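(* Over $\mathsf{RCA}_0$ the following are equivalent: (1) $\Sigma^1_1\text{-}\mathsf{AC}_0$; (2) if $\langle G_i : i\in\mathbb{N}\rangle$ is a sequence of graphs such that each $G_i$ has a Hamilton path, then there is a sequence $\langle P_i : i\in\mathbb{N}\rangle$ such that for each $i$, $P_i$ is a Hamilton path through $G_i$.
   Context: Work in second-order arithmetic, whose number variables range over $\mathbb{N}$ and set variables over subsets of $\mathbb{N}$; finite sequences, functions, sequences of graphs, etc. are coded by sets of natural numbers in the standard way. $\mathsf{RCA}_0$ is the subsystem consisting of the basic axioms of Peano arithmetic, induction restricted to $\Sigma^0_1$ formulas, and recursive comprehension (any set definable by both a $\Sigma^0_1$ formula and a $\Pi^0_1$ formula, with set parameters, exists). $\Sigma^1_1\text{-}\mathsf{AC}_0$ is $\mathsf{RCA}_0$ together with the scheme $(\forall k\,\exists X\,\Psi(k,X))\rightarrow \exists Y\,\forall k\,\Psi(k,(Y)_k)$ for every $\Sigma^1_1$ formula $\Psi$, where $(Y)_k=\{i:(i,k)\in Y\}$. A graph $G=\langle V,E\rangle$ has vertex set $V\subseteq\mathbb{N}$ and edge set $E$ a set of unordered pairs of elements of $V$. A path in $G$ is a sequence of vertices $v_0,v_1,v_2,\dots$ (indexed by $\mathbb{N}$) such that $(v_i,v_{i+1})\in E$ for every $i$; it is a (one-way) Hamilton path if it uses every vertex of $G$ exactly once. *)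

theory Defs
  imports Main
begin

section \<open>The language of second-order arithmetic\<close>

text \<open>Number variables and set variables are two separate families, both named by naturals:
  in \<open>AllN x \<phi>\<close> the index \<open>x\<close> names a number variable, in \<open>AllS X \<phi>\<close> a set variable. There is no
  equality between sets; as usual it is an abbreviation for extensional equality.\<close>

datatype trm =
    Var nat
  | Zero (\<open>\<^bold>0\<close>)
  | One (\<open>\<^bold>1\<close>)
  | Add trm trm (infixl \<open>\<^bold>+\<close> 65)
  | Mul trm trm (infixl \<open>\<^bold>*\<close> 70)

datatype fm =
    Eq trm trm (infix \<open>\<^bold>=\<close> 50)
  | Less trm trm (infix \<open>\<^bold><\<close> 50)
  | Mem trm nat (infix \<open>\<^bold>\<in>\<close> 50)
  | Neg fm (\<open>\<^bold>\<not> _\<close> [40] 40)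
  | And fm fm (infixr \<open>\<^bold>\<and>\<close> 35)
  | Or fm fm (infixr \<open>\<^bold>\<or>\<close> 30)
  | Imp fm fm (infixr \<open>\<^bold>\<longrightarrow>\<close> 25)
  | Iff fm fm (infixr \<open>\<^bold>\<longleftrightarrow>\<close> 25)
  | AllN nat fm
  | ExN nat fm
  | AllS nat fm
  | ExS nat fm

primrec tvars :: "trm \<Rightarrow> nat set" where
  "tvars (Var x) = {x}"
| "tvars \<^bold>0 = {}"
| "tvars \<^bold>1 = {}"
| "tvars (s \<^bold>+ t) = tvars s \<union> tvars t"
| "tvars (s \<^bold>* t) = tvars s \<union> tvars t"

text \<open>Free number variables and free set variables of a formula.\<close>

primrec fvN :: "fm \<Rightarrow> nat set" where
  "fvN (s \<^bold>= t) = tvars s \<union> tvars t"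
| "fvN (s \<^bold>< t) = tvars s \<union> tvars t"
| "fvN (t \<^bold>\<in> X) = tvars t"
| "fvN (\<^bold>\<not> \<phi>) = fvN \<phi>"
| "fvN (\<phi> \<^bold>\<and> \<psi>) = fvN \<phi> \<union> fvN \<psi>"
| "fvN (\<phi> \<^bold>\<or> \<psi>) = fvN \<phi> \<union> fvN \<psi>"
| "fvN (\<phi> \<^bold>\<longrightarrow> \<psi>) = fvN \<phi> \<union> fvN \<psi>"
| "fvN (\<phi> \<^bold>\<longleftrightarrow> \<psi>) = fvN \<phi> \<union> fvN \<psi>"
| "fvN (AllN x \<phi>) = fvN \<phi> - {x}"
| "fvN (ExN x \<phi>) = fvN \<phi> - {x}"
| "fvN (AllS X \<phi>) = fvN \<phi>"
| "fvN (ExS X \<phi>) = fvN \<phi>"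

primrec fvS :: "fm \<Rightarrow> nat set" where
  "fvS (s \<^bold>= t) = {}"
| "fvS (s \<^bold>< t) = {}"
| "fvS (t \<^bold>\<in> X) = {X}"
| "fvS (\<^bold>\<not> \<phi>) = fvS \<phi>"
| "fvS (\<phi> \<^bold>\<and> \<psi>) = fvS \<phi> \<union> fvS \<psi>"
| "fvS (\<phi> \<^bold>\<or> \<psi>) = fvS \<phi> \<union> fvS \<psi>"
| "fvS (\<phi> \<^bold>\<longrightarrow> \<psi>) = fvS \<phi> \<union> fvS \<psi>"
| "fvS (\<phi> \<^bold>\<longleftrightarrow> \<psi>) = fvS \<phi> \<union> fvS \<psi>"
| "fvS (AllN x \<phi>) = fvS \<phi>"
| "fvS (ExN x \<phi>) = fvS \<phi>"
| "fvS (AllS X \<phi>) = fvS \<phi> - {X}"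
| "fvS (ExS X \<phi>) = fvS \<phi> - {X}"

section \<open>Structures and satisfaction\<close>

text \<open>As usual in reverse mathematics, a structure consists of a first-order part (here the whole
  type \<^typ>\<open>'a\<close>) and a nonempty collection of subsets of it, over which the set variables range.
  Neither part needs to be standard.\<close>

record 'a L2_structure =
  zero :: 'a
  one :: 'a
  add :: "'a \<Rightarrow> 'a \<Rightarrow> 'a"
  mul :: "'a \<Rightarrow> 'a \<Rightarrow> 'a"
  less :: "'a \<Rightarrow> 'a \<Rightarrow> bool"
  sets :: "'a set set"

primrec eval :: "'a L2_structure \<Rightarrow> (nat \<Rightarrow> 'a) \<Rightarrow> trm \<Rightarrow> 'a" where
  "eval M e (Var x) = e x"
| "eval M e \<^bold>0 = zero M"
| "eval M e \<^bold>1 = one M"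
| "eval M e (s \<^bold>+ t) = add M (eval M e s) (eval M e t)"
| "eval M e (s \<^bold>* t) = mul M (eval M e s) (eval M e t)"

primrec sat :: "'a L2_structure \<Rightarrow> (nat \<Rightarrow> 'a) \<Rightarrow> (nat \<Rightarrow> 'a set) \<Rightarrow> fm \<Rightarrow> bool" where
  "sat M e E (s \<^bold>= t) \<longleftrightarrow> eval M e s = eval M e t"
| "sat M e E (s \<^bold>< t) \<longleftrightarrow> less M (eval M e s) (eval M e t)"
| "sat M e E (t \<^bold>\<in> X) \<longleftrightarrow> eval M e t \<in> E X"
| "sat M e E (\<^bold>\<not> \<phi>) \<longleftrightarrow> \<not> sat M e E \<phi>"
| "sat M e E (\<phi> \<^bold>\<and> \<psi>) \<longleftrightarrow> sat M e E \<phi> \<and> sat M e E \<psi>"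
| "sat M e E (\<phi> \<^bold>\<or> \<psi>) \<longleftrightarrow> sat M e E \<phi> \<or> sat M e E \<psi>"
| "sat M e E (\<phi> \<^bold>\<longrightarrow> \<psi>) \<longleftrightarrow> (sat M e E \<phi> \<longrightarrow> sat M e E \<psi>)"
| "sat M e E (\<phi> \<^bold>\<longleftrightarrow> \<psi>) \<longleftrightarrow> (sat M e E \<phi> \<longleftrightarrow> sat M e E \<psi>)"
| "sat M e E (AllN x \<phi>) \<longleftrightarrow> (\<forall>a. sat M (e(x := a)) E \<phi>)"
| "sat M e E (ExN x \<phi>) \<longleftrightarrow> (\<exists>a. sat M (e(x := a)) E \<phi>)"
| "sat M e E (AllS X \<phi>) \<longleftrightarrow> (\<forall>A\<in>sets M. sat M e (E(X := A)) \<phi>)"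
| "sat M e E (ExS X \<phi>) \<longleftrightarrow> (\<exists>A\<in>sets M. sat M e (E(X := A)) \<phi>)"

text \<open>Truth of all universal closures of members of \<open>T\<close>.\<close>

definition models :: "'a L2_structure \<Rightarrow> fm set \<Rightarrow> bool" (infix \<open>\<Turnstile>\<close> 50) where
  "M \<Turnstile> T \<longleftrightarrow> sets M \<noteq> {} \<and> (\<forall>\<phi>\<in>T. \<forall>e E. range E \<subseteq> sets M \<longrightarrow> sat M e E \<phi>)"

section \<open>Classes of formulas\<close>

inductive bounded :: "fm \<Rightarrow> bool" where
  "bounded (s \<^bold>= t)"
| "bounded (s \<^bold>< t)"
| "bounded (t \<^bold>\<in> X)"
| "bounded \<phi> \<Longrightarrow> bounded (\<^bold>\<not> \<phi>)"
| "bounded \<phi> \<Longrightarrow> bounded \<psi> \<Longrightarrow> bounded (\<phi> \<^bold>\<and> \<psi>)"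
| "bounded \<phi> \<Longrightarrow> bounded \<psi> \<Longrightarrow> bounded (\<phi> \<^bold>\<or> \<psi>)"
| "bounded \<phi> \<Longrightarrow> bounded \<psi> \<Longrightarrow> bounded (\<phi> \<^bold>\<longrightarrow> \<psi>)"
| "bounded \<phi> \<Longrightarrow> bounded \<psi> \<Longrightarrow> bounded (\<phi> \<^bold>\<longleftrightarrow> \<psi>)"
| "bounded \<phi> \<Longrightarrow> x \<notin> tvars t \<Longrightarrow> bounded (AllN x (Var x \<^bold>< t \<^bold>\<longrightarrow> \<phi>))"
| "bounded \<phi> \<Longrightarrow> x \<notin> tvars t \<Longrightarrow> bounded (ExN x (Var x \<^bold>< t \<^bold>\<and> \<phi>))"

definition Sigma01 :: "fm set" where
  "Sigma01 = {ExN x \<theta> | x \<theta>. bounded \<theta>}"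

definition Pi01 :: "fm set" where
  "Pi01 = {AllN x \<theta> | x \<theta>. bounded \<theta>}"

primrec arithmetical :: "fm \<Rightarrow> bool" where
  "arithmetical (s \<^bold>= t) \<longleftrightarrow> True"
| "arithmetical (s \<^bold>< t) \<longleftrightarrow> True"
| "arithmetical (t \<^bold>\<in> X) \<longleftrightarrow> True"
| "arithmetical (\<^bold>\<not> \<phi>) \<longleftrightarrow> arithmetical \<phi>"
| "arithmetical (\<phi> \<^bold>\<and> \<psi>) \<longleftrightarrow> arithmetical \<phi> \<and> arithmetical \<psi>"
| "arithmetical (\<phi> \<^bold>\<or> \<psi>) \<longleftrightarrow> arithmetical \<phi> \<and> arithmetical \<psi>"
| "arithmetical (\<phi> \<^bold>\<longrightarrow> \<psi>) \<longleftrightarrow> arithmetical \<phi> \<and> arithmetical \<psi>"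
| "arithmetical (\<phi> \<^bold>\<longleftrightarrow> \<psi>) \<longleftrightarrow> arithmetical \<phi> \<and> arithmetical \<psi>"
| "arithmetical (AllN x \<phi>) \<longleftrightarrow> arithmetical \<phi>"
| "arithmetical (ExN x \<phi>) \<longleftrightarrow> arithmetical \<phi>"
| "arithmetical (AllS X \<phi>) \<longleftrightarrow> False"
| "arithmetical (ExS X \<phi>) \<longleftrightarrow> False"

definition Sigma11 :: "fm set" where
  "Sigma11 = {ExS X \<theta> | X \<theta>. arithmetical \<theta>}"

section \<open>Axiom systems\<close>

definition basic_axioms :: "fm set" where
  "basic_axioms = (let m = Var 0; n = Var 1 in
    {\<^bold>\<not> n \<^bold>+ \<^bold>1 \<^bold>= \<^bold>0,
     m \<^bold>+ \<^bold>1 \<^bold>= n \<^bold>+ \<^bold>1 \<^bold>\<longrightarrow> m \<^bold>= n,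
     m \<^bold>+ \<^bold>0 \<^bold>= m,
     m \<^bold>+ (n \<^bold>+ \<^bold>1) \<^bold>= (m \<^bold>+ n) \<^bold>+ \<^bold>1,
     m \<^bold>* \<^bold>0 \<^bold>= \<^bold>0,
     m \<^bold>* (n \<^bold>+ \<^bold>1) \<^bold>= m \<^bold>* n \<^bold>+ m,
     \<^bold>\<not> m \<^bold>< \<^bold>0,
     m \<^bold>< n \<^bold>+ \<^bold>1 \<^bold>\<longleftrightarrow> m \<^bold>< n \<^bold>\<or> m \<^bold>= n})"

text \<open>The substitution instance \<open>\<phi>(t/x)\<close>, written without a substitution operation as
  \<open>\<forall>x (x = t \<longrightarrow> \<phi>)\<close>; to be used only for terms \<open>t\<close> not containing \<open>x\<close>.\<close>

definition inst :: "fm \<Rightarrow> nat \<Rightarrow> trm \<Rightarrow> fm" where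
  "inst \<phi> x t = AllN x (Var x \<^bold>= t \<^bold>\<longrightarrow> \<phi>)"

lemma eval_upd: "x \<notin> tvars t \<Longrightarrow> eval M (e(x := a)) t = eval M e t"
  by (induction t) auto

lemma sat_inst:
  "x \<notin> tvars t \<Longrightarrow> sat M e E (inst \<phi> x t) \<longleftrightarrow> sat M (e(x := eval M e t)) E \<phi>"
  by (simp add: inst_def eval_upd)

definition Sigma01_induction :: "fm set" where
  "Sigma01_induction =
    {inst \<phi> x \<^bold>0 \<^bold>\<and> AllN y (inst \<phi> x (Var y) \<^bold>\<longrightarrow> inst \<phi> x (Var y \<^bold>+ \<^bold>1)) \<^bold>\<longrightarrow> AllN x \<phi>
     | \<phi> x y. \<phi> \<in> Sigma01 \<and> y \<noteq> x \<and> y \<notin> fvN \<phi>}"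

definition Delta01_comprehension :: "fm set" where
  "Delta01_comprehension =
    {AllN x (\<phi> \<^bold>\<longleftrightarrow> \<psi>) \<^bold>\<longrightarrow> ExS X (AllN x (Var x \<^bold>\<in> X \<^bold>\<longleftrightarrow> \<phi>))
     | \<phi> \<psi> x X. \<phi> \<in> Sigma01 \<and> \<psi> \<in> Pi01 \<and> X \<notin> fvS \<phi>}"

definition RCA0 :: "fm set" where
  "RCA0 = basic_axioms \<union> Sigma01_induction \<union> Delta01_comprehension"

text \<open>The code \<open>(s + t)\<^sup>2 + s\<close> of the ordered pair of \<open>s\<close> and \<open>t\<close>.\<close>

definition pr :: "trm \<Rightarrow> trm \<Rightarrow> trm" where
  "pr s t = (s \<^bold>+ t) \<^bold>* (s \<^bold>+ t) \<^bold>+ s"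

text \<open>Defined sets such as \<open>(Y)\<^sub>k\<close> are represented by functions \<open>A\<close> of type \<^typ>\<open>trm \<Rightarrow> fm\<close>,
  where \<open>A t\<close> is the formula expressing \<open>t \<in> A\<close>.\<close>

definition setvar :: "nat \<Rightarrow> trm \<Rightarrow> fm" where
  "setvar Y = (\<lambda>t. t \<^bold>\<in> Y)"

definition sec :: "(trm \<Rightarrow> fm) \<Rightarrow> trm \<Rightarrow> trm \<Rightarrow> fm" where
  "sec A k = (\<lambda>t. A (pr t k))"

text \<open>The formula \<open>\<Psi>(k, (Y)\<^sub>k)\<close> is written as \<open>\<exists>X (X = (Y)\<^sub>k \<and> \<Psi>(k, X))\<close>.\<close>

definition Sigma11_AC0 :: "fm set" where
  "Sigma11_AC0 = RCA0 \<union>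
    {AllN k (ExS X \<Psi>) \<^bold>\<longrightarrow>
       ExS Y (AllN k (ExS X
         (AllN i (Var i \<^bold>\<in> X \<^bold>\<longleftrightarrow> sec (setvar Y) (Var k) (Var i)) \<^bold>\<and> \<Psi>)))
     | \<Psi> k X Y i. \<Psi> \<in> Sigma11 \<and> Y \<notin> fvS \<Psi> \<and> Y \<noteq> X \<and> i \<noteq> k}"

section \<open>Graphs and Hamilton paths\<close>

text \<open>A graph \<open>G = \<langle>V, E\<rangle>\<close> is coded by a set with \<open>V = (G)\<^sub>0\<close> and \<open>E = (G)\<^sub>1\<close>; a set of unordered
  pairs is a symmetric set of ordered pairs. A path \<open>P\<close> is a function from numbers to vertices,
  coded by the set of pairs \<open>(n, v\<^sub>n)\<close>. The formulas below bind number variables from 1 to 3,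
  so these must not occur free in the sets they are applied to.\<close>

definition vertices :: "(trm \<Rightarrow> fm) \<Rightarrow> trm \<Rightarrow> fm" where
  "vertices G = sec G \<^bold>0"

definition edges :: "(trm \<Rightarrow> fm) \<Rightarrow> trm \<Rightarrow> fm" where
  "edges G = sec G \<^bold>1"

definition graph_fm :: "(trm \<Rightarrow> fm) \<Rightarrow> fm" where
  "graph_fm G = (let z = 1; u = 2; v = 3 in
     AllN z (edges G (Var z) \<^bold>\<longrightarrow>
       ExN u (ExN v (Var z \<^bold>= pr (Var u) (Var v) \<^bold>\<and>
         vertices G (Var u) \<^bold>\<and> vertices G (Var v) \<^bold>\<and> edges G (pr (Var v) (Var u))))))"

definition path_fm :: "(trm \<Rightarrow> fm) \<Rightarrow> (trm \<Rightarrow> fm) \<Rightarrow> fm" where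
  "path_fm G P = (let z = 1; n = 1; u = 2; v = 3 in
     AllN z (P (Var z) \<^bold>\<longrightarrow>
       ExN u (ExN v (Var z \<^bold>= pr (Var u) (Var v) \<^bold>\<and> vertices G (Var v)))) \<^bold>\<and>
     AllN n (ExN u (P (pr (Var n) (Var u)) \<^bold>\<and>
       AllN v (P (pr (Var n) (Var v)) \<^bold>\<longrightarrow> Var v \<^bold>= Var u))) \<^bold>\<and>
     AllN n (AllN u (AllN v
       (P (pr (Var n) (Var u)) \<^bold>\<and> P (pr (Var n \<^bold>+ \<^bold>1) (Var v)) \<^bold>\<longrightarrow>
        edges G (pr (Var u) (Var v))))))"

definition hamilton_path_fm :: "(trm \<Rightarrow> fm) \<Rightarrow> (trm \<Rightarrow> fm) \<Rightarrow> fm" where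
  "hamilton_path_fm G P = (let v = 1; n = 2; m = 3 in
     path_fm G P \<^bold>\<and>
     AllN v (vertices G (Var v) \<^bold>\<longrightarrow>
       ExN n (P (pr (Var n) (Var v)) \<^bold>\<and>
         AllN m (P (pr (Var m) (Var v)) \<^bold>\<longrightarrow> Var m \<^bold>= Var n))))"

definition hamilton_sequences :: fm where
  "hamilton_sequences = (let i = 0; G = 0; P = 1 in
     AllS G
       (AllN i (graph_fm (sec (setvar G) (Var i)) \<^bold>\<and>
          ExS P (hamilton_path_fm (sec (setvar G) (Var i)) (setvar P))) \<^bold>\<longrightarrow>
        ExS P (AllN i (hamilton_path_fm (sec (setvar G) (Var i)) (sec (setvar P) (Var i))))))"

end

theory Submission
  imports Defs
begin

text \<open>From choice to paths, apply the axiom to the formula saying that \<open>X\<close> is a Hamilton path of the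
  \<open>k\<close>-th graph. Conversely, one solves sequences of satisfiable systems of (infinite) clauses. Such a
  system becomes a graph as in the reduction of satisfiability to Hamilton paths: the path passes a
  sequence of blocks, choosing a truth value in each, and gadgets keep the copies of a variable
  consistent. That a Hamilton path solves the system only uses that inner vertices have two
  neighbours on the path and that a path has no cycles. All passes have the same
  length, whichever values are chosen, so the path given by a solution is \<open>\<Delta>\<^sup>0\<^sub>1\<close> in
  it and no coding of finite sequences is needed. Clause systems yield arithmetical comprehension,
  hence truth sets of arithmetical formulas; since Tarski's conditions on truth sets are themselves
  (infinite) clauses, the choice of solutions gives the choice of witnesses for \<open>\<Sigma>\<^sup>1\<^sub>1\<close> formulas.\<close>

section \<open>Formulas under renaming\<close>

text \<open>The path for a given solution has to be a set of a possibly nonstandard model in which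
  only recursive comprehension is known. Arguments inside the model therefore concern relations
  defined by bounded formulas with parameters, and many statements carry explicit bounds to stay in
  that class; functions that are not polynomials enter through their graphs. Every block passes
  exactly one clause segment and every segment must be passed, so several true literals of a clause
  must not compete for one segment. Hence a clause has one reserved segment and free ones for all
  its other blocks, and a shift as in Hilbert's hotel matches blocks with segments for every
  solution. A gadget is a hexagon made of the top row of one copy of a variable and the bottom row
  of its neighbour. From a Hamilton path only one implication between the values at neighbouring
  copies is derived. This is enough because the copies are ordered with all positive occurrences
  before all negative ones.\<close>

primrec rent :: "(nat \<Rightarrow> nat) \<Rightarrow> trm \<Rightarrow> trm" where
  "rent f (Var x) = Var (f x)"
| "rent f \<^bold>0 = \<^bold>0"
| "rent f \<^bold>1 = \<^bold>1"
| "rent f (s \<^bold>+ t) = rent f s \<^bold>+ rent f t"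
| "rent f (s \<^bold>* t) = rent f s \<^bold>* rent f t"

primrec ren :: "(nat \<Rightarrow> nat) \<Rightarrow> (nat \<Rightarrow> nat) \<Rightarrow> fm \<Rightarrow> fm" where
  "ren f g (s \<^bold>= t) = (rent f s \<^bold>= rent f t)"
| "ren f g (s \<^bold>< t) = (rent f s \<^bold>< rent f t)"
| "ren f g (t \<^bold>\<in> X) = (rent f t \<^bold>\<in> g X)"
| "ren f g (\<^bold>\<not> \<phi>) = (\<^bold>\<not> ren f g \<phi>)"
| "ren f g (\<phi> \<^bold>\<and> \<psi>) = (ren f g \<phi> \<^bold>\<and> ren f g \<psi>)"
| "ren f g (\<phi> \<^bold>\<or> \<psi>) = (ren f g \<phi> \<^bold>\<or> ren f g \<psi>)"
| "ren f g (\<phi> \<^bold>\<longrightarrow> \<psi>) = (ren f g \<phi> \<^bold>\<longrightarrow> ren f g \<psi>)"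
| "ren f g (\<phi> \<^bold>\<longleftrightarrow> \<psi>) = (ren f g \<phi> \<^bold>\<longleftrightarrow> ren f g \<psi>)"
| "ren f g (AllN x \<phi>) = AllN (f x) (ren f g \<phi>)"
| "ren f g (ExN x \<phi>) = ExN (f x) (ren f g \<phi>)"
| "ren f g (AllS X \<phi>) = AllS (g X) (ren f g \<phi>)"
| "ren f g (ExS X \<phi>) = ExS (g X) (ren f g \<phi>)"

lemma eval_rent: "eval M e (rent f t) = eval M (e \<circ> f) t"
  by (induction t) auto

lemma tvars_rent: "tvars (rent f t) = f ` tvars t"
  by (induction t) auto

lemma fun_upd_comp_inj: "inj f \<Longrightarrow> (e(f x := a)) \<circ> f = (e \<circ> f)(x := a)"
  by (auto simp: fun_eq_iff inj_def)

text \<open>\<open>f\<close> is injective since it also renames bound number variables.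
  \<open>g\<close> may identify set variables, as a bounded formula binds none.\<close>

lemma sat_ren:
  "bounded \<phi> \<Longrightarrow> inj f \<Longrightarrow> sat M e E (ren f g \<phi>) \<longleftrightarrow> sat M (e \<circ> f) (E \<circ> g) \<phi>"
  by (induction \<phi> arbitrary: e rule: bounded.induct) (auto simp: eval_rent fun_upd_comp_inj)

lemma bounded_ren: "bounded \<phi> \<Longrightarrow> inj f \<Longrightarrow> bounded (ren f g \<phi>)"
  by (induction \<phi> rule: bounded.induct)
     (auto intro!: bounded.intros simp: tvars_rent inj_eq)

lemma eval_cong: "(\<And>x. x \<in> tvars t \<Longrightarrow> e x = e' x) \<Longrightarrow> eval M e t = eval M e' t"
  by (induction t) auto

lemma sat_cong:
  "(\<And>x. x \<in> fvN \<phi> \<Longrightarrow> e x = e' x) \<Longrightarrow> (\<And>X. X \<in> fvS \<phi> \<Longrightarrow> E X = E' X) \<Longrightarrow>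
   sat M e E \<phi> \<longleftrightarrow> sat M e' E' \<phi>"
proof (induction \<phi> arbitrary: e e' E E')
  case (Eq s t)
  then show ?case using eval_cong[of s e e' M] eval_cong[of t e e' M] by auto
next
  case (Less s t)
  then show ?case using eval_cong[of s e e' M] eval_cong[of t e e' M] by auto
next
  case (Mem t X)
  then show ?case using eval_cong[of t e e' M] by auto
next
  case (Neg \<phi>)
  have "sat M e E \<phi> = sat M e' E' \<phi>" by (rule Neg.IH) (use Neg.prems in auto)
  then show ?case by simp
next
  case (And \<phi> \<psi>)
  have "sat M e E \<phi> = sat M e' E' \<phi>" "sat M e E \<psi> = sat M e' E' \<psi>"
    by (rule And.IH; use And.prems in auto)+
  then show ?case by simp
next
  case (Or \<phi> \<psi>)
  have "sat M e E \<phi> = sat M e' E' \<phi>" "sat M e E \<psi> = sat M e' E' \<psi>"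
    by (rule Or.IH; use Or.prems in auto)+
  then show ?case by simp
next
  case (Imp \<phi> \<psi>)
  have "sat M e E \<phi> = sat M e' E' \<phi>" "sat M e E \<psi> = sat M e' E' \<psi>"
    by (rule Imp.IH; use Imp.prems in auto)+
  then show ?case by simp
next
  case (Iff \<phi> \<psi>)
  have "sat M e E \<phi> = sat M e' E' \<phi>" "sat M e E \<psi> = sat M e' E' \<psi>"
    by (rule Iff.IH; use Iff.prems in auto)+
  then show ?case by simp
next
  case (AllN x \<phi>)
  have "sat M (e(x := a)) E \<phi> = sat M (e'(x := a)) E' \<phi>" for a
    by (rule AllN.IH) (use AllN.prems in auto)
  then show ?case by simp
next
  case (ExN x \<phi>)
  have "sat M (e(x := a)) E \<phi> = sat M (e'(x := a)) E' \<phi>" for a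
    by (rule ExN.IH) (use ExN.prems in auto)
  then show ?case by simp
next
  case (AllS X \<phi>)
  have "sat M e (E(X := A)) \<phi> = sat M e' (E'(X := A)) \<phi>" for A
    by (rule AllS.IH) (use AllS.prems in auto)
  then show ?case by simp
next
  case (ExS X \<phi>)
  have "sat M e (E(X := A)) \<phi> = sat M e' (E'(X := A)) \<phi>" for A
    by (rule ExS.IH) (use ExS.prems in auto)
  then show ?case by simp
qed

lemma finite_tvars: "finite (tvars t)"
  by (induction t) auto

lemma finite_fvS: "finite (fvS \<phi>)"
  by (induction \<phi>) auto

section \<open>Definable relations of a structure\<close>

text \<open>Even positions hold the arguments of a relation; odd positions are left for parameters
  and for bound variables.\<close>

definition mix :: "(nat \<Rightarrow> 'b) \<Rightarrow> (nat \<Rightarrow> 'b) \<Rightarrow> nat \<Rightarrow> 'b" where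
  "mix e p n = (if even n then e (n div 2) else p (n div 2))"

definition definable :: "'a L2_structure \<Rightarrow> ((nat \<Rightarrow> 'a) \<Rightarrow> bool) \<Rightarrow> bool" where
  "definable M R \<longleftrightarrow> (\<exists>\<phi> E p. bounded \<phi> \<and> range E \<subseteq> sets M \<and> (\<forall>e. sat M (mix e p) E \<phi> \<longleftrightarrow> R e))"

text \<open>Only polynomials with parameters are terms; any other function \<open>f\<close> is
  handled through the relation \<open>s e = f (t e)\<close>.\<close>

definition definable_term :: "'a L2_structure \<Rightarrow> ((nat \<Rightarrow> 'a) \<Rightarrow> 'a) \<Rightarrow> bool" where
  "definable_term M t \<longleftrightarrow> (\<exists>s p. \<forall>e. eval M (mix e p) s = t e)"

text \<open>The odd position \<open>2 * m + 1\<close> goes to \<open>4 * m + 1\<close>, and under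
  \<open>right_ren\<close> to \<open>4 * m + 3\<close>: two formulas share their arguments and keep
  their parameters apart.\<close>

definition left_ren :: "nat \<Rightarrow> nat" where
  "left_ren n = (if even n then n else 2 * n - 1)"

definition right_ren :: "nat \<Rightarrow> nat" where
  "right_ren n = (if even n then n else 2 * n + 1)"

text \<open>Makes room for a new argument at position 0: the old one becomes a bound variable.\<close>

definition bind_ren :: "nat \<Rightarrow> nat" where
  "bind_ren n = (if n = 0 then 1 else if even n then n - 2 else n + 2)"

lemma parity_cases:
  fixes n :: nat
  obtains m where "n = 2 * m" | m where "n = 2 * m + 1"
  by (metis evenE oddE)

lemma inj_left_ren: "inj left_ren"
proof (rule inj_on_inverseI[of _ "\<lambda>n. if even n then n else (n + 1) div 2"])
  fix n show "(if even (left_ren n) then left_ren n else (left_ren n + 1) div 2) = n"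
    by (rule parity_cases[of n]) (simp_all add: left_ren_def)
qed

lemma inj_right_ren: "inj right_ren"
proof (rule inj_on_inverseI[of _ "\<lambda>n. if even n then n else (n - 1) div 2"])
  fix n show "(if even (right_ren n) then right_ren n else (right_ren n - 1) div 2) = n"
    by (rule parity_cases[of n]) (simp_all add: right_ren_def)
qed

lemma bind_ren_simps: "bind_ren 0 = 1" "bind_ren (2 * m + 2) = 2 * m" "bind_ren (2 * m + 1) = 2 * m + 3"
  by (simp_all add: bind_ren_def)

lemma parity_cases_Suc:
  fixes n :: nat
  obtains "n = 0" | m where "n = 2 * m + 2" | m where "n = 2 * m + 1"
proof (cases n rule: parity_cases)
  case (1 m)
  then show ?thesis using that by (cases m) auto
qed (use that in auto)

lemma inj_bind_ren: "inj bind_ren"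
proof (rule injI)
  fix m n assume "bind_ren m = bind_ren n"
  then show "m = n"
    by (cases m rule: parity_cases_Suc; cases n rule: parity_cases_Suc)
       (simp_all only: bind_ren_simps, presburger+)
qed

lemma mix_simps: "mix e p (2 * n) = e n" "mix e p (2 * n + 1) = p n"
  by (simp_all add: mix_def)

lemma mix_left_ren: "mix e (mix p q) \<circ> left_ren = mix e p"
proof
  fix n
  have "left_ren (2 * m + 1) = 2 * (2 * m) + 1" "left_ren (2 * m) = 2 * m" for m
    by (simp_all add: left_ren_def)
  then show "(mix e (mix p q) \<circ> left_ren) n = mix e p n"
    by (cases n rule: parity_cases) (simp_all only: o_apply mix_simps)
qed

lemma mix_right_ren: "mix e (mix p q) \<circ> right_ren = mix e q"
proof
  fix n
  have "right_ren (2 * m + 1) = 2 * (2 * m + 1) + 1" "right_ren (2 * m) = 2 * m" for m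
    by (simp_all add: right_ren_def)
  then show "(mix e (mix p q) \<circ> right_ren) n = mix e q n"
    by (cases n rule: parity_cases) (simp_all only: o_apply mix_simps)
qed

lemma mix_double: "mix E F \<circ> (\<lambda>n. 2 * n) = E" "mix E F \<circ> (\<lambda>n. 2 * n + 1) = F"
  by (auto simp: mix_def)

lemma range_mix: "range E \<subseteq> S \<Longrightarrow> range F \<subseteq> S \<Longrightarrow> range (mix E F) \<subseteq> S"
  by (auto simp: mix_def)

lemma mix_bind_ren:
  "(mix e (case_nat b p))(1 := a) \<circ> bind_ren = mix (case_nat a e) p"
proof
  fix n
  have "mix f q (2 * m + 2) = f (Suc m)" "mix f q (2 * m + 3) = q (Suc m)" for f q :: "nat \<Rightarrow> 'a" and m
    by (simp_all add: mix_def)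
  then show "((mix e (case_nat b p))(1 := a) \<circ> bind_ren) n = mix (case_nat a e) p n"
    by (cases n rule: parity_cases_Suc)
       (simp_all add: bind_ren_simps[simplified] mix_simps[simplified] mix_def[of _ _ 0])
qed

lemma definable_pair:
  assumes "definable M R" "definable M S"
  obtains \<phi> \<psi> E p where "bounded \<phi>" "bounded \<psi>" "range E \<subseteq> sets M"
    "\<And>e. sat M (mix e p) E \<phi> \<longleftrightarrow> R e" "\<And>e. sat M (mix e p) E \<psi> \<longleftrightarrow> S e"
proof -
  obtain \<phi> E p where 1: "bounded \<phi>" "range E \<subseteq> sets M" "\<And>e. sat M (mix e p) E \<phi> \<longleftrightarrow> R e"
    using assms(1) unfolding definable_def by blast
  obtain \<psi> F q where 2: "bounded \<psi>" "range F \<subseteq> sets M" "\<And>e. sat M (mix e q) F \<psi> \<longleftrightarrow> S e"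
    using assms(2) unfolding definable_def by blast
  show thesis
    by (rule that[of "ren left_ren (\<lambda>n. 2 * n) \<phi>" "ren right_ren (\<lambda>n. 2 * n + 1) \<psi>"
            "mix E F" "mix p q"])
       (use 1 2 in \<open>simp_all add: bounded_ren sat_ren inj_left_ren inj_right_ren mix_left_ren
          mix_right_ren mix_double range_mix del: One_nat_def\<close>)
qed

lemma definable_term_pair:
  assumes "definable_term M s" "definable_term M t"
  obtains s' t' p where "\<And>e. eval M (mix e p) s' = s e" "\<And>e. eval M (mix e p) t' = t e"
proof -
  obtain s' p where 1: "\<And>e. eval M (mix e p) s' = s e"
    using assms(1) unfolding definable_term_def by blast
  obtain t' q where 2: "\<And>e. eval M (mix e q) t' = t e"
    using assms(2) unfolding definable_term_def by blast
  show thesis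
    by (rule that[of "mix p q" "rent left_ren s'" "rent right_ren t'"])
       (simp_all add: eval_rent mix_left_ren mix_right_ren 1 2)
qed

section \<open>Closure properties of bounded definability\<close>

named_theorems definable_intros

lemma definable_term_var [definable_intros]: "definable_term M (\<lambda>e. e k)"
  unfolding definable_term_def by (rule exI[of _ "Var (2 * k)"]) (auto simp: mix_def)

lemma definable_term_const [definable_intros]: "definable_term M (\<lambda>e. c)"
  unfolding definable_term_def by (rule exI[of _ "Var 1"]) (auto simp: mix_def)

lemma definable_term_add [definable_intros]:
  assumes "definable_term M s" "definable_term M t"
  shows "definable_term M (\<lambda>e. add M (s e) (t e))"
proof -
  from assms obtain s' t' p
    where "\<And>e. eval M (mix e p) s' = s e" "\<And>e. eval M (mix e p) t' = t e"
    by (rule definable_term_pair) blast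
  then show ?thesis
    unfolding definable_term_def by (intro exI[of _ "s' \<^bold>+ t'"] exI[of _ p]) simp
qed

lemma definable_term_mul [definable_intros]:
  assumes "definable_term M s" "definable_term M t"
  shows "definable_term M (\<lambda>e. mul M (s e) (t e))"
proof -
  from assms obtain s' t' p
    where "\<And>e. eval M (mix e p) s' = s e" "\<And>e. eval M (mix e p) t' = t e"
    by (rule definable_term_pair) blast
  then show ?thesis
    unfolding definable_term_def by (intro exI[of _ "s' \<^bold>* t'"] exI[of _ p]) simp
qed

lemma definable_not [definable_intros]:
  assumes "definable M R" shows "definable M (\<lambda>e. \<not> R e)"
proof -
  obtain \<phi> E p where "bounded \<phi>" "range E \<subseteq> sets M" "\<And>e. sat M (mix e p) E \<phi> \<longleftrightarrow> R e"
    using assms unfolding definable_def by blast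
  then show ?thesis
    unfolding definable_def
    by (intro exI[of _ "\<^bold>\<not> \<phi>"] exI[of _ E] exI[of _ p]) (simp add: bounded.intros image_subset_iff)
qed

lemma definable_conj [definable_intros]:
  assumes "definable M R" "definable M S" shows "definable M (\<lambda>e. R e \<and> S e)"
proof -
  from assms obtain \<phi> \<psi> E p where "bounded \<phi>" "bounded \<psi>" "range E \<subseteq> sets M"
    "\<And>e. sat M (mix e p) E \<phi> \<longleftrightarrow> R e" "\<And>e. sat M (mix e p) E \<psi> \<longleftrightarrow> S e"
    by (rule definable_pair) blast
  then show ?thesis
    unfolding definable_def
    by (intro exI[of _ "\<phi> \<^bold>\<and> \<psi>"] exI[of _ E] exI[of _ p]) (simp add: bounded.intros image_subset_iff)
qed

lemma definable_disj [definable_intros]: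
  assumes "definable M R" "definable M S" shows "definable M (\<lambda>e. R e \<or> S e)"
  using definable_not[OF definable_conj[OF assms[THEN definable_not]]] by simp

lemma definable_imp [definable_intros]:
  assumes "definable M R" "definable M S" shows "definable M (\<lambda>e. R e \<longrightarrow> S e)"
  unfolding imp_conv_disj by (intro definable_disj definable_not assms)

lemma definable_iff [definable_intros]:
  assumes "definable M R" "definable M S" shows "definable M (\<lambda>e. R e \<longleftrightarrow> S e)"
  unfolding iff_conv_conj_imp
  by (intro definable_conj definable_imp assms)

text \<open>Even a formula without set variables is evaluated under an assignment \<open>E\<close>
  of sets, whence the nonemptiness.\<close>

lemma definable_eq_if_nonempty:
  assumes "sets M \<noteq> {}" "definable_term M s" "definable_term M t"
  shows "definable M (\<lambda>e. s e = t e)"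
proof -
  obtain A where "A \<in> sets M" using assms(1) by blast
  from assms(2,3) obtain s' t' p
    where "\<And>e. eval M (mix e p) s' = s e" "\<And>e. eval M (mix e p) t' = t e"
    by (rule definable_term_pair) blast
  with \<open>A \<in> sets M\<close> show ?thesis
    unfolding definable_def
    by (intro exI[of _ "s' \<^bold>= t'"] exI[of _ "\<lambda>_. A"] exI[of _ p]) (simp add: bounded.intros image_subset_iff)
qed

lemma definable_less_if_nonempty:
  assumes "sets M \<noteq> {}" "definable_term M s" "definable_term M t"
  shows "definable M (\<lambda>e. less M (s e) (t e))"
proof -
  obtain A where "A \<in> sets M" using assms(1) by blast
  from assms(2,3) obtain s' t' p
    where "\<And>e. eval M (mix e p) s' = s e" "\<And>e. eval M (mix e p) t' = t e"
    by (rule definable_term_pair) blast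
  with \<open>A \<in> sets M\<close> show ?thesis
    unfolding definable_def
    by (intro exI[of _ "s' \<^bold>< t'"] exI[of _ "\<lambda>_. A"] exI[of _ p]) (simp add: bounded.intros image_subset_iff)
qed

lemma definable_mem [definable_intros]:
  assumes "A \<in> sets M" "definable_term M t"
  shows "definable M (\<lambda>e. t e \<in> A)"
proof -
  obtain t' p where "\<And>e. eval M (mix e p) t' = t e"
    using assms(2) unfolding definable_term_def by blast
  with assms(1) show ?thesis
    unfolding definable_def
    by (intro exI[of _ "t' \<^bold>\<in> 0"] exI[of _ "\<lambda>_. A"] exI[of _ p]) (simp add: bounded.intros image_subset_iff)
qed

text \<open>Variables are treated in de Bruijn style: in the hypothesis, argument 0 stands for the
  quantified number and the other arguments have moved up by one. \<open>bind_ren\<close> then puts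
  that number at the odd position 1.\<close>

lemma definable_ex_less [definable_intros]:
  assumes t: "definable_term M t" and R: "definable M (\<lambda>e. R (\<lambda>n. e (Suc n)) (e 0))"
  shows "definable M (\<lambda>e. \<exists>a. less M a (t e) \<and> R e a)"
proof -
  obtain t' q where t': "\<And>e. eval M (mix e q) t' = t e"
    using t unfolding definable_term_def by blast
  obtain \<phi> E p where \<phi>: "bounded \<phi>" "range E \<subseteq> sets M"
    and sat\<phi>: "\<And>e. sat M (mix e p) E \<phi> \<longleftrightarrow> R (\<lambda>n. e (Suc n)) (e 0)"
    using R unfolding definable_def by blast
  \<comment> \<open>The first parameter is a placeholder at the position of the bound variable; all
    others move up.\<close>
  define P where "P = case_nat undefined (mix p q)"
  define \<psi> where "\<psi> = ren bind_ren id (ren left_ren id \<phi>)"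
  \<comment> \<open>keeps the bound variable 1 out of the bounding term\<close>
  define r where "r = (\<lambda>n::nat. if even n then n else n + 2)"
  define u where "u = rent r (rent right_ren t')"
  have 1: "1 \<notin> tvars u" unfolding u_def r_def tvars_rent by (auto split: if_splits)
  have "mix e P \<circ> r = mix e (mix p q)" for e
    unfolding P_def r_def mix_def by (auto simp: fun_eq_iff)
  then have u: "eval M (mix e P) u = t e" for e
    unfolding u_def by (simp add: eval_rent mix_right_ren t')
  have \<psi>: "sat M ((mix e P)(1 := a)) E \<psi> \<longleftrightarrow> R e a" for e a
    unfolding \<psi>_def P_def
    by (simp add: sat_ren bounded_ren \<phi> inj_bind_ren inj_left_ren mix_bind_ren mix_left_ren sat\<phi>
        del: One_nat_def)
  have "bounded (ExN 1 (Var 1 \<^bold>< u \<^bold>\<and> \<psi>))"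
    unfolding \<psi>_def by (intro bounded.intros bounded_ren \<phi> inj_bind_ren inj_left_ren 1)
  moreover have "sat M (mix e P) E (ExN 1 (Var 1 \<^bold>< u \<^bold>\<and> \<psi>)) \<longleftrightarrow> (\<exists>a. less M a (t e) \<and> R e a)" for e
    using \<psi>[of e] by (simp add: eval_upd[OF 1, simplified] u)
  ultimately show ?thesis
    unfolding definable_def using \<phi>(2) by blast
qed

lemma definable_all_less [definable_intros]:
  assumes t: "definable_term M t" and R: "definable M (\<lambda>e. R (\<lambda>n. e (Suc n)) (e 0))"
  shows "definable M (\<lambda>e. \<forall>a. less M a (t e) \<longrightarrow> R e a)"
proof -
  have "definable M (\<lambda>e. \<not> (\<exists>a. less M a (t e) \<and> \<not> R e a))"
    by (intro definable_not definable_ex_less assms)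
  then show ?thesis by simp
qed

section \<open>Arithmetic in models of RCA0\<close>

lemma mix_upd: "mix e p 0 = e 0" "(mix e p)(0 := a) = mix (e(0 := a)) p" "(mix e p)(2 := a) = mix (e(1 := a)) p"
  by (auto simp: mix_def fun_eq_iff)

locale rca =
  fixes M :: "'a L2_structure"
  assumes rca: "M \<Turnstile> RCA0"
begin

abbreviation zero_M (\<open>\<zero>\<close>) where "\<zero> \<equiv> zero M"
abbreviation one_M (\<open>\<one>\<close>) where "\<one> \<equiv> one M"
abbreviation add_M (infixl \<open>\<oplus>\<close> 65) where "a \<oplus> b \<equiv> add M a b"
abbreviation mul_M (infixl \<open>\<otimes>\<close> 70) where "a \<otimes> b \<equiv> mul M a b"
abbreviation less_M (infix \<open>\<prec>\<close> 50) where "a \<prec> b \<equiv> less M a b"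

lemma sets_nonempty: "sets M \<noteq> {}"
  using rca by (simp add: models_def)

lemma satisfies: "\<phi> \<in> RCA0 \<Longrightarrow> range E \<subseteq> sets M \<Longrightarrow> sat M e E \<phi>"
  using rca by (simp add: models_def)

lemmas definable_eq [definable_intros] = definable_eq_if_nonempty[OF sets_nonempty]
lemmas definable_less [definable_intros] = definable_less_if_nonempty[OF sets_nonempty]

lemma definable_const [definable_intros]: "definable M (\<lambda>e. P)"
proof -
  have "definable M (\<lambda>e. e 0 = e 0)" "definable M (\<lambda>e. \<not> e 0 = e 0)"
    by (intro definable_intros)+
  then show ?thesis by (cases P) simp_all
qed

lemma definable_bex [definable_intros]:
  "finite I \<Longrightarrow> (\<And>i. i \<in> I \<Longrightarrow> definable M (R i)) \<Longrightarrow> definable M (\<lambda>e. \<exists>i\<in>I. R i e)"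
  by (induction I rule: finite_induct) (simp_all add: definable_const definable_disj)

section \<open>Comprehension and induction for definable relations\<close>

lemma delta1_comprehension:
  assumes "definable M (\<lambda>e. Q (e 0) (e 1))" "definable M (\<lambda>e. Q' (e 0) (e 1))"
    and eq: "\<And>a. (\<exists>y. Q a y) \<longleftrightarrow> (\<forall>y. Q' a y)"
  shows "{a. \<exists>y. Q a y} \<in> sets M"
proof -
  from assms(1,2) obtain \<phi> \<psi> E p where bd: "bounded \<phi>" "bounded \<psi>" and E: "range E \<subseteq> sets M"
    and sat: "\<And>e. sat M (mix e p) E \<phi> \<longleftrightarrow> Q (e 0) (e 1)"
      "\<And>e. sat M (mix e p) E \<psi> \<longleftrightarrow> Q' (e 0) (e 1)"
    by (rule definable_pair) blast
  obtain X where X: "X \<notin> fvS \<phi>"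
    using finite_fvS[of \<phi>] infinite_UNIV_nat ex_new_if_finite by blast
  let ?e = "mix (\<lambda>_. undefined) p :: nat \<Rightarrow> 'a"
  \<comment> \<open>Argument 1 is number variable 2, since arguments occupy the even
    positions.\<close>
  let ?\<phi> = "ExN 2 \<phi>" and ?\<psi> = "AllN 2 \<psi>"
  have "(AllN 0 (?\<phi> \<^bold>\<longleftrightarrow> ?\<psi>) \<^bold>\<longrightarrow> ExS X (AllN 0 (Var 0 \<^bold>\<in> X \<^bold>\<longleftrightarrow> ?\<phi>))) \<in> RCA0"
    unfolding RCA0_def Delta01_comprehension_def Sigma01_def Pi01_def using bd X by fastforce
  from satisfies[OF this E, of ?e]
  have imp: "(\<forall>a. (\<exists>y. Q a y) \<longleftrightarrow> (\<forall>y. Q' a y)) \<longrightarrow>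
      (\<exists>A\<in>sets M. \<forall>a. a \<in> A \<longleftrightarrow> (\<exists>y. sat M (?e(0 := a, 2 := y)) (E(X := A)) \<phi>))"
    by (simp add: mix_upd sat)
  have "sat M (?e(0 := a, 2 := y)) (E(X := A)) \<phi> \<longleftrightarrow> Q a y" for a y A
  proof -
    have "sat M (?e(0 := a, 2 := y)) (E(X := A)) \<phi> \<longleftrightarrow> sat M (?e(0 := a, 2 := y)) E \<phi>"
      by (rule sat_cong) (use X in auto)
    then show ?thesis by (simp add: mix_upd sat)
  qed
  with imp eq obtain A where "A \<in> sets M" "\<forall>a. a \<in> A \<longleftrightarrow> (\<exists>y. Q a y)" by auto
  moreover from this have "A = {a. \<exists>y. Q a y}" by blast
  ultimately show ?thesis by simp
qed

lemma comprehension: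
  assumes "definable M (\<lambda>e. Q (e 0))"
  shows "{a. Q a} \<in> sets M"
  using delta1_comprehension[of "\<lambda>a y. Q a" "\<lambda>a y. Q a"] assms by simp

text \<open>Comprehension turns \<open>Q\<close> into a set, so one instance of the scheme, for
  membership in that set, serves all \<open>Q\<close>. The vacuous existential quantifier gives this
  instance the shape of a member of \<open>Sigma01\<close>.\<close>

lemma induct:
  assumes "definable M (\<lambda>e. Q (e 0))" and 0: "Q \<zero>" and Suc: "\<And>n. Q n \<Longrightarrow> Q (n \<oplus> \<one>)"
  shows "Q n"
proof -
  let ?A = "{a. Q a}" and ?\<phi> = "ExN 2 (Var 0 \<^bold>\<in> 0)"
  have "(inst ?\<phi> 0 \<^bold>0 \<^bold>\<and> AllN 1 (inst ?\<phi> 0 (Var 1) \<^bold>\<longrightarrow> inst ?\<phi> 0 (Var 1 \<^bold>+ \<^bold>1)) \<^bold>\<longrightarrow> AllN 0 ?\<phi>) \<in> RCA0"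
    unfolding RCA0_def Sigma01_induction_def Sigma01_def by (fastforce intro: bounded.intros)
  moreover have "range (\<lambda>_. ?A) \<subseteq> sets M" using comprehension[OF assms(1)] by simp
  ultimately have "sat M (\<lambda>_. n) (\<lambda>_. ?A)
      (inst ?\<phi> 0 \<^bold>0 \<^bold>\<and> AllN 1 (inst ?\<phi> 0 (Var 1) \<^bold>\<longrightarrow> inst ?\<phi> 0 (Var 1 \<^bold>+ \<^bold>1)) \<^bold>\<longrightarrow> AllN 0 ?\<phi>)"
    by (rule satisfies)
  then show ?thesis using 0 Suc by (simp add: sat_inst)
qed

section \<open>The ordered semiring\<close>

lemma basic:
  "n \<oplus> \<one> \<noteq> \<zero>" "m \<oplus> \<one> = n \<oplus> \<one> \<Longrightarrow> m = n" "m \<oplus> \<zero> = m" "m \<oplus> (n \<oplus> \<one>) = m \<oplus> n \<oplus> \<one>"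
  "m \<otimes> \<zero> = \<zero>" "m \<otimes> (n \<oplus> \<one>) = m \<otimes> n \<oplus> m" "\<not> m \<prec> \<zero>" "m \<prec> n \<oplus> \<one> \<longleftrightarrow> m \<prec> n \<or> m = n"
proof -
  obtain A where "A \<in> sets M" using sets_nonempty by blast
  then have *: "sat M ((\<lambda>_. m)(1 := n)) (\<lambda>_. A) \<phi>" if "\<phi> \<in> basic_axioms" for \<phi>
    using that by (intro satisfies) (auto simp: RCA0_def)
  have **: "\<forall>\<phi>\<in>basic_axioms. sat M ((\<lambda>_. m)(1 := n)) (\<lambda>_. A) \<phi>" using * by blast
  show "n \<oplus> \<one> \<noteq> \<zero>" "m \<oplus> \<one> = n \<oplus> \<one> \<Longrightarrow> m = n" "m \<oplus> \<zero> = m" "m \<oplus> (n \<oplus> \<one>) = m \<oplus> n \<oplus> \<one>"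
    "m \<otimes> \<zero> = \<zero>" "m \<otimes> (n \<oplus> \<one>) = m \<otimes> n \<oplus> m" "\<not> m \<prec> \<zero>" "m \<prec> n \<oplus> \<one> \<longleftrightarrow> m \<prec> n \<or> m = n"
    using ** by (auto simp: basic_axioms_def Let_def)
qed

lemma suc_inj [simp]: "m \<oplus> \<one> = n \<oplus> \<one> \<longleftrightarrow> m = n"
  using basic(2) by blast

lemmas suc_neq_zero [simp] = basic(1) basic(1)[symmetric]
lemmas add_zero [simp] = basic(3)
lemmas add_suc = basic(4)
lemmas mul_zero [simp] = basic(5)
lemmas mul_suc = basic(6)
lemmas not_less_zero [simp] = basic(7)
lemmas less_suc = basic(8)

lemma add_assoc: "a \<oplus> b \<oplus> c = a \<oplus> (b \<oplus> c)"
  by (rule induct[of "\<lambda>c. a \<oplus> b \<oplus> c = a \<oplus> (b \<oplus> c)"]) (intro definable_intros | simp add: add_suc)+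

lemma zero_add [simp]: "\<zero> \<oplus> a = a"
  by (rule induct[of "\<lambda>a. \<zero> \<oplus> a = a"]) (intro definable_intros | simp add: add_suc)+

lemma suc_add: "a \<oplus> \<one> \<oplus> b = a \<oplus> b \<oplus> \<one>"
  by (rule induct[of "\<lambda>b. a \<oplus> \<one> \<oplus> b = a \<oplus> b \<oplus> \<one>"]) (intro definable_intros | simp add: add_suc)+

lemma add_comm: "a \<oplus> b = b \<oplus> a"
  by (rule induct[of "\<lambda>b. a \<oplus> b = b \<oplus> a"]) (intro definable_intros | simp add: add_suc suc_add)+

lemma add_left_comm: "a \<oplus> (b \<oplus> c) = b \<oplus> (a \<oplus> c)"
  by (metis add_assoc add_comm)

lemmas add_ac = add_assoc add_comm add_left_comm

lemma add_right_cancel [simp]: "a \<oplus> c = b \<oplus> c \<longleftrightarrow> a = b"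
  by (rule induct[of "\<lambda>c. a \<oplus> c = b \<oplus> c \<longleftrightarrow> a = b"])
     (intro definable_intros | simp add: add_assoc[symmetric])+

lemma add_left_cancel [simp]: "c \<oplus> a = c \<oplus> b \<longleftrightarrow> a = b"
  by (simp add: add_comm[of c])

lemma zero_mul [simp]: "\<zero> \<otimes> a = \<zero>"
  by (rule induct[of "\<lambda>a. \<zero> \<otimes> a = \<zero>"]) (intro definable_intros | simp add: mul_suc)+

lemma suc_mul: "(a \<oplus> \<one>) \<otimes> b = a \<otimes> b \<oplus> b"
  by (rule induct[of "\<lambda>b. (a \<oplus> \<one>) \<otimes> b = a \<otimes> b \<oplus> b"])
     (intro definable_intros | simp add: mul_suc add_ac)+

lemma mul_one [simp]: "a \<otimes> \<one> = a"
  using mul_suc[of a \<zero>] by simp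

lemma one_mul [simp]: "\<one> \<otimes> a = a"
  using suc_mul[of \<zero> a] by simp

lemma mul_comm: "a \<otimes> b = b \<otimes> a"
  by (rule induct[of "\<lambda>b. a \<otimes> b = b \<otimes> a"])
     (intro definable_intros | simp add: mul_suc suc_mul)+

lemma distrib_left: "a \<otimes> (b \<oplus> c) = a \<otimes> b \<oplus> a \<otimes> c"
  by (rule induct[of "\<lambda>c. a \<otimes> (b \<oplus> c) = a \<otimes> b \<oplus> a \<otimes> c"])
     (intro definable_intros | simp add: mul_suc add_assoc[symmetric])+

lemma distrib_right: "(b \<oplus> c) \<otimes> a = b \<otimes> a \<oplus> c \<otimes> a"
  by (simp add: mul_comm[of _ a] distrib_left)

lemma zero_or_suc: obtains "a = \<zero>" | b where "a = b \<oplus> \<one>"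
proof -
  \<comment> \<open>The bound on the predecessor makes the induction formula bounded. The same
    device recurs below.\<close>
  have "a = \<zero> \<or> (\<exists>b. b \<prec> a \<and> a = b \<oplus> \<one>)"
    by (rule induct[of "\<lambda>a. a = \<zero> \<or> (\<exists>b. b \<prec> a \<and> a = b \<oplus> \<one>)"])
       (intro definable_intros | simp add: less_suc)+
  then show thesis using that by blast
qed

lemma zero_less_suc [simp]: "\<zero> \<prec> a \<oplus> \<one>"
  by (rule induct[of "\<lambda>a. \<zero> \<prec> a \<oplus> \<one>"])
     (intro definable_intros | simp add: less_suc[of _ "_ \<oplus> _"] less_suc[of _ "\<zero>", simplified])+

lemma zero_less_one [simp]: "\<zero> \<prec> \<one>"
  using zero_less_suc[of \<zero>] by simp

lemma suc_mono: "a \<prec> b \<Longrightarrow> a \<oplus> \<one> \<prec> b \<oplus> \<one>"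
proof -
  have "a \<prec> b \<longrightarrow> a \<oplus> \<one> \<prec> b \<oplus> \<one>"
    by (rule induct[of "\<lambda>b. a \<prec> b \<longrightarrow> a \<oplus> \<one> \<prec> b \<oplus> \<one>"])
       (intro definable_intros | auto simp: less_suc)+
  then show "a \<prec> b \<Longrightarrow> a \<oplus> \<one> \<prec> b \<oplus> \<one>" by simp
qed

lemma less_add_suc: "a \<prec> a \<oplus> c \<oplus> \<one>"
  by (rule induct[of "\<lambda>c. a \<prec> a \<oplus> c \<oplus> \<one>"])
     (intro definable_intros | simp add: less_suc add_assoc[symmetric])+

lemma less_iff: "a \<prec> b \<longleftrightarrow> (\<exists>c. b = a \<oplus> c \<oplus> \<one>)"
proof -
  have "a \<prec> b \<longrightarrow> (\<exists>c. c \<prec> b \<and> b = a \<oplus> c \<oplus> \<one>)"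
  proof (rule induct[of "\<lambda>b. a \<prec> b \<longrightarrow> (\<exists>c. c \<prec> b \<and> b = a \<oplus> c \<oplus> \<one>)"])
    show "a \<prec> \<zero> \<longrightarrow> (\<exists>c. c \<prec> \<zero> \<and> \<zero> = a \<oplus> c \<oplus> \<one>)" by simp
  next
    fix b assume IH: "a \<prec> b \<longrightarrow> (\<exists>c. c \<prec> b \<and> b = a \<oplus> c \<oplus> \<one>)"
    show "a \<prec> b \<oplus> \<one> \<longrightarrow> (\<exists>c. c \<prec> b \<oplus> \<one> \<and> b \<oplus> \<one> = a \<oplus> c \<oplus> \<one>)"
    proof
      assume "a \<prec> b \<oplus> \<one>"
      then consider "a \<prec> b" | "a = b" by (auto simp: less_suc)
      then show "\<exists>c. c \<prec> b \<oplus> \<one> \<and> b \<oplus> \<one> = a \<oplus> c \<oplus> \<one>"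
      proof cases
        case 1
        then obtain c where "c \<prec> b" "b = a \<oplus> c \<oplus> \<one>" using IH by blast
        then show ?thesis by (intro exI[of _ "c \<oplus> \<one>"]) (simp add: suc_mono add_suc)
      next
        case 2
        then show ?thesis by (intro exI[of _ "\<zero>"]) simp
      qed
    qed
  qed (intro definable_intros)
  then show ?thesis using less_add_suc by blast
qed

lemma less_irrefl [simp]: "\<not> a \<prec> a"
proof
  assume "a \<prec> a"
  then obtain c where "a \<oplus> \<zero> = a \<oplus> (c \<oplus> \<one>)" by (auto simp: less_iff add_assoc)
  then show False unfolding add_left_cancel by simp
qed

lemma less_trans: "a \<prec> b \<Longrightarrow> b \<prec> c \<Longrightarrow> a \<prec> c"
  unfolding less_iff by (metis add_assoc)

lemma less_linear: "a \<prec> b \<or> a = b \<or> b \<prec> a"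
proof (rule induct[of "\<lambda>a. a \<prec> b \<or> a = b \<or> b \<prec> a"])
  show "\<zero> \<prec> b \<or> \<zero> = b \<or> b \<prec> \<zero>" by (cases b rule: zero_or_suc) auto
next
  fix a assume "a \<prec> b \<or> a = b \<or> b \<prec> a"
  then consider "a \<prec> b" | "b \<prec> a \<oplus> \<one>" by (auto simp: less_suc)
  then show "a \<oplus> \<one> \<prec> b \<or> a \<oplus> \<one> = b \<or> b \<prec> a \<oplus> \<one>"
  proof cases
    case 1
    then obtain c where "b = a \<oplus> c \<oplus> \<one>" by (auto simp: less_iff)
    then show ?thesis
      by (cases c rule: zero_or_suc) (auto simp: less_iff add_ac)
  qed auto
qed (intro definable_intros)

lemma less_asym: "a \<prec> b \<Longrightarrow> \<not> b \<prec> a"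
  using less_trans less_irrefl by blast

lemma less_suc_iff: "a \<prec> b \<oplus> \<one> \<longleftrightarrow> (\<exists>c. b = a \<oplus> c)"
proof
  assume "a \<prec> b \<oplus> \<one>"
  then show "\<exists>c. b = a \<oplus> c" unfolding less_iff by simp
next
  assume "\<exists>c. b = a \<oplus> c"
  then show "a \<prec> b \<oplus> \<one>" using less_add_suc by blast
qed

lemma not_less_iff: "\<not> a \<prec> b \<longleftrightarrow> b \<prec> a \<oplus> \<one>"
  using less_linear less_asym less_suc less_irrefl by metis

lemma least_witness:
  assumes "definable M (\<lambda>e. Q (e 0))" "Q n"
  shows "\<exists>m. Q m \<and> (\<forall>i. i \<prec> m \<longrightarrow> \<not> Q i)"
proof (rule ccontr)
  assume none: "\<not> ?thesis"
  have "\<forall>i. i \<prec> n \<oplus> \<one> \<longrightarrow> \<not> Q i" for n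
  proof (rule induct[of "\<lambda>n. \<forall>i. i \<prec> n \<oplus> \<one> \<longrightarrow> \<not> Q i"])
    show "definable M (\<lambda>e. \<forall>i. i \<prec> e 0 \<oplus> \<one> \<longrightarrow> \<not> Q i)"
    proof -
      have "definable M (\<lambda>e. \<forall>i. i \<prec> e 0 \<oplus> \<one> \<longrightarrow> \<not> i \<in> {a. Q a})"
        by (intro definable_intros comprehension assms)
      then show ?thesis by simp
    qed
  next
    show "\<forall>i. i \<prec> \<zero> \<oplus> \<one> \<longrightarrow> \<not> Q i" using none less_suc not_less_zero by blast
  next
    fix n assume "\<forall>i. i \<prec> n \<oplus> \<one> \<longrightarrow> \<not> Q i"
    then show "\<forall>i. i \<prec> n \<oplus> \<one> \<oplus> \<one> \<longrightarrow> \<not> Q i" using none less_suc by blast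
  qed
  then show False using assms(2) by (auto simp: less_suc)
qed

lemma ex_maximal:
  assumes "finite S" "S \<noteq> {}"
  shows "\<exists>m\<in>S. \<forall>x\<in>S. \<not> m \<prec> x"
  using assms
proof (induction S rule: finite_ne_induct)
  case (insert x S)
  then obtain m where "m \<in> S" "\<forall>x\<in>S. \<not> m \<prec> x" by blast
  then show ?case using less_trans less_irrefl less_asym by (cases "m \<prec> x") blast+
qed simp

section \<open>Pairing\<close>

definition pair :: "'a \<Rightarrow> 'a \<Rightarrow> 'a" where
  "pair a b = (a \<oplus> b) \<otimes> (a \<oplus> b) \<oplus> a"

lemma eval_pr [simp]: "eval M e (pr s t) = pair (eval M e s) (eval M e t)"
  by (simp add: pr_def pair_def)

lemma definable_term_code [definable_intros]:
  "definable_term M s \<Longrightarrow> definable_term M t \<Longrightarrow> definable_term M (\<lambda>e. pair (s e) (t e))"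
  unfolding pair_def by (intro definable_intros)

text \<open>With \<open>s\<close> for \<open>a \<oplus> b\<close>, the squares of \<open>s\<close>
  and \<open>s \<oplus> \<one>\<close> differ by more than \<open>s\<close>, and \<open>a\<close> is
  at most \<open>s\<close>.\<close>

lemma pair_less:
  assumes "a \<oplus> b \<prec> c \<oplus> d"
  shows "pair a b \<prec> pair c d"
proof -
  obtain z where "c \<oplus> d = a \<oplus> b \<oplus> z \<oplus> \<one>" using assms by (auto simp: less_iff)
  then have "pair c d = (a \<oplus> b \<oplus> z \<oplus> \<one>) \<otimes> (a \<oplus> b \<oplus> z \<oplus> \<one>) \<oplus> c" by (simp add: pair_def)
  also have "\<dots> = pair a b \<oplus> ((a \<oplus> b) \<otimes> z \<oplus> z \<otimes> (a \<oplus> b \<oplus> z \<oplus> \<one>) \<oplus> (a \<oplus> b \<oplus> z) \<oplus> b \<oplus> c) \<oplus> \<one>"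
    by (simp add: pair_def distrib_left distrib_right mul_suc suc_mul add_ac)
  finally show ?thesis by (auto simp: less_iff)
qed

lemma pair_inj [simp]: "pair a b = pair c d \<longleftrightarrow> a = c \<and> b = d"
proof
  assume *: "pair a b = pair c d"
  have "a \<oplus> b = c \<oplus> d" using less_linear[of "a \<oplus> b" "c \<oplus> d"] pair_less * by fastforce
  moreover from this have "a = c" using * by (simp add: pair_def)
  ultimately show "a = c \<and> b = d" by simp
qed simp

lemma fst_le_pair: "a \<prec> pair a b \<oplus> \<one>"
  unfolding less_suc_iff pair_def using add_comm by blast

lemma snd_le_pair: "b \<prec> pair a b \<oplus> \<one>"
proof -
  have "\<exists>c. s \<otimes> s = s \<oplus> c" for s
  proof (cases s rule: zero_or_suc)
    case (2 b)
    then have "s \<otimes> s = s \<oplus> s \<otimes> b" using mul_suc[of s b] by (simp add: add_comm)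
    then show ?thesis by blast
  qed simp
  then obtain c where "(a \<oplus> b) \<otimes> (a \<oplus> b) = a \<oplus> b \<oplus> c" by blast
  then have "pair a b = b \<oplus> (a \<oplus> c \<oplus> a)" by (simp add: pair_def add_ac)
  then show ?thesis unfolding less_suc_iff by blast
qed

text \<open>Both components are at most the code, so the quantifiers can be bounded by it. This
  makes decoding available in bounded formulas.\<close>

lemma definable_ex_pair [definable_intros]:
  assumes "definable_term M t" "definable M (\<lambda>e. R (\<lambda>n. e (Suc (Suc n))) (e 1) (e 0))"
  shows "definable M (\<lambda>e. \<exists>a b. t e = pair a b \<and> R e a b)"
proof -
  \<comment> \<open>A term stays definable when its arguments are read one position higher, as
    happens under a quantifier.\<close>
  have t: "definable_term M (\<lambda>e. t (\<lambda>n. e (Suc n)))" if "definable_term M t" for t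
  proof -
    obtain s p where s: "\<And>e. eval M (mix e p) s = t e"
      using \<open>definable_term M t\<close> unfolding definable_term_def by blast
    define r where "r = (\<lambda>n::nat. if even n then n + 2 else n)"
    have "eval M (mix e p) (rent r s) = t (\<lambda>n. e (Suc n))" for e
    proof -
      have "mix e p \<circ> r = mix (\<lambda>n. e (Suc n)) p" by (auto simp: fun_eq_iff mix_def r_def)
      then show ?thesis by (simp add: eval_rent s)
    qed
    then show ?thesis unfolding definable_term_def by blast
  qed
  have "definable M (\<lambda>e. \<exists>a. a \<prec> t e \<oplus> \<one> \<and> (\<exists>b. b \<prec> t e \<oplus> \<one> \<and> t e = pair a b \<and> R e a b))"
    by (intro definable_intros assms t t[OF t[OF assms(1)]]) (use assms(2) in simp)
  also have "(\<lambda>e. \<exists>a. a \<prec> t e \<oplus> \<one> \<and> (\<exists>b. b \<prec> t e \<oplus> \<one> \<and> t e = pair a b \<and> R e a b)) =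
      (\<lambda>e. \<exists>a b. t e = pair a b \<and> R e a b)"
    using fst_le_pair snd_le_pair by (intro ext) metis
  finally show ?thesis .
qed

section \<open>Standard numerals, division, and substitution into relations\<close>

definition num :: "nat \<Rightarrow> 'a" where
  "num n = ((\<lambda>a. a \<oplus> \<one>) ^^ n) \<zero>"

lemma num_0 [simp]: "num 0 = \<zero>" and num_Suc [simp]: "num (Suc n) = num n \<oplus> \<one>"
  by (simp_all add: num_def)

lemma num_inj [simp]: "num m = num n \<longleftrightarrow> m = n"
proof (induction m arbitrary: n)
  case 0 show ?case by (cases n) auto
next
  case (Suc m) then show ?case by (cases n) auto
qed

lemma num_less: "m < n \<Longrightarrow> num m \<prec> num n"
  by (induction n) (auto simp: less_suc less_Suc_eq)

text \<open>\<open>L\<close> is a standard number, so the remainder is expressed by a disjunction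
  over finitely many numerals, and induction applies.\<close>

lemma division:
  assumes "0 < L"
  shows "\<exists>j. \<exists>r<L. n = num L \<otimes> j \<oplus> num r"
proof -
  have "\<exists>j. j \<prec> n \<oplus> \<one> \<and> (\<exists>r\<in>{..<L}. n = num L \<otimes> j \<oplus> num r)"
  proof (rule induct[of "\<lambda>n. \<exists>j. j \<prec> n \<oplus> \<one> \<and> (\<exists>r\<in>{..<L}. n = num L \<otimes> j \<oplus> num r)"])
    show "\<exists>j. j \<prec> \<zero> \<oplus> \<one> \<and> (\<exists>r\<in>{..<L}. \<zero> = num L \<otimes> j \<oplus> num r)"
      using assms by (intro exI[of _ \<zero>]) (auto intro!: bexI[of _ 0])
  next
    fix n assume "\<exists>j. j \<prec> n \<oplus> \<one> \<and> (\<exists>r\<in>{..<L}. n = num L \<otimes> j \<oplus> num r)"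
    then obtain j r where *: "j \<prec> n \<oplus> \<one>" "r < L" "n = num L \<otimes> j \<oplus> num r" by auto
    show "\<exists>j. j \<prec> n \<oplus> \<one> \<oplus> \<one> \<and> (\<exists>r\<in>{..<L}. n \<oplus> \<one> = num L \<otimes> j \<oplus> num r)"
    proof (cases "Suc r < L")
      case True
      have "j \<prec> n \<oplus> \<one> \<oplus> \<one>" using *(1) less_suc by blast
      moreover have "n \<oplus> \<one> = num L \<otimes> j \<oplus> num (Suc r)" using *(3) by (simp add: add_assoc)
      ultimately show ?thesis using True by blast
    next
      case False
      then have "L = Suc r" using *(2) by simp
      then show ?thesis using *
        by (intro exI[of _ "j \<oplus> \<one>"])
           (auto simp: suc_mono mul_suc add_assoc[symmetric] intro!: bexI[of _ 0])
    qed
  qed (intro definable_intros | simp)+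
  then show ?thesis by blast
qed

lemma division_unique:
  assumes "r < L" "r' < L" and eq: "num L \<otimes> j \<oplus> num r = num L \<otimes> j' \<oplus> num r'"
  shows "j = j' \<and> r = r'"
proof -
  have *: "num L \<otimes> j \<oplus> num r \<prec> num L \<otimes> j' \<oplus> num r'" if j: "j \<prec> j'" and r: "r < L" for j j' r r'
  proof -
    obtain c where "j' = j \<oplus> c \<oplus> \<one>" using j unfolding less_iff by blast
    moreover obtain d where "num L = num r \<oplus> d \<oplus> \<one>"
      using num_less[OF r] unfolding less_iff by blast
    then have "num L \<otimes> (j \<oplus> c \<oplus> \<one>) \<oplus> num r' =
        num L \<otimes> j \<oplus> num r \<oplus> (num L \<otimes> c \<oplus> d \<oplus> num r') \<oplus> \<one>"
      by (simp only: mul_suc distrib_left) (simp add: add_ac)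
    ultimately show ?thesis unfolding less_iff by blast
  qed
  have "j = j'" using less_linear[of j j'] *[of j j' r r'] *[of j' j r' r] assms by auto
  then show ?thesis using eq by simp
qed

text \<open>Substitution of terms without a syntactic operation: the relation becomes a set of
  pairs, and membership of the pair of terms in this set is definable.\<close>

lemma definable_rel2:
  assumes "definable M (\<lambda>e. R (e 1) (e 0))" "definable_term M s" "definable_term M t"
  shows "definable M (\<lambda>e. R (s e) (t e))"
proof -
  have "{z. \<exists>a b. z = pair a b \<and> R a b} \<in> sets M"
    by (intro comprehension definable_intros assms(1))
  then have "definable M (\<lambda>e. pair (s e) (t e) \<in> {z. \<exists>a b. z = pair a b \<and> R a b})"
    by (intro definable_intros assms)
  then show ?thesis by simp
qed

lemma definable_rel3:
  assumes "definable M (\<lambda>e. R (e 2) (e 1) (e 0))"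
    "definable_term M r" "definable_term M s" "definable_term M t"
  shows "definable M (\<lambda>e. R (r e) (s e) (t e))"
proof -
  let ?A = "{z. \<exists>y k. z = pair y k \<and> (\<exists>a b. y = pair a b \<and> R k a b)}"
  have "?A \<in> sets M"
    by (intro comprehension definable_intros) (use assms(1) in \<open>simp add: numeral_2_eq_2\<close>)
  then have "definable M (\<lambda>e. pair (pair (s e) (t e)) (r e) \<in> ?A)"
    by (intro definable_intros assms)
  then show ?thesis by simp
qed

section \<open>Graphs and Hamilton paths in a model\<close>

definition is_graph :: "'a set \<Rightarrow> bool" where
  "is_graph G \<longleftrightarrow> (\<forall>z. pair z \<one> \<in> G \<longrightarrow> (\<exists>u v. z = pair u v \<and>
     pair u \<zero> \<in> G \<and> pair v \<zero> \<in> G \<and> pair (pair v u) \<one> \<in> G))"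

definition is_hamilton_path :: "'a set \<Rightarrow> 'a set \<Rightarrow> bool" where
  "is_hamilton_path G P \<longleftrightarrow>
     (\<forall>z\<in>P. \<exists>n v. z = pair n v \<and> pair v \<zero> \<in> G) \<and>
     (\<forall>n. \<exists>u. pair n u \<in> P \<and> (\<forall>v. pair n v \<in> P \<longrightarrow> v = u)) \<and>
     (\<forall>n u v. pair n u \<in> P \<and> pair (n \<oplus> \<one>) v \<in> P \<longrightarrow> pair (pair u v) \<one> \<in> G) \<and>
     (\<forall>v. pair v \<zero> \<in> G \<longrightarrow> (\<exists>n. pair n v \<in> P \<and> (\<forall>m. pair m v \<in> P \<longrightarrow> m = n)))"

definition slice :: "'a set \<Rightarrow> 'a \<Rightarrow> 'a set" where
  "slice A k = {i. pair i k \<in> A}"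

lemma mem_slice [simp]: "i \<in> slice A k \<longleftrightarrow> pair i k \<in> A"
  by (simp add: slice_def)

lemma slice_sets: "A \<in> sets M \<Longrightarrow> slice A k \<in> sets M"
  unfolding slice_def by (intro comprehension definable_intros)

lemma sat_graph_fm:
  "sat M e E (graph_fm (sec (setvar X) (Var 0))) \<longleftrightarrow> is_graph (slice (E X) (e 0))"
  by (simp add: graph_fm_def is_graph_def vertices_def edges_def sec_def setvar_def Let_def)

lemma sat_hamilton_path_fm:
  "sat M e E (hamilton_path_fm (sec (setvar X) (Var 0)) (setvar Y)) \<longleftrightarrow>
     is_hamilton_path (slice (E X) (e 0)) (E Y)"
  "sat M e E (hamilton_path_fm (sec (setvar X) (Var 0)) (sec (setvar Y) (Var 0))) \<longleftrightarrow>
     is_hamilton_path (slice (E X) (e 0)) (slice (E Y) (e 0))"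
  by (simp_all add: hamilton_path_fm_def path_fm_def is_hamilton_path_def vertices_def edges_def
      sec_def setvar_def Let_def Ball_def conj_assoc)

lemma hamilton_sequences_iff:
  "M \<Turnstile> {hamilton_sequences} \<longleftrightarrow>
     (\<forall>G\<in>sets M. (\<forall>i. is_graph (slice G i) \<and> (\<exists>P\<in>sets M. is_hamilton_path (slice G i) P)) \<longrightarrow>
       (\<exists>P\<in>sets M. \<forall>i. is_hamilton_path (slice G i) (slice P i)))"
proof -
  obtain A where "A \<in> sets M" using sets_nonempty by blast
  then have "\<exists>E :: nat \<Rightarrow> 'a set. range E \<subseteq> sets M" by (intro exI[of _ "\<lambda>_. A"]) auto
  then show ?thesis
    by (simp add: models_def hamilton_sequences_def Let_def sat_graph_fm sat_hamilton_path_fm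
        sets_nonempty)
qed

text \<open>\<open>p\<close> is a function outside the model; inside, only its graph
  \<open>P\<close> exists.\<close>

lemma hamilton_path_function:
  assumes "is_hamilton_path G P"
  obtains p where "\<And>n v. pair n v \<in> P \<longleftrightarrow> v = p n" "inj p" "range p = {v. pair v \<zero> \<in> G}"
    "\<And>n. pair (pair (p n) (p (n \<oplus> \<one>))) \<one> \<in> G"
proof -
  have "\<forall>n. \<exists>u. \<forall>v. pair n v \<in> P \<longleftrightarrow> v = u"
  proof
    fix n
    have "\<exists>u. pair n u \<in> P \<and> (\<forall>v. pair n v \<in> P \<longrightarrow> v = u)"
      using assms by (simp add: is_hamilton_path_def)
    then show "\<exists>u. \<forall>v. pair n v \<in> P \<longleftrightarrow> v = u" by blast
  qed
  then obtain p where p: "\<And>n v. pair n v \<in> P \<longleftrightarrow> v = p n" by metis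
  have V: "pair (p n) \<zero> \<in> G" for n
    using assms p[of n "p n"] unfolding is_hamilton_path_def by fastforce
  show thesis
  proof (rule that[OF p])
    show "inj p"
      using assms V p unfolding is_hamilton_path_def inj_def by metis
    show "range p = {v. pair v \<zero> \<in> G}"
      using assms V p unfolding is_hamilton_path_def by (auto; metis rangeI)
    show "pair (pair (p n) (p (n \<oplus> \<one>))) \<one> \<in> G" for n
      using assms p unfolding is_hamilton_path_def by blast
  qed
qed

text \<open>Vertices of twelve kinds, with a copy of each kind for every number:
  a line vertex 0 leading into a branch vertex 1; a gadget consisting of a top row 6, 9 and a bottom
  row 8, 11 linked by the rungs 7 and 10; a clause segment 3, 4, 5; and an exit 2.
  The bottom row of \<open>j\<close> is linked to the top row of \<open>\<pi> j\<close>. Each pass through block \<open>j\<close> takes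
  either its top row (meaning that \<open>j\<close> is true) or its bottom row (\<open>j\<close> is false).\<close>

definition vx :: "nat \<Rightarrow> 'a \<Rightarrow> 'a" where
  "vx r j = pair j (num r)"

lemma vx_eq [simp]: "vx r j = vx q i \<longleftrightarrow> r = q \<and> j = i"
  by (auto simp: vx_def)

text \<open>The rungs join the top row of \<open>\<pi> i\<close> to the bottom row of
  \<open>i\<close>, so that vertices of kinds 6, 7, 8, 11, 10, 9 form hexagons.
  \<open>AT j x\<close> and \<open>AF j x\<close> allow block \<open>j\<close> to go on to segment
  \<open>x\<close> from its top row and from its bottom row.\<close>

definition arcs :: "('a \<Rightarrow> 'a) \<Rightarrow> ('a \<Rightarrow> 'a \<Rightarrow> bool) \<Rightarrow> ('a \<Rightarrow> 'a \<Rightarrow> bool) \<Rightarrow>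
    (nat \<times> nat \<times> ('a \<Rightarrow> 'a \<Rightarrow> bool)) set" where
  "arcs \<pi> AT AF = {(0, 1, \<lambda>j i. i = j), (2, 0, \<lambda>j i. i = j \<oplus> \<one>), (1, 6, \<lambda>j i. i = j),
     (1, 8, \<lambda>j i. i = j), (6, 7, \<lambda>j i. i = j), (7, 8, \<lambda>j i. j = \<pi> i), (6, 9, \<lambda>j i. i = j),
     (8, 11, \<lambda>j i. i = j), (9, 10, \<lambda>j i. i = j), (10, 11, \<lambda>j i. j = \<pi> i), (9, 3, AT), (11, 3, AF),
     (3, 4, \<lambda>j i. i = j), (4, 5, \<lambda>j i. i = j), (5, 2, \<lambda>x j. AT j x \<or> AF j x)}"

definition arc :: "('a \<Rightarrow> 'a) \<Rightarrow> ('a \<Rightarrow> 'a \<Rightarrow> bool) \<Rightarrow> ('a \<Rightarrow> 'a \<Rightarrow> bool) \<Rightarrow> 'a \<Rightarrow> 'a \<Rightarrow> bool" where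
  "arc \<pi> AT AF x y \<longleftrightarrow> (\<exists>(r, q, R)\<in>arcs \<pi> AT AF. \<exists>j i. x = vx r j \<and> y = vx q i \<and> R j i)"

definition graph_of :: "('a \<Rightarrow> 'a) \<Rightarrow> ('a \<Rightarrow> 'a \<Rightarrow> bool) \<Rightarrow> ('a \<Rightarrow> 'a \<Rightarrow> bool) \<Rightarrow> 'a set" where
  "graph_of \<pi> AT AF = {pair (vx r j) \<zero> | r j. r < 12} \<union>
     {pair (pair x y) \<one> | x y. arc \<pi> AT AF x y \<or> arc \<pi> AT AF y x}"

lemma arc_vx: "arc \<pi> AT AF x y \<Longrightarrow> (\<exists>r j q i. r < 12 \<and> q < 12 \<and> x = vx r j \<and> y = vx q i)"
  unfolding arc_def arcs_def by fastforce

lemma one_neq_zero [simp]: "\<one> \<noteq> \<zero>" "\<zero> \<noteq> \<one>"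
  using suc_neq_zero(1)[of \<zero>] by auto

lemma graph_of_vertices: "pair v \<zero> \<in> graph_of \<pi> AT AF \<longleftrightarrow> (\<exists>r j. r < 12 \<and> v = vx r j)"
  by (auto simp: graph_of_def)

lemma graph_of_edges:
  "pair (pair x y) \<one> \<in> graph_of \<pi> AT AF \<longleftrightarrow> arc \<pi> AT AF x y \<or> arc \<pi> AT AF y x"
  by (auto simp: graph_of_def)

lemma is_graph_graph_of: "is_graph (graph_of \<pi> AT AF)"
  unfolding is_graph_def
proof (intro allI impI)
  fix z assume "pair z \<one> \<in> graph_of \<pi> AT AF"
  then obtain x y where "z = pair x y" "arc \<pi> AT AF x y \<or> arc \<pi> AT AF y x"
    by (auto simp: graph_of_def)
  then show "\<exists>u v. z = pair u v \<and> pair u \<zero> \<in> graph_of \<pi> AT AF \<and>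
      pair v \<zero> \<in> graph_of \<pi> AT AF \<and> pair (pair v u) \<one> \<in> graph_of \<pi> AT AF"
    using arc_vx by (fastforce simp: graph_of_vertices graph_of_edges)
qed

section \<open>From Hamilton paths to truth values\<close>

definition used :: "('a \<Rightarrow> 'a) \<Rightarrow> 'a \<Rightarrow> 'a \<Rightarrow> bool" where
  "used p x y \<longleftrightarrow> (\<exists>n. p n = x \<and> p (n \<oplus> \<one>) = y \<or> p n = y \<and> p (n \<oplus> \<one>) = x)"

lemma used_sym: "used p x y \<longleftrightarrow> used p y x"
  by (auto simp: used_def)

lemma used_start:
  assumes "inj p"
  shows "used p (p \<zero>) y \<longleftrightarrow> y = p \<one>"
  by (auto simp: used_def inj_eq[OF assms])

lemma used_inner:
  assumes "inj p" "x \<in> range p" "x \<noteq> p \<zero>"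
  obtains y z where "y \<noteq> z" "\<And>w. used p x w \<longleftrightarrow> w = y \<or> w = z"
proof -
  obtain k where "x = p k" using assms(2) by blast
  with assms(3) obtain n where x: "x = p (n \<oplus> \<one>)" by (cases k rule: zero_or_suc) auto
  note eq = inj_eq[OF assms(1)]
  have "n \<prec> n \<oplus> \<one> \<oplus> \<one>" by (simp add: less_suc)
  then have "n \<noteq> n \<oplus> \<one> \<oplus> \<one>" using less_irrefl by metis
  then have "p n \<noteq> p (n \<oplus> \<one> \<oplus> \<one>)" by (simp add: eq)
  moreover have "used p x w \<longleftrightarrow> w = p n \<or> w = p (n \<oplus> \<one> \<oplus> \<one>)" for w
    unfolding used_def x by (auto simp: eq)
  ultimately show thesis by (rule that)
qed

text \<open>The vertex of \<open>S\<close> that comes last on the path has its successor outside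
  \<open>S\<close>.\<close>

lemma no_used_cycle:
  assumes "finite S" "S \<noteq> {}" "S \<subseteq> range p" "inj p"
  shows "\<exists>x\<in>S. \<exists>y. used p x y \<and> y \<notin> S"
proof -
  have fin: "finite (p -` S)" using assms(1,4) by (rule finite_vimageI)
  have "p -` S \<noteq> {}" using assms(2,3) by auto
  with fin obtain m where m: "m \<in> p -` S" "\<forall>x\<in>p -` S. \<not> m \<prec> x" using ex_maximal by blast
  have "p (m \<oplus> \<one>) \<notin> S" using m(2) less_suc by auto
  moreover have "used p (p m) (p (m \<oplus> \<one>))" unfolding used_def by blast
  ultimately show ?thesis using m(1) by blast
qed

text \<open>A block counts as true when the path uses the edge from its branch vertex to its top
  row. Edges forced at vertices of degree two leave binary decisions at the branch vertices and at
  the row starts 6 and 8; excluding closed hexagons links the decisions of \<open>j\<close> and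
  \<open>\<pi> j\<close>.\<close>

lemma graph_of_sound:
  assumes \<pi>: "bij \<pi>" and p: "inj p" "range p = {v. pair v \<zero> \<in> graph_of \<pi> AT AF}"
    "\<And>n. pair (pair (p n) (p (n \<oplus> \<one>))) \<one> \<in> graph_of \<pi> AT AF"
  shows "used p (vx 1 j) (vx 6 j) \<Longrightarrow> used p (vx 1 (\<pi> j)) (vx 6 (\<pi> j))"
    and "\<exists>j. used p (vx 1 j) (vx 6 j) \<and> AT j x \<or> \<not> used p (vx 1 j) (vx 6 j) \<and> AF j x"
proof -
  let ?adj = "\<lambda>x y. arc \<pi> AT AF x y \<or> arc \<pi> AT AF y x"
  have adj: "?adj x y" if "used p x y" for x y
    using that p(3) unfolding used_def graph_of_edges by blast
  have V: "vx r j \<in> range p" if "r < 12" for r j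
    using that by (auto simp: p(2) graph_of_vertices)
  note \<pi>_eq = inj_eq[OF bij_is_inj[OF \<pi>]]
  note arc_simps = arc_def arcs_def \<pi>_eq
  have N0: "?adj (vx 0 j) y \<longleftrightarrow> y = vx 1 j \<or> (\<exists>i. j = i \<oplus> \<one> \<and> y = vx 2 i)" for j y
    by (auto simp: arc_simps)
  have N1: "?adj (vx 1 j) y \<longleftrightarrow> y = vx 0 j \<or> y = vx 6 j \<or> y = vx 8 j" for j y
    by (auto simp: arc_simps)
  have N6: "?adj (vx 6 j) y \<longleftrightarrow> y = vx 1 j \<or> y = vx 7 j \<or> y = vx 9 j" for j y
    by (auto simp: arc_simps)
  have N7: "?adj (vx 7 (\<pi> j)) y \<longleftrightarrow> y = vx 6 (\<pi> j) \<or> y = vx 8 j" for j y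
    by (auto simp: arc_simps)
  have N8: "?adj (vx 8 j) y \<longleftrightarrow> y = vx 1 j \<or> y = vx 7 (\<pi> j) \<or> y = vx 11 j" for j y
    by (auto simp: arc_simps)
  have N10: "?adj (vx 10 (\<pi> j)) y \<longleftrightarrow> y = vx 9 (\<pi> j) \<or> y = vx 11 j" for j y
    by (auto simp: arc_simps)
  have N4: "?adj (vx 4 j) y \<longleftrightarrow> y = vx 3 j \<or> y = vx 5 j" for j y
    by (auto simp: arc_simps)
  have N3: "?adj (vx 3 x) y \<Longrightarrow> y = vx 4 x \<or> (\<exists>j. AT j x \<and> y = vx 9 j) \<or> (\<exists>j. AF j x \<and> y = vx 11 j)" for x y
    by (auto simp: arc_simps)

  \<comment> \<open>A vertex with a single neighbour cannot be an inner vertex of the path.\<close>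
  have start: "p \<zero> = vx 0 \<zero>"
  proof (rule ccontr)
    assume "p \<zero> \<noteq> vx 0 \<zero>"
    then obtain y z where "y \<noteq> z" "\<And>w. used p (vx 0 \<zero>) w \<longleftrightarrow> w = y \<or> w = z"
      using used_inner[OF p(1), of "vx 0 \<zero>"] V by (metis zero_less_numeral)
    moreover have "w = vx 1 \<zero>" if "used p (vx 0 \<zero>) w" for w
      using adj[OF that] by (auto simp: N0)
    ultimately show False by metis
  qed
  have two: "\<exists>y z. y \<noteq> z \<and> (\<forall>w. used p (vx r j) w \<longleftrightarrow> w = y \<or> w = z)"
    if "r < 12" "r \<noteq> 0 \<or> j \<noteq> \<zero>" for r j
    using used_inner[OF p(1) V[OF that(1)], of j] that(2) start by (metis vx_eq)
  \<comment> \<open>An inner vertex with only two neighbours uses both edges, and all vertices but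
    \<open>vx 0 \<zero>\<close> are inner.\<close>
  have deg2: "used p (vx r j) y \<and> used p (vx r j) z"
    if "r < 12" "r \<noteq> 0 \<or> j \<noteq> \<zero>" "\<And>w. ?adj (vx r j) w \<longleftrightarrow> w = y \<or> w = z" for r j y z
    using two[OF that(1,2)] adj that(3) by metis
  have other: "\<exists>z. z \<noteq> y \<and> (\<forall>w. used p (vx r j) w \<longleftrightarrow> w = y \<or> w = z)"
    if "r < 12" "r \<noteq> 0 \<or> j \<noteq> \<zero>" "used p (vx r j) y" for r j y
    using two[OF that(1,2)] that(3) by metis

  have u01: "used p (vx 1 j) (vx 0 j)" for j
  proof (cases j rule: zero_or_suc)
    case 1
    have "used p (vx 0 \<zero>) (p \<one>)" using used_start[OF p(1)] start by metis
    moreover from this have "p \<one> = vx 1 \<zero>" using adj N0 by fastforce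
    ultimately show ?thesis using 1 used_sym by metis
  next
    case (2 i)
    have "?adj (vx 0 (i \<oplus> \<one>)) w \<longleftrightarrow> w = vx 1 (i \<oplus> \<one>) \<or> w = vx 2 i" for w
      using N0[of "i \<oplus> \<one>" w] by auto
    from deg2[OF _ _ this] have "used p (vx 0 j) (vx 1 j)" using 2 by simp
    then show ?thesis using used_sym by metis
  qed
  have surj: "\<exists>i. j = \<pi> i" for j using \<pi> by (metis bij_pointE)
  have u7: "used p (vx 7 (\<pi> j)) (vx 6 (\<pi> j)) \<and> used p (vx 7 (\<pi> j)) (vx 8 j)" for j
    by (rule deg2[OF _ _ N7]) auto
  have u10: "used p (vx 10 (\<pi> j)) (vx 9 (\<pi> j)) \<and> used p (vx 10 (\<pi> j)) (vx 11 j)" for j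
    by (rule deg2[OF _ _ N10]) auto
  have u4: "used p (vx 4 j) (vx 3 j) \<and> used p (vx 4 j) (vx 5 j)" for j
    by (rule deg2[OF _ _ N4]) auto
  have u67: "used p (vx 6 j) (vx 7 j)" for j using surj u7 used_sym by metis
  have u87: "used p (vx 8 j) (vx 7 (\<pi> j))" for j using u7 used_sym by metis
  have u910: "used p (vx 9 j) (vx 10 j)" for j using surj u10 used_sym by metis
  have u1110: "used p (vx 11 j) (vx 10 (\<pi> j))" for j using u10 used_sym by metis
  \<comment> \<open>With three neighbours and one edge known to be used, exactly one of the other
    two edges is used.\<close>
  have exactly_one: "used p (vx r j) b \<longleftrightarrow> \<not> used p (vx r j) c"
    if h: "r < 12" "r \<noteq> 0" "used p (vx r j) a" "\<And>w. ?adj (vx r j) w \<longleftrightarrow> w = a \<or> w = b \<or> w = c"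
      "b \<noteq> a" "c \<noteq> a" "b \<noteq> c" for r j a b c
  proof -
    obtain z where z: "z \<noteq> a" "\<And>w. used p (vx r j) w \<longleftrightarrow> w = a \<or> w = z"
      using other[OF h(1) _ h(3)] h(2) by blast
    then have "z = b \<or> z = c" using adj[of "vx r j" z] h(4)[of z] by blast
    then show ?thesis using z h(5-7) by metis
  qed
  have only: "y = a \<or> y = b" if "r < 12" "r \<noteq> 0" "used p (vx r j) a" "used p (vx r j) b" "a \<noteq> b"
      "used p (vx r j) y" for r j a b y
    using two[OF that(1), of j] that(2-) by metis
  have x1: "used p (vx 1 j) (vx 6 j) \<longleftrightarrow> \<not> used p (vx 1 j) (vx 8 j)" for j
    by (rule exactly_one[OF _ _ u01 N1]) simp_all
  have x6: "used p (vx 6 j) (vx 1 j) \<longleftrightarrow> \<not> used p (vx 6 j) (vx 9 j)" for j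
    by (rule exactly_one[OF _ _ u67]) (auto simp: N6)
  have x8: "used p (vx 8 j) (vx 1 j) \<longleftrightarrow> \<not> used p (vx 8 j) (vx 11 j)" for j
    by (rule exactly_one[OF _ _ u87]) (auto simp: N8)
  \<comment> \<open>Both row edges together with the rungs would close a hexagon: each of its six
    vertices would have its two used edges inside.\<close>
  have no_cycle: "\<not> (used p (vx 6 (\<pi> j)) (vx 9 (\<pi> j)) \<and> used p (vx 8 j) (vx 11 j))" for j
  proof
    assume *: "used p (vx 6 (\<pi> j)) (vx 9 (\<pi> j)) \<and> used p (vx 8 j) (vx 11 j)"
    let ?S = "{vx 6 (\<pi> j), vx 7 (\<pi> j), vx 8 j, vx 11 j, vx 10 (\<pi> j), vx 9 (\<pi> j)}"
    have "?S \<subseteq> range p" using V by simp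
    then obtain x y where xy: "x \<in> ?S" "used p x y" "y \<notin> ?S"
      using no_used_cycle[of ?S, OF _ _ _ p(1)] by blast
    have s: "used p (vx 9 (\<pi> j)) (vx 6 (\<pi> j))" "used p (vx 11 j) (vx 8 j)"
      using * used_sym by blast+
    have "y \<in> ?S" if "x = vx 6 (\<pi> j)"
      using only[OF _ _ u67[of "\<pi> j"] conjunct1[OF *]] xy(2) that by auto
    moreover have "y \<in> ?S" if "x = vx 7 (\<pi> j)"
      using only[OF _ _ conjunct1[OF u7] conjunct2[OF u7], of j] xy(2) that by auto
    moreover have "y \<in> ?S" if "x = vx 8 j"
      using only[OF _ _ u87[of j] conjunct2[OF *]] xy(2) that by auto
    moreover have "y \<in> ?S" if "x = vx 11 j"
      using only[OF _ _ u1110[of j] s(2)] xy(2) that by auto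
    moreover have "y \<in> ?S" if "x = vx 10 (\<pi> j)"
      using only[OF _ _ conjunct1[OF u10] conjunct2[OF u10], of j] xy(2) that by auto
    moreover have "y \<in> ?S" if "x = vx 9 (\<pi> j)"
      using only[OF _ _ u910[of "\<pi> j"] s(1)] xy(2) that by auto
    ultimately show False using xy(1,3) by blast
  qed
  have s: "used p (vx 6 j) (vx 1 j) \<longleftrightarrow> used p (vx 1 j) (vx 6 j)"
    "used p (vx 8 j) (vx 1 j) \<longleftrightarrow> used p (vx 1 j) (vx 8 j)" for j
    using used_sym by blast+
  \<comment> \<open>If \<open>j\<close> is true, its bottom row is not joined to its branch vertex,
    so the edge from 8 to 11 is used. Then the edge from 6 to 9 at \<open>\<pi> j\<close> is not,
    which leaves the edge to the branch vertex of \<open>\<pi> j\<close>.\<close>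
  show "used p (vx 1 j) (vx 6 j) \<Longrightarrow> used p (vx 1 (\<pi> j)) (vx 6 (\<pi> j))"
    using x1 x6 x8 no_cycle s by metis
  show "\<exists>j. used p (vx 1 j) (vx 6 j) \<and> AT j x \<or> \<not> used p (vx 1 j) (vx 6 j) \<and> AF j x"
  proof -
    have "used p (vx 3 x) (vx 4 x)" using u4 used_sym by blast
    from other[OF _ _ this] obtain z where z: "z \<noteq> vx 4 x" "used p (vx 3 x) z" by auto
    then consider j where "AT j x" "z = vx 9 j" | j where "AF j x" "z = vx 11 j"
      using N3 adj[OF z(2)] by blast
    then show ?thesis
    proof cases
      case (1 j)
      have "used p (vx 9 j) (vx 3 x)" using z(2) 1 used_sym by blast
      then have "\<not> used p (vx 9 j) (vx 6 j)"
        using only[OF _ _ u910[of j], of "vx 3 x" "vx 6 j"] by auto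
      then have "\<not> used p (vx 6 j) (vx 9 j)" using used_sym by blast
      then show ?thesis using x6 s 1 by blast
    next
      case (2 j)
      have "used p (vx 11 j) (vx 3 x)" using z(2) 2 used_sym by blast
      then have "\<not> used p (vx 11 j) (vx 8 j)"
        using only[OF _ _ u1110[of j], of "vx 3 x" "vx 8 j"] by auto
      then have "\<not> used p (vx 8 j) (vx 11 j)" using used_sym by blast
      then show ?thesis using x8 x1 s 2 by blast
    qed
  qed
qed

section \<open>The sequence of graphs as a set of the model\<close>

lemma definable_term_vx [definable_intros]:
  "definable_term M t \<Longrightarrow> definable_term M (\<lambda>e. vx r (t e))"
  unfolding vx_def by (intro definable_intros)

text \<open>Once both endpoints are decoded, adjacency becomes a plain disjunction without
  quantifiers over indices. This is the form to which the definability rules apply.\<close>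

lemma arc_pair:
  "arc \<pi> AT AF (pair j c) (pair i d) \<longleftrightarrow>
       (c = num 0 \<and> d = num 1 \<and> i = j \<or> c = num 2 \<and> d = num 0 \<and> i = j \<oplus> \<one> \<or>
        c = num 1 \<and> d = num 6 \<and> i = j \<or> c = num 1 \<and> d = num 8 \<and> i = j \<or>
        c = num 6 \<and> d = num 7 \<and> i = j \<or> c = num 7 \<and> d = num 8 \<and> j = \<pi> i \<or>
        c = num 6 \<and> d = num 9 \<and> i = j \<or> c = num 8 \<and> d = num 11 \<and> i = j \<or>
        c = num 9 \<and> d = num 10 \<and> i = j \<or> c = num 10 \<and> d = num 11 \<and> j = \<pi> i \<or>
        c = num 9 \<and> d = num 3 \<and> AT j i \<or> c = num 11 \<and> d = num 3 \<and> AF j i \<or>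
        c = num 3 \<and> d = num 4 \<and> i = j \<or> c = num 4 \<and> d = num 5 \<and> i = j \<or>
        c = num 5 \<and> d = num 2 \<and> (AT i j \<or> AF i j))"
  unfolding arc_def arcs_def vx_def by (simp only: bex_simps prod.case pair_inj simp_thms) simp

lemma arc_iff:
  "arc \<pi> AT AF x y \<longleftrightarrow>
     (\<exists>j c. x = pair j c \<and> (\<exists>i d. y = pair i d \<and> arc \<pi> AT AF (pair j c) (pair i d)))"
  using arc_vx[of \<pi> AT AF x y] unfolding vx_def by metis

lemma graph_family_sets:
  assumes "definable M (\<lambda>e. e 1 = \<pi> (e 0))"
    and "definable M (\<lambda>e. AT (e 2) (e 1) (e 0))" "definable M (\<lambda>e. AF (e 2) (e 1) (e 0))"
  shows "\<exists>G\<in>sets M. \<forall>k. slice G k = graph_of \<pi> (AT k) (AF k)"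
proof -
  let ?G = "{z. \<exists>x k. z = pair x k \<and> x \<in> graph_of \<pi> (AT k) (AF k)}"
  note \<pi> = definable_rel2[of "\<lambda>i j. i = \<pi> j", OF assms(1)]
  note A = definable_rel3[of AT, OF assms(2)] definable_rel3[of AF, OF assms(3)]
  have arc: "definable M (\<lambda>e. arc \<pi> (AT (e 2)) (AF (e 2)) (e 1) (e 0))"
    by (subst arc_iff, unfold arc_pair) (rule \<pi> A definable_intros)+
  have mem: "x \<in> graph_of \<pi> (AT k) (AF k) \<longleftrightarrow> (\<exists>a b. x = pair a b \<and>
      (b = \<zero> \<and> (\<exists>j c. a = pair j c \<and> (\<exists>r\<in>{..<12}. c = num r)) \<or>
       b = \<one> \<and> (\<exists>u v. a = pair u v \<and> (arc \<pi> (AT k) (AF k) u v \<or> arc \<pi> (AT k) (AF k) v u))))" for x k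
    unfolding graph_of_def vx_def by auto
  note R = definable_rel3[of "\<lambda>k. arc \<pi> (AT k) (AF k)", OF arc]
  have "?G \<in> sets M"
    unfolding mem by (rule comprehension) (rule R definable_intros finite_lessThan)+
  moreover have "slice ?G k = graph_of \<pi> (AT k) (AF k)" for k by auto
  ultimately show ?thesis by blast
qed

section \<open>From solutions to Hamilton paths\<close>

text \<open>Either choice runs through a whole hexagon: a true block takes the one with the top row
  of \<open>j\<close> and the bottom row of \<open>\<rho> j\<close>, a false block the one with the
  bottom row of \<open>j\<close> and the top row of \<open>\<pi> j\<close>. Both lists have twelve
  entries.\<close>

definition tour :: "('a \<Rightarrow> 'a) \<Rightarrow> ('a \<Rightarrow> 'a) \<Rightarrow> ('a \<Rightarrow> 'a) \<Rightarrow> bool \<Rightarrow> 'a \<Rightarrow> 'a list" where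
  "tour \<pi> \<rho> h b j = [vx 0 j, vx 1 j] @
     (if b then [vx 6 j, vx 7 j, vx 8 (\<rho> j), vx 11 (\<rho> j), vx 10 j, vx 9 j]
      else [vx 8 j, vx 7 (\<pi> j), vx 6 (\<pi> j), vx 9 (\<pi> j), vx 10 (\<pi> j), vx 11 j]) @
     [vx 3 (h j), vx 4 (h j), vx 5 (h j), vx 2 j]"

lemma less_12_cases:
  fixes r :: nat
  assumes "r < 12"
  obtains "r = 0" | "r = 1" | "r = 2" | "r = 3" | "r = 4" | "r = 5" | "r = 6" | "r = 7" | "r = 8"
    | "r = 9" | "r = 10" | "r = 11"
proof -
  have "r = 0 \<or> r = 1 \<or> r = 2 \<or> r = 3 \<or> r = 4 \<or> r = 5 \<or> r = 6 \<or> r = 7 \<or> r = 8 \<or>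
      r = 9 \<or> r = 10 \<or> r = 11"
    using assms by presburger
  then show thesis using that by blast
qed

text \<open>Invariance of \<open>W\<close> lets every hexagon be run through exactly once: of the
  two blocks meeting in it, either both are true and \<open>\<pi> j\<close> takes it, or both are
  false and \<open>j\<close> does. As \<open>h\<close> is a permutation, every segment is passed
  exactly once too.\<close>

lemma hamilton_path_of_tours:
  assumes \<rho>: "\<And>j. \<rho> (\<pi> j) = j" "\<And>j. \<pi> (\<rho> j) = j" and g: "\<And>j. g (h j) = j" "\<And>j. h (g j) = j"
    and W: "\<And>j. \<pi> j \<in> W \<longleftrightarrow> j \<in> W"
    and AT: "\<And>j. j \<in> W \<Longrightarrow> AT j (h j)" and AF: "\<And>j. j \<notin> W \<Longrightarrow> AF j (h j)"
  shows "is_hamilton_path (graph_of \<pi> AT AF)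
    {pair (num 12 \<otimes> j \<oplus> num r) (tour \<pi> \<rho> h (j \<in> W) j ! r) | j r. r < 12}"
proof -
  define loc where "loc r j = tour \<pi> \<rho> h (j \<in> W) j ! r" for r j
  let ?P = "{pair (num 12 \<otimes> j \<oplus> num r) (loc r j) | j r. r < 12}"
  have P: "pair (num 12 \<otimes> j \<oplus> num r) v \<in> ?P \<longleftrightarrow> v = loc r j" if "r < 12" for r j v
    using division_unique[OF that] that by auto
  have div: "\<exists>j r. r < 12 \<and> n = num 12 \<otimes> j \<oplus> num r" for n using division[of 12 n] by auto
  have W': "\<rho> j \<in> W \<longleftrightarrow> j \<in> W" for j using W[of "\<rho> j"] \<rho> by simp
  have loc_simps:
    "loc 0 j = vx 0 j" "loc 1 j = vx 1 j" "loc (Suc 0) j = vx 1 j" "loc 8 j = vx 3 (h j)" "loc 9 j = vx 4 (h j)"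
    "loc 10 j = vx 5 (h j)" "loc 11 j = vx 2 j"
    "loc (Suc (Suc 0)) j = (if j \<in> W then vx 6 j else vx 8 j)"
    "loc 2 j = (if j \<in> W then vx 6 j else vx 8 j)"
    "loc 3 j = (if j \<in> W then vx 7 j else vx 7 (\<pi> j))"
    "loc 4 j = (if j \<in> W then vx 8 (\<rho> j) else vx 6 (\<pi> j))"
    "loc 5 j = (if j \<in> W then vx 11 (\<rho> j) else vx 9 (\<pi> j))"
    "loc 6 j = (if j \<in> W then vx 10 j else vx 10 (\<pi> j))"
    "loc 7 j = (if j \<in> W then vx 9 j else vx 11 j)" for j
    by (simp_all add: loc_def tour_def)
  have vertex: "\<exists>q i. q < 12 \<and> loc r j = vx q i" if "r < 12" for r j
    using that by (cases r rule: less_12_cases) (simp_all add: loc_simps)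
  have step: "arc \<pi> AT AF (loc r j) (loc (Suc r) j) \<or> arc \<pi> AT AF (loc (Suc r) j) (loc r j)"
    if "r < 11" for r j
  proof -
    have "r < 12" using that by simp
    then show ?thesis
      by (cases r rule: less_12_cases; cases "j \<in> W")
         (use that in \<open>simp_all add: loc_simps AT AF \<rho> arc_def arcs_def\<close>)
  qed
  have step_last: "arc \<pi> AT AF (loc 11 j) (loc 0 (j \<oplus> \<one>))" for j
    by (simp add: loc_simps arc_def arcs_def)
  \<comment> \<open>The inverse of \<open>loc\<close>: the offset and the block at which a vertex is
    visited.\<close>
  define place where "place q i = (
      if q = 0 then (0 :: nat, i) else if q = 1 then (1, i) else if q = 2 then (11, i) else
      if q = 3 then (8, g i) else if q = 4 then (9, g i) else if q = 5 then (10, g i) else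
      if q = 6 then (if i \<in> W then (2, i) else (4, \<rho> i)) else
      if q = 7 then (if i \<in> W then (3, i) else (3, \<rho> i)) else
      if q = 8 then (if i \<in> W then (4, \<pi> i) else (2, i)) else
      if q = 9 then (if i \<in> W then (7, i) else (5, \<rho> i)) else
      if q = 10 then (if i \<in> W then (6, i) else (6, \<rho> i)) else
      (if i \<in> W then (5, \<pi> i) else (7, i)))" for q :: nat and i :: 'a
  have place1: "loc (fst (place q i)) (snd (place q i)) = vx q i \<and> fst (place q i) < 12" if "q < 12" for q i
    using that by (cases q rule: less_12_cases) (simp_all add: place_def loc_simps \<rho> g W W')
  have place2: "place q i = (r, j)" if "loc r j = vx q i" "r < 12" for q i r j
    using that(2,1)
    by (cases r rule: less_12_cases; cases "j \<in> W")
       (auto simp: loc_simps place_def \<rho> g W W')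
  have "is_hamilton_path (graph_of \<pi> AT AF) ?P"
    unfolding is_hamilton_path_def graph_of_vertices graph_of_edges
  proof (intro conjI allI impI ballI)
    fix z assume "z \<in> ?P"
    then show "\<exists>n v. z = pair n v \<and> (\<exists>r j. r < 12 \<and> v = vx r j)" using vertex by blast
  next
    fix n
    obtain j r where "r < 12" "n = num 12 \<otimes> j \<oplus> num r" using div by blast
    then show "\<exists>u. pair n u \<in> ?P \<and> (\<forall>v. pair n v \<in> ?P \<longrightarrow> v = u)" using P by simp
  next
    fix n u v assume *: "pair n u \<in> ?P \<and> pair (n \<oplus> \<one>) v \<in> ?P"
    obtain j r where r: "r < 12" "n = num 12 \<otimes> j \<oplus> num r" using div by blast
    then have u: "u = loc r j" using * P by simp
    show "arc \<pi> AT AF u v \<or> arc \<pi> AT AF v u"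
    proof (cases "r < 11")
      case True
      then have "n \<oplus> \<one> = num 12 \<otimes> j \<oplus> num (Suc r)" using r by (simp add: add_assoc)
      then have "v = loc (Suc r) j" using * P[of "Suc r" j v] True by simp
      then show ?thesis using step[OF True] u by simp
    next
      case False
      then have r11: "r = 11" using r by simp
      have "num 12 = num 11 \<oplus> \<one>" by (simp only: num_Suc[symmetric]) simp
      then have "n \<oplus> \<one> = num 12 \<otimes> (j \<oplus> \<one>) \<oplus> num 0" using r r11 by (simp add: mul_suc add_assoc)
      then have "v = loc 0 (j \<oplus> \<one>)" using * P[of 0 "j \<oplus> \<one>" v] by simp
      then show ?thesis using step_last u r11 by simp
    qed
  next
    fix v assume "\<exists>r j. r < 12 \<and> v = vx r j"
    then obtain q i where qi: "q < 12" "v = vx q i" by blast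
    obtain r j where rj: "place q i = (r, j)" by fastforce
    then have *: "loc r j = v" "r < 12" using place1[OF qi(1), of i] qi(2) by simp_all
    show "\<exists>n. pair n v \<in> ?P \<and> (\<forall>m. pair m v \<in> ?P \<longrightarrow> m = n)"
    proof (intro exI[of _ "num 12 \<otimes> j \<oplus> num r"] conjI allI impI)
      show "pair (num 12 \<otimes> j \<oplus> num r) v \<in> ?P" using * P by simp
    next
      fix m assume "pair m v \<in> ?P"
      then obtain j' r' where "m = num 12 \<otimes> j' \<oplus> num r'" "v = loc r' j'" "r' < 12" by auto
      then show "m = num 12 \<otimes> j \<oplus> num r" using place2[of r' j' q i] qi(2) rj by simp
    qed
  qed
  then show ?thesis by (simp add: loc_def)
qed

text \<open>Since all tours have the same length, the block visited at step \<open>n\<close> is a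
  quotient of \<open>n\<close> and hence bounded by \<open>n\<close>. The graph of the path is thus
  defined by a bounded formula.\<close>

lemma tours_sets:
  assumes "W \<in> sets M" "definable M (\<lambda>e. e 1 = \<pi> (e 0))" "definable M (\<lambda>e. e 1 = h (e 0))"
    and \<rho>: "\<And>j. \<rho> (\<pi> j) = j" "\<And>j. \<pi> (\<rho> j) = j"
  shows "{pair (num 12 \<otimes> j \<oplus> num r) (tour \<pi> \<rho> h (j \<in> W) j ! r) | j r. r < 12} \<in> sets M"
proof -
  note \<pi> = definable_rel2[of "\<lambda>i j. i = \<pi> j", OF assms(2)]
  note h = definable_rel2[of "\<lambda>i j. i = h j", OF assms(3)]
  \<comment> \<open>The graph of \<open>\<rho>\<close> is that of \<open>\<pi>\<close>
    reversed.\<close>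
  have "i = \<rho> j \<longleftrightarrow> j = \<pi> i" for i j using \<rho> by metis
  then have \<rho>': "definable M (\<lambda>e. s e = \<rho> (t e))" if "definable_term M s" "definable_term M t" for s t
    using \<pi>[OF that(2,1)] by simp
  have eq_vx: "v = vx q i \<longleftrightarrow> (\<exists>a b. v = pair a b \<and> b = num q \<and> a = i)" for v q i
    by (auto simp: vx_def)
  have vx: "definable M (\<lambda>e. s e = vx q (f (t e)))"
    if f: "\<And>s t. definable_term M s \<Longrightarrow> definable_term M t \<Longrightarrow> definable M (\<lambda>e. s e = f (t e))"
      and st: "definable_term M s" "definable_term M t" for s t q f
  proof -
    have "definable M (\<lambda>e. e 1 = vx q (f (e 0)))"
      unfolding eq_vx by (rule f definable_intros)+
    from definable_rel2[of "\<lambda>v j. v = vx q (f j)", OF this st] show ?thesis .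
  qed
  note vx_rules = vx[OF \<rho>'] vx[OF \<pi>] vx[OF h]
  have loc: "definable M (\<lambda>e. e 1 = tour \<pi> \<rho> h (e 0 \<in> W) (e 0) ! r)" if "r < 12" for r
  proof -
    have D: "definable M (\<lambda>e. e 0 \<in> W \<and> e 1 = tour \<pi> \<rho> h True (e 0) ! r \<or>
        \<not> e 0 \<in> W \<and> e 1 = tour \<pi> \<rho> h False (e 0) ! r)"
      using that
      by (cases r rule: less_12_cases)
         (simp_all add: tour_def, (assumption | rule vx_rules assms(1) definable_intros)+)
    have eq: "e 1 = tour \<pi> \<rho> h (e 0 \<in> W) (e 0) ! r \<longleftrightarrow> e 0 \<in> W \<and> e 1 = tour \<pi> \<rho> h True (e 0) ! r \<or>
        \<not> e 0 \<in> W \<and> e 1 = tour \<pi> \<rho> h False (e 0) ! r" for e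
      by (cases "e 0 \<in> W") simp_all
    show ?thesis unfolding eq by (rule D)
  qed
  note loc' = definable_rel2[of "\<lambda>v j. v = tour \<pi> \<rho> h (j \<in> W) j ! r" for r, OF loc]
  have "{z. \<exists>n v. z = pair n v \<and> (\<exists>r\<in>{..<12}. \<exists>j. j \<prec> n \<oplus> \<one> \<and> n = num 12 \<otimes> j \<oplus> num r \<and>
      v = tour \<pi> \<rho> h (j \<in> W) j ! r)} \<in> sets M"
    by (rule comprehension) (rule loc' definable_intros finite_lessThan | simp)+
  also have "{z. \<exists>n v. z = pair n v \<and> (\<exists>r\<in>{..<12}. \<exists>j. j \<prec> n \<oplus> \<one> \<and> n = num 12 \<otimes> j \<oplus> num r \<and>
      v = tour \<pi> \<rho> h (j \<in> W) j ! r)} =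
      {pair (num 12 \<otimes> j \<oplus> num r) (tour \<pi> \<rho> h (j \<in> W) j ! r) | j r. r < 12}"
  proof -
    have "j \<prec> num 12 \<otimes> j \<oplus> num r \<oplus> \<one>" for j r
    proof -
      have "num 12 = num 11 \<oplus> \<one>" by (simp only: num_Suc[symmetric]) simp
      then have "num 12 \<otimes> j \<oplus> num r = j \<oplus> (num 11 \<otimes> j \<oplus> num r)" by (simp add: distrib_right add_ac)
      then show ?thesis unfolding less_suc_iff by blast
    qed
    then show ?thesis by (auto, blast)
  qed
  finally show ?thesis .
qed

section \<open>Choosing solutions of infinite clause systems\<close>

text \<open>The literals of a variable \<open>v\<close> are coded by \<open>pair v \<zero>\<close> (positive) and \<open>pair v \<one>\<close> (negative);
  other numbers are never true. A set \<open>C\<close> codes a sequence of clause systems: literal \<open>l\<close> belongs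
  to the clause \<open>c\<close> of system \<open>k\<close> iff \<open>pair (pair c l) k \<in> C\<close>. Clauses may be infinite.\<close>

definition lit :: "'a set \<Rightarrow> 'a \<Rightarrow> bool" where
  "lit W l \<longleftrightarrow> (\<exists>v s. l = pair v s \<and> (s = \<zero> \<and> v \<in> W \<or> s = \<one> \<and> v \<notin> W))"

definition solves :: "'a set \<Rightarrow> 'a \<Rightarrow> 'a set \<Rightarrow> bool" where
  "solves C k W \<longleftrightarrow> (\<forall>c. \<exists>l. pair (pair c l) k \<in> C \<and> lit W l)"

lemma definable_lit [definable_intros]:
  "W \<in> sets M \<Longrightarrow> definable_term M t \<Longrightarrow> definable M (\<lambda>e. lit W (t e))"
  unfolding lit_def by (rule definable_intros | assumption)+

lemma definable_is_pair [definable_intros]: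
  "definable_term M t \<Longrightarrow> definable M (\<lambda>e. \<exists>a b. t e = pair a b)"
  using definable_ex_pair[of t "\<lambda>_ _ _. True"] by (simp add: definable_const)

lemma lit_pair [simp]: "lit W (pair v \<zero>) \<longleftrightarrow> v \<in> W" "lit W (pair v \<one>) \<longleftrightarrow> v \<notin> W"
  by (auto simp: lit_def)

lemma ex_lit:
  "(\<exists>l. R l \<and> lit W l) \<longleftrightarrow>
     (\<exists>v. R (pair v \<zero>) \<and> v \<in> W) \<or> (\<exists>v. R (pair v \<one>) \<and> v \<notin> W)"
  by (auto simp: lit_def)

section \<open>The permutations for copies and for clause segments\<close>

lemma bij_of_rel:
  assumes "\<And>j. \<exists>!i. R j i" "\<And>i. \<exists>!j. R j i"
  obtains f where "bij f" "\<And>j i. i = f j \<longleftrightarrow> R j i"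
proof -
  obtain f where f: "\<And>j i. i = f j \<longleftrightarrow> R j i" using assms(1) by metis
  then have "bij f" using assms(2) unfolding bij_iff by metis
  with f show thesis by (rule that[rotated])
qed

text \<open>The variable \<open>v\<close> has a copy at \<open>pair c (pair v s)\<close> for every clause \<open>c\<close> and sign \<open>s\<close>. The shift
  runs through the positive copies in decreasing and then through the negative ones in increasing
  order, so that truth at a positive copy implies truth at every negative copy.\<close>

definition shift_rel :: "'a \<Rightarrow> 'a \<Rightarrow> bool" where
  "shift_rel j i \<longleftrightarrow>
     (\<exists>c l. j = pair c l \<and> (\<exists>v s. l = pair v s \<and>
        (s = \<zero> \<and> c = \<zero> \<and> i = pair \<zero> (pair v \<one>) \<or>
         s = \<zero> \<and> (\<exists>d. d \<prec> c \<and> c = d \<oplus> \<one> \<and> i = pair d l) \<or>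
         s = \<one> \<and> i = pair (c \<oplus> \<one>) l))) \<or>
     i = j \<and> \<not> (\<exists>c l. j = pair c l \<and> (\<exists>v s. l = pair v s \<and> (s = \<zero> \<or> s = \<one>)))"

lemma less_self_suc [simp]: "a \<prec> a \<oplus> \<one>"
  by (simp add: less_suc)

lemma shift_rel_simps:
  "shift_rel (pair \<zero> (pair v \<zero>)) i \<longleftrightarrow> i = pair \<zero> (pair v \<one>)"
  "shift_rel (pair (c \<oplus> \<one>) (pair v \<zero>)) i \<longleftrightarrow> i = pair c (pair v \<zero>)"
  "shift_rel (pair c (pair v \<one>)) i \<longleftrightarrow> i = pair (c \<oplus> \<one>) (pair v \<one>)"
  "shift_rel j (pair \<zero> (pair v \<one>)) \<longleftrightarrow> j = pair \<zero> (pair v \<zero>)"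
  "shift_rel j (pair (c \<oplus> \<one>) (pair v \<one>)) \<longleftrightarrow> j = pair c (pair v \<one>)"
  "shift_rel j (pair c (pair v \<zero>)) \<longleftrightarrow> j = pair (c \<oplus> \<one>) (pair v \<zero>)"
  by (auto simp: shift_rel_def)

lemma shift_rel_other:
  assumes "\<nexists>c v. j = pair c (pair v \<zero>) \<or> j = pair c (pair v \<one>)"
  shows "shift_rel j i \<longleftrightarrow> i = j" "shift_rel i j \<longleftrightarrow> i = j"
  using assms by (auto simp: shift_rel_def)

lemma shift_rel_cases:
  obtains v where "j = pair \<zero> (pair v \<zero>)" | c v where "j = pair (c \<oplus> \<one>) (pair v \<zero>)"
    | v where "j = pair \<zero> (pair v \<one>)" | c v where "j = pair (c \<oplus> \<one>) (pair v \<one>)"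
    | "\<nexists>c v. j = pair c (pair v \<zero>) \<or> j = pair c (pair v \<one>)"
  by (metis zero_or_suc)

lemma shift_exists:
  obtains \<pi> where "bij \<pi>" "\<And>j i. i = \<pi> j \<longleftrightarrow> shift_rel j i"
proof (rule bij_of_rel)
  show "\<exists>!i. shift_rel j i" for j
    by (cases j rule: shift_rel_cases) (simp_all add: shift_rel_simps shift_rel_other)
  show "\<exists>!j. shift_rel j i" for i
    by (cases i rule: shift_rel_cases) (simp_all add: shift_rel_simps shift_rel_other)
qed (rule that)

lemma definable_shift: "definable M (\<lambda>e. shift_rel (e 0) (e 1))"
  unfolding shift_rel_def by (rule definable_intros)+

text \<open>Every block \<open>pair c l\<close> passes through one of the clause segments of \<open>c\<close>; the segment
  \<open>pair c \<zero>\<close> is reserved for a true literal of \<open>c\<close>. The remaining segments can always be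
  distributed, by shifting them past the least true literal.\<close>

definition free_pass :: "'a \<Rightarrow> 'a \<Rightarrow> bool" where
  "free_pass j x \<longleftrightarrow> x = j \<and> \<not> (\<exists>c l. j = pair c l \<and> l = \<zero>) \<or> (\<exists>c l. j = pair c l \<and> x = pair c (l \<oplus> \<one>))"

text \<open>\<open>s\<close> is the sign of the literals made true by the exit in question:
  \<open>\<zero>\<close> for the top row, \<open>\<one>\<close> for the bottom row.\<close>

definition clause_pass :: "'a set \<Rightarrow> 'a \<Rightarrow> 'a \<Rightarrow> 'a \<Rightarrow> 'a \<Rightarrow> bool" where
  "clause_pass C s k j x \<longleftrightarrow> free_pass j x \<or>
     (\<exists>c l. j = pair c l \<and> (\<exists>v t. l = pair v t \<and> t = s \<and> x = pair c \<zero> \<and> pair (pair c l) k \<in> C))"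

lemma definable_clause_pass:
  "C \<in> sets M \<Longrightarrow> definable M (\<lambda>e. clause_pass C s (e 2) (e 1) (e 0))"
  unfolding clause_pass_def free_pass_def by (rule definable_intros | assumption)+

text \<open>Hilbert's hotel among the numbers \<open>pair c l\<close> with fixed \<open>c\<close>:
  the least good \<open>l\<close> moves to \<open>\<zero>\<close>, smaller ones move up, greater
  ones stay. A bounded quantifier expresses leastness, so the graph is definable whenever
  \<open>good\<close> is.\<close>

definition hotel_rel :: "('a \<Rightarrow> 'a \<Rightarrow> bool) \<Rightarrow> 'a \<Rightarrow> 'a \<Rightarrow> bool" where
  "hotel_rel good j i \<longleftrightarrow> (\<exists>c l. j = pair c l \<and>
      ((\<exists>m. m \<prec> l \<and> good c m) \<and> i = j \<or>
       \<not> (\<exists>m. m \<prec> l \<and> good c m) \<and> good c l \<and> i = pair c \<zero> \<or>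
       \<not> (\<exists>m. m \<prec> l \<and> good c m) \<and> \<not> good c l \<and> i = pair c (l \<oplus> \<one>))) \<or>
     i = j \<and> \<not> (\<exists>c l. j = pair c l)"

lemma hotel_exists:
  assumes "\<And>c. definable M (\<lambda>e. good c (e 0))" "\<And>c. \<exists>l. good c l"
  obtains h where "bij h" "\<And>j i. i = h j \<longleftrightarrow> hotel_rel good j i"
proof -
  have "\<exists>l. good c l \<and> (\<forall>m. m \<prec> l \<longrightarrow> \<not> good c m)" for c
    using least_witness[of "good c", OF assms(1)] assms(2) by blast
  then obtain f where f: "\<And>c. good c (f c)" "\<And>c m. m \<prec> f c \<Longrightarrow> \<not> good c m" by metis
  have ex: "(\<exists>m. m \<prec> l \<and> good c m) \<longleftrightarrow> f c \<prec> l" for c l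
    using f less_trans less_linear by metis
  have first: "\<not> f c \<prec> l \<and> good c l \<longleftrightarrow> l = f c" for c l
    using f less_linear less_irrefl by metis
  have later: "\<not> f c \<prec> l \<and> \<not> good c l \<longleftrightarrow> l \<prec> f c" for c l
    using f less_linear less_irrefl less_asym by metis
  have rel: "hotel_rel good j i \<longleftrightarrow> (\<exists>c l. j = pair c l \<and>
      (f c \<prec> l \<and> i = j \<or> l = f c \<and> i = pair c \<zero> \<or> l \<prec> f c \<and> i = pair c (l \<oplus> \<one>))) \<or>
      i = j \<and> \<not> (\<exists>c l. j = pair c l)" for j i
    unfolding hotel_rel_def ex using first later by blast
  have fwd: "\<exists>!i. hotel_rel good j i" for j
  proof (cases "\<exists>c l. j = pair c l")
    case True
    then obtain c l where "j = pair c l" by blast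
    moreover have "f c \<prec> l \<or> l = f c \<or> l \<prec> f c" using less_linear by blast
    ultimately show ?thesis using less_asym less_irrefl unfolding rel by (elim disjE) auto
  next
    case False
    then show ?thesis unfolding rel by auto
  qed
  \<comment> \<open>\<open>pair c \<zero>\<close> comes from the least good number;
    \<open>pair c (m \<oplus> \<one>)\<close> comes from itself or from \<open>pair c m\<close>,
    depending on where \<open>f c\<close> lies.\<close>
  have bwd: "\<exists>!j. hotel_rel good j i" for i
  proof (cases "\<exists>c l. i = pair c l")
    case True
    then obtain c l where i: "i = pair c l" by blast
    have eq: "hotel_rel good j i \<longleftrightarrow> (\<exists>m. j = pair c m \<and>
        (f c \<prec> m \<and> l = m \<or> m = f c \<and> l = \<zero> \<or> m \<prec> f c \<and> l = m \<oplus> \<one>))" for j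
      unfolding rel i by auto
    have suc: "m \<prec> f c \<longleftrightarrow> \<not> f c \<prec> m \<oplus> \<one>" for m
      using not_less_iff by blast
    show ?thesis
    proof (cases l rule: zero_or_suc)
      case 1
      then show ?thesis unfolding eq by auto
    next
      case (2 m)
      show ?thesis
      proof (cases "f c \<prec> l")
        case True
        then show ?thesis unfolding eq using 2 suc by auto
      next
        case False
        then show ?thesis unfolding eq using 2 suc by auto
      qed
    qed
  next
    case False
    then show ?thesis unfolding rel by auto
  qed
  show thesis using bij_of_rel[OF fwd bwd] that by blast
qed

text \<open>Being used is an existential statement about steps. As \<open>x\<close> is visited at a
  unique step, it also has a universal form, and recursive comprehension needs both.\<close>

lemma used_iff_all:
  assumes "inj p" "x \<in> range p"
  shows "used p x y \<longleftrightarrow>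
    (\<forall>n. x = p n \<longrightarrow> y = p (n \<oplus> \<one>) \<or> (\<exists>m. m \<prec> n \<and> n = m \<oplus> \<one> \<and> y = p m))"
proof -
  obtain k where k: "x = p k" using assms(2) by blast
  have "used p x y \<longleftrightarrow> p (k \<oplus> \<one>) = y \<or> (\<exists>m. p m = y \<and> m \<oplus> \<one> = k)"
    unfolding used_def k inj_eq[OF assms(1)] by blast
  also have "\<dots> \<longleftrightarrow> (\<forall>n. x = p n \<longrightarrow> y = p (n \<oplus> \<one>) \<or> (\<exists>m. m \<prec> n \<and> n = m \<oplus> \<one> \<and> y = p m))"
    unfolding k inj_eq[OF assms(1)] using less_self_suc by auto
  finally show ?thesis .
qed

end

section \<open>Choice of solutions and arithmetical comprehension\<close>

locale hamilton_choice = rca +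
  assumes hamilton_choice: "\<And>G. G \<in> sets M \<Longrightarrow>
    (\<And>i. is_graph (slice G i) \<and> (\<exists>P\<in>sets M. is_hamilton_path (slice G i) P)) \<Longrightarrow>
    \<exists>P\<in>sets M. \<forall>i. is_hamilton_path (slice G i) (slice P i)"
begin

text \<open>The graphs are built from \<open>C\<close> alone. A solution of a single system only
  serves to show that its graph has a Hamilton path in the model.\<close>

theorem clause_choice:
  assumes C: "C \<in> sets M" and solvable: "\<And>k. \<exists>W\<in>sets M. solves C k W"
  shows "\<exists>Y\<in>sets M. \<forall>k. solves C k (slice Y k)"
proof -
  obtain \<pi> where \<pi>: "bij \<pi>" and shift: "\<And>j i. i = \<pi> j \<longleftrightarrow> shift_rel j i"
    using shift_exists by blast
  obtain \<rho> where \<rho>: "\<And>j. \<rho> (\<pi> j) = j" "\<And>j. \<pi> (\<rho> j) = j"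
    using \<pi> by (metis bij_inv_eq_iff)
  define AT AF where "AT = clause_pass C \<zero>" and "AF = clause_pass C \<one>"
  let ?graph = "\<lambda>k. graph_of \<pi> (AT k) (AF k)"
  have def_\<pi>: "definable M (\<lambda>e. e 1 = \<pi> (e 0))" unfolding shift by (rule definable_shift)
  obtain G where G: "G \<in> sets M" "\<And>k. slice G k = ?graph k"
    using graph_family_sets[of \<pi> AT AF, OF def_\<pi>] definable_clause_pass[OF C]
    unfolding AT_def AF_def by blast
  have "\<exists>P\<in>sets M. is_hamilton_path (?graph k) P" for k
  proof -
    obtain W where W: "W \<in> sets M" "solves C k W" using solvable by blast
    define good where "good c l \<longleftrightarrow> pair (pair c l) k \<in> C \<and> lit W l" for c l
    have def_good: "definable M (\<lambda>e. good (e 1) (e 0))"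
      unfolding good_def by (rule definable_intros C W | assumption)+
    have def_good1: "definable M (\<lambda>e. good c (e 0))" for c
      unfolding good_def by (rule definable_intros C W | assumption)+
    have ex_good: "\<exists>l. good c l" for c using W(2) unfolding solves_def good_def by blast
    obtain h where h: "bij h" and hotel: "\<And>j i. i = h j \<longleftrightarrow> hotel_rel good j i"
      using hotel_exists[of good, OF def_good1 ex_good] by blast
    obtain g where g: "\<And>j. g (h j) = j" "\<And>j. h (g j) = j"
      using h by (metis bij_inv_eq_iff)
    have def_h: "definable M (\<lambda>e. e 1 = h (e 0))"
      unfolding hotel hotel_rel_def
      by (rule definable_rel2[of good, OF def_good] definable_intros)+
    \<comment> \<open>Every copy of a variable gets the value of that variable, which makes
      \<open>U\<close> invariant under the shift.\<close>
    define U where "U = {j. \<exists>c l. j = pair c l \<and> (\<exists>v s. l = pair v s \<and> v \<in> W)}"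
    have U: "U \<in> sets M"
      unfolding U_def by (rule comprehension) (rule definable_intros W)+
    have U_inv: "\<pi> j \<in> U \<longleftrightarrow> j \<in> U" for j
    proof -
      have "shift_rel j (\<pi> j)" using shift by blast
      then show ?thesis by (cases j rule: shift_rel_cases) (auto simp: shift_rel_simps shift_rel_other U_def)
    qed
    \<comment> \<open>A block sent to the reserved segment carries a true literal, so its row fits
      the sign of that literal. Every other block moves along a free pass, which is open to both
      rows.\<close>
    have "(j \<in> U \<longrightarrow> AT k j (h j)) \<and> (j \<notin> U \<longrightarrow> AF k j (h j))" for j
    proof -
      have "hotel_rel good j (h j)" using hotel by blast
      then have "free_pass j (h j) \<or> (\<exists>c l. j = pair c l \<and> good c l \<and> h j = pair c \<zero>)"
        unfolding hotel_rel_def free_pass_def by (elim disjE exE conjE) auto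
      then consider "free_pass j (h j)" | c l where "j = pair c l" "good c l" "h j = pair c \<zero>"
        by blast
      then show ?thesis
      proof cases
        case 1
        then show ?thesis by (simp add: AT_def AF_def clause_pass_def)
      next
        case (2 c l)
        then obtain v s where vs: "l = pair v s" "s = \<zero> \<and> v \<in> W \<or> s = \<one> \<and> v \<notin> W"
          unfolding good_def lit_def by blast
        then have "j \<in> U \<longleftrightarrow> s = \<zero>" using 2 by (auto simp: U_def)
        then show ?thesis
          using 2 vs unfolding AT_def AF_def clause_pass_def good_def by auto
      qed
    qed
    then have "is_hamilton_path (?graph k)
        {pair (num 12 \<otimes> j \<oplus> num r) (tour \<pi> \<rho> h (j \<in> U) j ! r) | j r. r < 12}"
      by (intro hamilton_path_of_tours[of \<rho> \<pi> g h U, OF \<rho> g U_inv]) auto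
    moreover have "{pair (num 12 \<otimes> j \<oplus> num r) (tour \<pi> \<rho> h (j \<in> U) j ! r) | j r. r < 12} \<in> sets M"
      by (rule tours_sets[OF U def_\<pi> def_h \<rho>])
    ultimately show ?thesis by blast
  qed
  then obtain P where P: "P \<in> sets M" "\<And>k. is_hamilton_path (?graph k) (slice P k)"
    using hamilton_choice[OF G(1)] is_graph_graph_of G(2) by auto
  \<comment> \<open>The path functions are chosen outside the model; \<open>mem_P\<close> translates
    statements about them into statements about the set \<open>P\<close>.\<close>
  define runs where "runs k p \<longleftrightarrow> (\<forall>n v. pair n v \<in> slice P k \<longleftrightarrow> v = p n) \<and> inj p \<and>
      range p = {v. pair v \<zero> \<in> ?graph k} \<and> (\<forall>n. pair (pair (p n) (p (n \<oplus> \<one>))) \<one> \<in> ?graph k)"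
    for k p
  have "\<exists>p. runs k p" for k
    by (rule hamilton_path_function[OF P(2)[of k]]) (auto simp: runs_def)
  then have "\<exists>p. \<forall>k. runs k (p k)" by (intro choice allI)
  then obtain p where runs: "\<And>k. runs k (p k)" by blast
  have mem_P: "pair (pair n v) k \<in> P \<longleftrightarrow> v = p k n" for k n v
    using runs[of k] by (simp add: runs_def)
  have p: "inj (p k)" "range (p k) = {v. pair v \<zero> \<in> ?graph k}"
      "pair (pair (p k n) (p k (n \<oplus> \<one>))) \<one> \<in> ?graph k" for k n
    using runs[of k] by (simp_all add: runs_def)
  note sound = graph_of_sound[OF \<pi> p]
  let ?U = "{z. \<exists>j k. z = pair j k \<and> used (p k) (vx 1 j) (vx 6 j)}"
  have "{z. \<exists>n. \<exists>j k. z = pair j k \<and> (pair (pair n (vx 1 j)) k \<in> P \<and> pair (pair (n \<oplus> \<one>) (vx 6 j)) k \<in> P \<or>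
        pair (pair n (vx 6 j)) k \<in> P \<and> pair (pair (n \<oplus> \<one>) (vx 1 j)) k \<in> P)} \<in> sets M"
  proof (rule delta1_comprehension[where Q' = "\<lambda>z n. \<exists>j k. z = pair j k \<and>
        (pair (pair n (vx 1 j)) k \<in> P \<longrightarrow> pair (pair (n \<oplus> \<one>) (vx 6 j)) k \<in> P \<or>
          (\<exists>m. m \<prec> n \<and> n = m \<oplus> \<one> \<and> pair (pair m (vx 6 j)) k \<in> P))"])
    fix z
    show "(\<exists>n. \<exists>j k. z = pair j k \<and> (pair (pair n (vx 1 j)) k \<in> P \<and> pair (pair (n \<oplus> \<one>) (vx 6 j)) k \<in> P \<or>
        pair (pair n (vx 6 j)) k \<in> P \<and> pair (pair (n \<oplus> \<one>) (vx 1 j)) k \<in> P)) \<longleftrightarrow>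
      (\<forall>n. \<exists>j k. z = pair j k \<and>
        (pair (pair n (vx 1 j)) k \<in> P \<longrightarrow> pair (pair (n \<oplus> \<one>) (vx 6 j)) k \<in> P \<or>
          (\<exists>m. m \<prec> n \<and> n = m \<oplus> \<one> \<and> pair (pair m (vx 6 j)) k \<in> P)))"
    proof (cases "\<exists>j k. z = pair j k")
      case True
      then obtain j k where z: "z = pair j k" by blast
      have "vx 1 j \<in> range (p k)" unfolding p(2) by (auto simp: graph_of_vertices)
      note all = used_iff_all[OF p(1) this, of "vx 6 j"]
      show ?thesis
        unfolding z pair_inj simp_thms mem_P
        using all unfolding used_def by (simp add: eq_commute del: One_nat_def)
    qed auto
  qed (rule definable_intros P)+
  also have "{z. \<exists>n. \<exists>j k. z = pair j k \<and> (pair (pair n (vx 1 j)) k \<in> P \<and> pair (pair (n \<oplus> \<one>) (vx 6 j)) k \<in> P \<or>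
      pair (pair n (vx 6 j)) k \<in> P \<and> pair (pair (n \<oplus> \<one>) (vx 1 j)) k \<in> P)} = ?U"
    unfolding mem_P used_def by (auto; metis)
  finally have U: "?U \<in> sets M" .
  \<comment> \<open>The value of \<open>v\<close> is read at the last positive copy in the order of
    the shift: truth at any positive copy leads to it, and from it to all negative copies.\<close>
  let ?Y = "{z. \<exists>v k. z = pair v k \<and> pair (pair \<zero> (pair v \<zero>)) k \<in> ?U}"
  have "?Y \<in> sets M" by (rule comprehension) (rule definable_intros U)+
  moreover have "solves C k (slice ?Y k)" for k
  proof -
    let ?Uk = "slice ?U k"
    have Uk: "?Uk \<in> sets M" by (rule slice_sets[OF U])
    have step: "i \<in> ?Uk" if "shift_rel j i" "j \<in> ?Uk" for i j
      using sound(1)[of k j] shift[of i j] that by simp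
    have pos: "pair c (pair v \<zero>) \<in> ?Uk \<longrightarrow> pair \<zero> (pair v \<zero>) \<in> ?Uk" for c v
    proof (rule induct[of "\<lambda>c. pair c (pair v \<zero>) \<in> ?Uk \<longrightarrow> pair \<zero> (pair v \<zero>) \<in> ?Uk"])
      fix c assume "pair c (pair v \<zero>) \<in> ?Uk \<longrightarrow> pair \<zero> (pair v \<zero>) \<in> ?Uk"
      then show "pair (c \<oplus> \<one>) (pair v \<zero>) \<in> ?Uk \<longrightarrow> pair \<zero> (pair v \<zero>) \<in> ?Uk"
        using step shift_rel_simps(2) by blast
    qed (rule definable_intros Uk | blast)+
    have neg: "pair \<zero> (pair v \<zero>) \<in> ?Uk \<longrightarrow> pair c (pair v \<one>) \<in> ?Uk" for c v
    proof (rule induct[of "\<lambda>c. pair \<zero> (pair v \<zero>) \<in> ?Uk \<longrightarrow> pair c (pair v \<one>) \<in> ?Uk"])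
      show "pair \<zero> (pair v \<zero>) \<in> ?Uk \<longrightarrow> pair \<zero> (pair v \<one>) \<in> ?Uk"
        using step shift_rel_simps(1) by blast
    next
      fix c assume "pair \<zero> (pair v \<zero>) \<in> ?Uk \<longrightarrow> pair c (pair v \<one>) \<in> ?Uk"
      then show "pair \<zero> (pair v \<zero>) \<in> ?Uk \<longrightarrow> pair (c \<oplus> \<one>) (pair v \<one>) \<in> ?Uk"
        using step shift_rel_simps(3) by blast
    qed (rule definable_intros Uk)+
    have Y: "v \<in> slice ?Y k \<longleftrightarrow> pair \<zero> (pair v \<zero>) \<in> ?Uk" for v by simp
    show ?thesis
      unfolding solves_def
    proof
      fix c
      obtain j where j: "j \<in> ?Uk \<and> AT k j (pair c \<zero>) \<or> j \<notin> ?Uk \<and> AF k j (pair c \<zero>)"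
        using sound(2)[of k "pair c \<zero>"] by auto
      \<comment> \<open>The reserved segment admits no free pass, so the block that enters it yields
        a literal of clause \<open>c\<close>.\<close>
      have "\<not> free_pass j (pair c \<zero>)" by (auto simp: free_pass_def)
      with j consider v where "pair c (pair v \<zero>) \<in> ?Uk" "pair (pair c (pair v \<zero>)) k \<in> C"
        | v where "pair c (pair v \<one>) \<notin> ?Uk" "pair (pair c (pair v \<one>)) k \<in> C"
        unfolding AT_def AF_def clause_pass_def by auto
      then show "\<exists>l. pair (pair c l) k \<in> C \<and> lit (slice ?Y k) l"
      proof cases
        case (1 v)
        then have "lit (slice ?Y k) (pair v \<zero>)" unfolding lit_pair Y using pos[of c v] by simp
        then show ?thesis using 1 by blast
      next
        case (2 v)
        then have "lit (slice ?Y k) (pair v \<one>)" unfolding lit_pair Y using neg[of v c] by blast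
        then show ?thesis using 2 by blast
      qed
    qed
  qed
  ultimately show ?thesis by blast
qed

text \<open>The first clause makes variable \<open>\<zero>\<close> imply the existence of an \<open>n\<close>; the others give the converse.\<close>

theorem projection:
  assumes A: "A \<in> sets M"
  shows "{k. \<exists>n. pair n k \<in> A} \<in> sets M"
proof -
  \<comment> \<open>Variable \<open>n \<oplus> \<one>\<close> marks \<open>n\<close> as a witness.
    If \<open>pair n k \<notin> A\<close>, the clause \<open>n \<oplus> \<one>\<close> contains both
    literals of variable \<open>\<zero>\<close> and holds trivially.\<close>
  define C where "C = {z. \<exists>y k. z = pair y k \<and> (\<exists>c l. y = pair c l \<and> (\<exists>v s. l = pair v s \<and>
      (c = \<zero> \<and> v = \<zero> \<and> s = \<one> \<or>
       c = \<zero> \<and> s = \<zero> \<and> (\<exists>n. n \<prec> v \<and> v = n \<oplus> \<one> \<and> pair n k \<in> A) \<or>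
       (\<exists>n. n \<prec> c \<and> c = n \<oplus> \<one> \<and> v = \<zero> \<and> (s = \<zero> \<or> s = \<one> \<and> pair n k \<notin> A)))))}"
  have C: "C \<in> sets M" unfolding C_def by (rule comprehension) (rule definable_intros A)+
  have first: "(\<exists>l. pair (pair \<zero> l) k \<in> C \<and> lit W l) \<longleftrightarrow>
      (\<zero> \<in> W \<longrightarrow> (\<exists>n. n \<oplus> \<one> \<in> W \<and> pair n k \<in> A))" for k W
    unfolding ex_lit by (auto simp: C_def, blast)
  have later: "(\<exists>l. pair (pair (n \<oplus> \<one>) l) k \<in> C \<and> lit W l) \<longleftrightarrow> (pair n k \<in> A \<longrightarrow> \<zero> \<in> W)" for k n W
    unfolding ex_lit by (auto simp: C_def)
  have all: "(\<forall>c. Q c) \<longleftrightarrow> Q \<zero> \<and> (\<forall>n. Q (n \<oplus> \<one>))" for Q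
    by (metis zero_or_suc)
  have solves: "solves C k W \<longleftrightarrow> (\<zero> \<in> W \<longrightarrow> (\<exists>n. n \<oplus> \<one> \<in> W \<and> pair n k \<in> A)) \<and>
      (\<forall>n. pair n k \<in> A \<longrightarrow> \<zero> \<in> W)" for k W
    unfolding solves_def by (subst all) (simp only: first later)
  \<comment> \<open>For a single \<open>k\<close> the value of variable \<open>\<zero>\<close> is
    settled by a case distinction, so recursive comprehension suffices for a solution. Uniformity in
    \<open>k\<close> comes from \<open>clause_choice\<close>.\<close>
  have "\<exists>W\<in>sets M. solves C k W" for k
  proof (cases "\<exists>n. pair n k \<in> A")
    case True
    have "{x. x = x} \<in> sets M" by (rule comprehension) (rule definable_intros)+
    then show ?thesis using True by (intro bexI[of _ "{x. x = x}"]) (simp_all add: solves)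
  next
    case False
    have "{x. x \<noteq> \<zero>} \<in> sets M" by (rule comprehension) (rule definable_intros)+
    then show ?thesis using False by (intro bexI[of _ "{x. x \<noteq> \<zero>}"]) (simp_all add: solves)
  qed
  then obtain Y where Y: "Y \<in> sets M" "\<And>k. solves C k (slice Y k)"
    using clause_choice[OF C] by blast
  have "{k. pair \<zero> k \<in> Y} \<in> sets M" by (rule comprehension) (rule definable_intros Y)+
  moreover have "pair \<zero> k \<in> Y \<longleftrightarrow> (\<exists>n. pair n k \<in> A)" for k
    using Y(2)[of k] unfolding solves mem_slice by blast
  ultimately show ?thesis by simp
qed

end

section \<open>Arithmetical truth\<close>

text \<open>Of the logical symbols in an arithmetical formula only negation, conjunction and
  \<open>ExN\<close> remain, which cuts the cases of the truth definition.\<close>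

primrec nf :: "fm \<Rightarrow> fm" where
  "nf (s \<^bold>= t) = (s \<^bold>= t)"
| "nf (s \<^bold>< t) = (s \<^bold>< t)"
| "nf (t \<^bold>\<in> X) = (t \<^bold>\<in> X)"
| "nf (\<^bold>\<not> \<phi>) = (\<^bold>\<not> nf \<phi>)"
| "nf (\<phi> \<^bold>\<and> \<psi>) = (nf \<phi> \<^bold>\<and> nf \<psi>)"
| "nf (\<phi> \<^bold>\<or> \<psi>) = (\<^bold>\<not> (\<^bold>\<not> nf \<phi> \<^bold>\<and> \<^bold>\<not> nf \<psi>))"
| "nf (\<phi> \<^bold>\<longrightarrow> \<psi>) = (\<^bold>\<not> (nf \<phi> \<^bold>\<and> \<^bold>\<not> nf \<psi>))"
| "nf (\<phi> \<^bold>\<longleftrightarrow> \<psi>) = (\<^bold>\<not> (nf \<phi> \<^bold>\<and> \<^bold>\<not> nf \<psi>) \<^bold>\<and> \<^bold>\<not> (nf \<psi> \<^bold>\<and> \<^bold>\<not> nf \<phi>))"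
| "nf (AllN x \<phi>) = (\<^bold>\<not> ExN x (\<^bold>\<not> nf \<phi>))"
| "nf (ExN x \<phi>) = ExN x (nf \<phi>)"
| "nf (AllS X \<phi>) = AllS X \<phi>"
| "nf (ExS X \<phi>) = ExS X \<phi>"

primrec core :: "fm \<Rightarrow> bool" where
  "core (s \<^bold>= t) \<longleftrightarrow> True"
| "core (s \<^bold>< t) \<longleftrightarrow> True"
| "core (t \<^bold>\<in> X) \<longleftrightarrow> True"
| "core (\<^bold>\<not> \<phi>) \<longleftrightarrow> core \<phi>"
| "core (\<phi> \<^bold>\<and> \<psi>) \<longleftrightarrow> core \<phi> \<and> core \<psi>"
| "core (\<phi> \<^bold>\<or> \<psi>) \<longleftrightarrow> False"
| "core (\<phi> \<^bold>\<longrightarrow> \<psi>) \<longleftrightarrow> False"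
| "core (\<phi> \<^bold>\<longleftrightarrow> \<psi>) \<longleftrightarrow> False"
| "core (AllN x \<phi>) \<longleftrightarrow> False"
| "core (ExN x \<phi>) \<longleftrightarrow> core \<phi>"
| "core (AllS X \<phi>) \<longleftrightarrow> False"
| "core (ExS X \<phi>) \<longleftrightarrow> False"

lemma core_nf: "arithmetical \<phi> \<Longrightarrow> core (nf \<phi>)"
  by (induction \<phi>) auto

lemma sat_nf: "sat M e E (nf \<phi>) \<longleftrightarrow> sat M e E \<phi>"
  by (induction \<phi> arbitrary: e E) auto

primrec subs :: "fm \<Rightarrow> fm set" where
  "subs (s \<^bold>= t) = {s \<^bold>= t}"
| "subs (s \<^bold>< t) = {s \<^bold>< t}"
| "subs (t \<^bold>\<in> X) = {t \<^bold>\<in> X}"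
| "subs (\<^bold>\<not> \<phi>) = insert (\<^bold>\<not> \<phi>) (subs \<phi>)"
| "subs (\<phi> \<^bold>\<and> \<psi>) = insert (\<phi> \<^bold>\<and> \<psi>) (subs \<phi> \<union> subs \<psi>)"
| "subs (\<phi> \<^bold>\<or> \<psi>) = {\<phi> \<^bold>\<or> \<psi>}"
| "subs (\<phi> \<^bold>\<longrightarrow> \<psi>) = {\<phi> \<^bold>\<longrightarrow> \<psi>}"
| "subs (\<phi> \<^bold>\<longleftrightarrow> \<psi>) = {\<phi> \<^bold>\<longleftrightarrow> \<psi>}"
| "subs (AllN x \<phi>) = {AllN x \<phi>}"
| "subs (ExN x \<phi>) = insert (ExN x \<phi>) (subs \<phi>)"
| "subs (AllS X \<phi>) = {AllS X \<phi>}"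
| "subs (ExS X \<phi>) = {ExS X \<phi>}"

text \<open>Bound variables count as well, since they are free in subformulas; all assignments can
  then be cut off at one \<open>N\<close>.\<close>

primrec nvars :: "fm \<Rightarrow> nat set" where
  "nvars (s \<^bold>= t) = tvars s \<union> tvars t"
| "nvars (s \<^bold>< t) = tvars s \<union> tvars t"
| "nvars (t \<^bold>\<in> X) = tvars t"
| "nvars (\<^bold>\<not> \<phi>) = nvars \<phi>"
| "nvars (\<phi> \<^bold>\<and> \<psi>) = nvars \<phi> \<union> nvars \<psi>"
| "nvars (\<phi> \<^bold>\<or> \<psi>) = nvars \<phi> \<union> nvars \<psi>"
| "nvars (\<phi> \<^bold>\<longrightarrow> \<psi>) = nvars \<phi> \<union> nvars \<psi>"
| "nvars (\<phi> \<^bold>\<longleftrightarrow> \<psi>) = nvars \<phi> \<union> nvars \<psi>"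
| "nvars (AllN x \<phi>) = insert x (nvars \<phi>)"
| "nvars (ExN x \<phi>) = insert x (nvars \<phi>)"
| "nvars (AllS X \<phi>) = nvars \<phi>"
| "nvars (ExS X \<phi>) = nvars \<phi>"

lemma finite_subs: "finite (subs \<phi>)"
  by (induction \<phi>) auto

lemma subs_self: "\<phi> \<in> subs \<phi>"
  by (cases \<phi>) auto

lemma subs_core: "core \<theta> \<Longrightarrow> \<phi> \<in> subs \<theta> \<Longrightarrow> core \<phi>"
  by (induction \<theta>) auto

lemma subs_closed:
  "(\<^bold>\<not> \<phi>) \<in> subs \<theta> \<Longrightarrow> \<phi> \<in> subs \<theta>"
  "(\<phi> \<^bold>\<and> \<psi>) \<in> subs \<theta> \<Longrightarrow> \<phi> \<in> subs \<theta> \<and> \<psi> \<in> subs \<theta>"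
  "ExN x \<phi> \<in> subs \<theta> \<Longrightarrow> \<phi> \<in> subs \<theta>"
  by (induction \<theta>) (auto simp: subs_self)

lemma subs_nvars: "\<phi> \<in> subs \<theta> \<Longrightarrow> nvars \<phi> \<subseteq> nvars \<theta>"
  by (induction \<theta>) auto

lemma fvN_subset_nvars: "fvN \<phi> \<subseteq> nvars \<phi>"
  by (induction \<phi>) auto

lemma nvars_bounded: "\<exists>N. nvars \<phi> \<subseteq> {..<N}"
proof -
  have "finite (nvars \<phi>)" by (induction \<phi>) (auto simp: finite_tvars)
  then show ?thesis unfolding finite_nat_set_iff_bounded by blast
qed

section \<open>Codes of assignments\<close>

context rca
begin

text \<open>A number \<open>b = pair c a\<close> codes the assignment with value \<open>a\<close> at 0, followed by that coded by \<open>c\<close>.\<close>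

definition left :: "'a \<Rightarrow> 'a" where
  "left b = (if \<exists>x y. b = pair x y then THE x. \<exists>y. b = pair x y else \<zero>)"

definition right :: "'a \<Rightarrow> 'a" where
  "right b = (if \<exists>x y. b = pair x y then THE y. \<exists>x. b = pair x y else \<zero>)"

primrec dec :: "'a \<Rightarrow> nat \<Rightarrow> 'a" where
  "dec b 0 = right b"
| "dec b (Suc i) = dec (left b) i"

lemma left_pair [simp]: "left (pair a b) = a" and right_pair [simp]: "right (pair a b) = b"
  by (simp_all add: left_def right_def)

lemma left_iff: "a = left b \<longleftrightarrow> (\<exists>x y. b = pair x y \<and> a = x) \<or> a = \<zero> \<and> \<not> (\<exists>x y. b = pair x y)"
  by (cases "\<exists>x y. b = pair x y") (auto simp: left_def)

lemma right_iff: "a = right b \<longleftrightarrow> (\<exists>x y. b = pair x y \<and> a = y) \<or> a = \<zero> \<and> \<not> (\<exists>x y. b = pair x y)"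
  by (cases "\<exists>x y. b = pair x y") (auto simp: right_def)

lemma left_le: "left b \<prec> b \<oplus> \<one>" and right_le: "right b \<prec> b \<oplus> \<one>"
  using left_iff[of "left b" b] right_iff[of "right b" b] fst_le_pair snd_le_pair zero_less_suc by metis+

lemma le_trans: "a \<prec> b \<oplus> \<one> \<Longrightarrow> b \<prec> c \<oplus> \<one> \<Longrightarrow> a \<prec> c \<oplus> \<one>"
  using less_suc less_trans by metis

lemma dec_le: "dec b i \<prec> b \<oplus> \<one>"
  by (induction i arbitrary: b) (auto intro: right_le le_trans left_le)

lemma definable_dec:
  assumes "definable_term M s" "definable_term M t"
  shows "definable M (\<lambda>e. s e = dec (t e) i)"
proof -
  have left: "definable M (\<lambda>e. e 0 = left (e 1))"
    unfolding left_iff by (rule definable_intros)+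
  note left = definable_rel2[of "\<lambda>b a. a = left b", OF left]
  have "definable M (\<lambda>e. e 0 = dec (e 1) i)"
  proof (induction i)
    case 0
    show ?case unfolding dec.simps right_iff by (rule definable_intros)+
  next
    case (Suc i)
    note IH = definable_rel2[of "\<lambda>b a. a = dec b i", OF Suc]
    have "definable M (\<lambda>e. \<exists>x. x \<prec> e 1 \<oplus> \<one> \<and> x = left (e 1) \<and> e 0 = dec x i)"
      by (rule left IH definable_intros)+
    moreover have "(\<exists>x. x \<prec> b \<oplus> \<one> \<and> x = left b \<and> a = dec x i) \<longleftrightarrow> a = dec b (Suc i)" for a b
      using left_le by auto
    ultimately show ?case by simp
  qed
  from definable_rel2[of "\<lambda>b a. a = dec b i", OF this assms(2,1)] show ?thesis .
qed

lemma dec_update: "\<exists>b'. dec b' = (dec b)(i := a)"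
proof (induction i arbitrary: b)
  case 0
  have "dec (pair (left b) a) j = ((dec b)(0 := a)) j" for j by (cases j) auto
  then show ?case by blast
next
  case (Suc i)
  obtain b' where b': "dec b' = (dec (left b))(i := a)" using Suc by blast
  have "dec (pair b' (right b)) j = ((dec b)(Suc i := a)) j" for j by (cases j) (auto simp: b')
  then show ?case by blast
qed

lemma dec_exists: "\<exists>b. \<forall>i<N. dec b i = e i"
proof (induction N)
  case (Suc N)
  then obtain b where b: "\<forall>i<N. dec b i = e i" by blast
  obtain b' where "dec b' = (dec b)(N := e N)" using dec_update by blast
  then show ?case using b by (intro exI[of _ b']) (auto simp: less_Suc_eq)
qed simp

text \<open>Bounding \<open>a\<close> by \<open>b\<close> and using a finite existential under
  negation fits the closure rules; \<open>agree_except_iff\<close> gives the plain meaning.\<close>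

definition agree_except :: "nat \<Rightarrow> nat \<Rightarrow> 'a \<Rightarrow> 'a \<Rightarrow> bool" where
  "agree_except N x b b' \<longleftrightarrow> \<not> (\<exists>i\<in>{..<N} - {x}. \<not> (\<exists>a. a \<prec> b \<oplus> \<one> \<and> a = dec b i \<and> a = dec b' i))"

lemma agree_except_iff: "agree_except N x b b' \<longleftrightarrow> (\<forall>i<N. i \<noteq> x \<longrightarrow> dec b' i = dec b i)"
  using dec_le unfolding agree_except_def by auto

lemma definable_agree_except:
  assumes "definable_term M s" "definable_term M t"
  shows "definable M (\<lambda>e. agree_except N x (s e) (t e))"
proof -
  have "definable M (\<lambda>e. agree_except N x (e 1) (e 0))"
    unfolding agree_except_def
    by (rule definable_intros definable_dec finite_Diff finite_lessThan)+
  from definable_rel2[of "agree_except N x", OF this assms] show ?thesis .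
qed

lemma sat_dec_cong:
  assumes "nvars \<phi> \<subseteq> {..<N}" "\<And>i. i < N \<Longrightarrow> dec b i = e i"
  shows "sat M (dec b) E \<phi> \<longleftrightarrow> sat M e E \<phi>"
  using assms fvN_subset_nvars[of \<phi>] by (intro sat_cong) auto

text \<open>A quantifier over values becomes one over codes, so that codes are the arguments of all
  truth sets. Agreement below \<open>N\<close> suffices because all variables of the formula lie
  there.\<close>

lemma sat_ExN_dec:
  assumes "nvars (ExN x \<phi>) \<subseteq> {..<N}"
  shows "sat M (dec b) E (ExN x \<phi>) \<longleftrightarrow> (\<exists>b'. agree_except N x b b' \<and> sat M (dec b') E \<phi>)"
proof
  assume "sat M (dec b) E (ExN x \<phi>)"
  then obtain a where "sat M ((dec b)(x := a)) E \<phi>" by auto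
  moreover obtain b' where "dec b' = (dec b)(x := a)" using dec_update by blast
  ultimately show "\<exists>b'. agree_except N x b b' \<and> sat M (dec b') E \<phi>"
    by (intro exI[of _ b']) (auto simp: agree_except_iff)
next
  assume "\<exists>b'. agree_except N x b b' \<and> sat M (dec b') E \<phi>"
  then obtain b' where b': "agree_except N x b b'" "sat M (dec b') E \<phi>" by blast
  have "sat M (dec b') E \<phi> \<longleftrightarrow> sat M ((dec b)(x := dec b' x)) E \<phi>"
    by (rule sat_dec_cong[of _ N]) (use assms b' in \<open>auto simp: agree_except_iff\<close>)
  then show "sat M (dec b) E (ExN x \<phi>)" using b' by auto
qed

end

section \<open>Truth sets of arithmetical formulas\<close>

context hamilton_choice
begin

lemma definable_ex2:
  assumes "definable M (\<lambda>e. R (e 1) (e 0))" "definable_term M t"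
  shows "definable M (\<lambda>e. \<exists>a. R (t e) a)"
proof -
  let ?A = "{z. \<exists>a b. z = pair a b \<and> R b a}"
  have "?A \<in> sets M"
    by (rule comprehension) (rule definable_intros definable_rel2[of R, OF assms(1)])+
  then have "definable M (\<lambda>e. t e \<in> {k. \<exists>n. pair n k \<in> ?A})"
    by (intro definable_mem projection assms)
  then show ?thesis by simp
qed

lemma definable_ex3:
  assumes "definable M (\<lambda>e. R (e 2) (e 1) (e 0))" "definable_term M s" "definable_term M t"
  shows "definable M (\<lambda>e. \<exists>a. R (s e) (t e) a)"
proof -
  have "definable M (\<lambda>e. \<exists>x y. e 1 = pair x y \<and> R x y (e 0))"
    by (rule definable_intros definable_rel3[of R, OF assms(1)])+
  from definable_ex2[of "\<lambda>z a. \<exists>x y. z = pair x y \<and> R x y a", OF this definable_term_code[OF assms(2,3)]]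
  have "definable M (\<lambda>e. \<exists>a x y. pair (s e) (t e) = pair x y \<and> R x y a)" .
  then show ?thesis by simp
qed

text \<open>The values of subterms come with no explicit bound, but unbounded quantifiers over them
  are admissible by now.\<close>

lemma definable_eval:
  assumes "definable_term M s" "definable_term M t"
  shows "definable M (\<lambda>e. s e = eval M (dec (t e)) u)"
proof -
  have "definable M (\<lambda>e. e 0 = eval M (dec (e 1)) u)"
  proof (induction u)
    case (Var i)
    show ?case unfolding eval.simps by (rule definable_intros definable_dec)+
  next
    case (Add u v)
    note IH = Add[THEN definable_rel2[of "\<lambda>b a. a = eval M (dec b) w" for w]]
    let ?R = "\<lambda>b a w. \<exists>x y. w = pair x y \<and> x = eval M (dec b) u \<and> y = eval M (dec b) v \<and> a = x \<oplus> y"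
    have "definable M (\<lambda>e. ?R (e 2) (e 1) (e 0))"
      by (rule IH definable_intros)+
    from definable_ex3[of ?R, OF this definable_term_var definable_term_var]
    have "definable M (\<lambda>e. \<exists>w. ?R (e 1) (e 0) w)" .
    then show ?case by simp
  next
    case (Mul u v)
    note IH = Mul[THEN definable_rel2[of "\<lambda>b a. a = eval M (dec b) w" for w]]
    let ?R = "\<lambda>b a w. \<exists>x y. w = pair x y \<and> x = eval M (dec b) u \<and> y = eval M (dec b) v \<and> a = x \<otimes> y"
    have "definable M (\<lambda>e. ?R (e 2) (e 1) (e 0))"
      by (rule IH definable_intros)+
    from definable_ex3[of ?R, OF this definable_term_var definable_term_var]
    have "definable M (\<lambda>e. \<exists>w. ?R (e 1) (e 0) w)" .
    then show ?case by simp
  qed (simp_all, (rule definable_intros)+)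
  from definable_rel2[of "\<lambda>b a. a = eval M (dec b) u", OF this assms(2,1)] show ?thesis .
qed

lemma definable_eval2:
  assumes "definable M (\<lambda>e. Q (e 1) (e 0))"
  shows "definable M (\<lambda>e. Q (eval M (dec (e 0)) u) (eval M (dec (e 0)) v))"
proof -
  let ?R = "\<lambda>b w. \<exists>x y. w = pair x y \<and> x = eval M (dec b) u \<and> y = eval M (dec b) v \<and> Q x y"
  have "definable M (\<lambda>e. ?R (e 1) (e 0))"
    by (rule definable_rel2[of Q, OF assms] definable_eval definable_intros)+
  from definable_ex2[of ?R, OF this definable_term_var] have "definable M (\<lambda>e. \<exists>w. ?R (e 0) w)" .
  then show ?thesis by simp
qed

text \<open>The induction on \<open>\<phi>\<close> takes place outside the model, with
  \<open>N\<close> fixed: every standard formula gets a truth set of its own.\<close>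

lemma truth_set:
  assumes E: "range E \<subseteq> sets M" and "core \<phi>" "nvars \<phi> \<subseteq> {..<N}"
  shows "{b. sat M (dec b) E \<phi>} \<in> sets M"
proof (rule comprehension)
  show "definable M (\<lambda>e. sat M (dec (e 0)) E \<phi>)"
    using assms(2,3)
  proof (induction \<phi>)
    case (Eq s t)
    have "definable M (\<lambda>e. e 1 = e 0)" by (rule definable_intros)+
    from definable_eval2[of "\<lambda>x y. x = y", OF this] show ?case by simp
  next
    case (Less s t)
    have "definable M (\<lambda>e. e 1 \<prec> e 0)" by (rule definable_intros)+
    from definable_eval2[of "\<lambda>x y. x \<prec> y", OF this] show ?case by simp
  next
    case (Mem t X)
    have EX: "E X \<in> sets M" using E by auto
    have "definable M (\<lambda>e. e 1 \<in> E X)" by (rule definable_intros EX)+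
    from definable_eval2[of "\<lambda>x y. x \<in> E X", OF this, of t] show ?case by simp
  next
    case (Neg \<phi>)
    then have "definable M (\<lambda>e. sat M (dec (e 0)) E \<phi>)" by simp
    then show ?case unfolding sat.simps by (rule definable_not)
  next
    case (And \<phi> \<psi>)
    then have "definable M (\<lambda>e. sat M (dec (e 0)) E \<phi>)" "definable M (\<lambda>e. sat M (dec (e 0)) E \<psi>)"
      by simp_all
    then show ?case unfolding sat.simps by (rule definable_conj)
  next
    case (ExN x \<phi>)
    then have IH: "definable M (\<lambda>e. sat M (dec (e 0)) E \<phi>)" by simp
    have "definable M (\<lambda>e. agree_except N x (e 1) (e 0) \<and> sat M (dec (e 0)) E \<phi>)"
      by (rule definable_conj definable_agree_except definable_intros IH)+
    from definable_ex2[of "\<lambda>b b'. agree_except N x b b' \<and> sat M (dec b') E \<phi>", OF this definable_term_var]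
    have "definable M (\<lambda>e. \<exists>b'. agree_except N x (e 0) b' \<and> sat M (dec b') E \<phi>)" .
    then show ?case using sat_ExN_dec[OF ExN.prems(2)] by simp
  qed simp_all
qed

end

section \<open>Clause systems for arithmetical truth\<close>

context rca
begin

definition ternary :: "('a \<Rightarrow> 'a \<Rightarrow> 'a \<Rightarrow> bool) \<Rightarrow> bool" where
  "ternary P \<longleftrightarrow> definable M (\<lambda>e. P (e 2) (e 1) (e 0))"

lemma ternaryI: "definable M (\<lambda>e. P (e 2) (e 1) (e 0)) \<Longrightarrow> ternary P"
  by (simp add: ternary_def)

lemma ternary_disj: "ternary P \<Longrightarrow> ternary N \<Longrightarrow> ternary (\<lambda>k c v. P k c v \<or> N k c v)"
  unfolding ternary_def by (rule definable_disj)

text \<open>\<open>P\<close> and \<open>N\<close> list the variables occurring positively and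
  negatively in clause \<open>c\<close> of system \<open>k\<close>.\<close>

definition clausal :: "('a \<Rightarrow> 'a \<Rightarrow> 'a set \<Rightarrow> bool) \<Rightarrow> bool" where
  "clausal Q \<longleftrightarrow> (\<exists>P N. ternary P \<and> ternary N \<and>
     Q = (\<lambda>k c W. (\<exists>v. P k c v \<and> v \<in> W) \<or> (\<exists>v. N k c v \<and> v \<notin> W)))"

definition axiomatizable :: "('a \<Rightarrow> 'a set \<Rightarrow> bool) \<Rightarrow> bool" where
  "axiomatizable K \<longleftrightarrow> (\<exists>C\<in>sets M. \<forall>k W. solves C k W \<longleftrightarrow> K k W)"

lemma clausalI:
  assumes "ternary P" "ternary N"
    "\<And>k c W. Q k c W \<longleftrightarrow> (\<exists>v. P k c v \<and> v \<in> W) \<or> (\<exists>v. N k c v \<and> v \<notin> W)"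
  shows "clausal Q"
proof -
  have "Q = (\<lambda>k c W. (\<exists>v. P k c v \<and> v \<in> W) \<or> (\<exists>v. N k c v \<and> v \<notin> W))"
    by (intro ext assms(3))
  then show ?thesis unfolding clausal_def using assms(1,2) by blast
qed

lemma ternary_False: "ternary (\<lambda>_ _ _. False)"
  by (rule ternaryI) (rule definable_const)

lemma clausal_pos:
  assumes "definable M (\<lambda>e. P (e 2) (e 1) (e 0))"
  shows "clausal (\<lambda>k c W. \<exists>v. P k c v \<and> v \<in> W)"
  by (rule clausalI[OF ternaryI[of P, OF assms] ternary_False]) simp

lemma clausal_neg:
  assumes "definable M (\<lambda>e. P (e 2) (e 1) (e 0))"
  shows "clausal (\<lambda>k c W. \<exists>v. P k c v \<and> v \<notin> W)"
  by (rule clausalI[OF ternary_False ternaryI[of P, OF assms]]) simp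

text \<open>A condition not mentioning the solution is expressed by adding all literals where it holds.\<close>

lemma clausal_const:
  assumes "definable M (\<lambda>e. T (e 1) (e 0))"
  shows "clausal (\<lambda>k c W. T k c)"
proof -
  have T: "ternary (\<lambda>k c v. T k c)"
    by (rule ternaryI, rule definable_rel2[of T, OF assms definable_term_var definable_term_var])
  have "(\<exists>v. v \<in> W) \<or> (\<exists>v. v \<notin> W)" for W :: "'a set" by blast
  then have "T k c \<longleftrightarrow> T k c \<and> (\<exists>v. v \<in> W) \<or> T k c \<and> (\<exists>v. v \<notin> W)" for k c W by blast
  then show ?thesis by (intro clausalI[OF T T]) simp
qed

lemma clausal_disj:
  assumes "clausal Q" "clausal R"
  shows "clausal (\<lambda>k c W. Q k c W \<or> R k c W)"
proof -
  obtain P N where Q: "ternary P" "ternary N"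
     "Q = (\<lambda>k c W. (\<exists>v. P k c v \<and> v \<in> W) \<or> (\<exists>v. N k c v \<and> v \<notin> W))"
    using assms(1) unfolding clausal_def by blast
  obtain P' N' where R: "ternary P'" "ternary N'"
     "R = (\<lambda>k c W. (\<exists>v. P' k c v \<and> v \<in> W) \<or> (\<exists>v. N' k c v \<and> v \<notin> W))"
    using assms(2) unfolding clausal_def by blast
  show ?thesis
    by (rule clausalI[OF ternary_disj[OF Q(1) R(1)] ternary_disj[OF Q(2) R(2)]])
      (unfold Q(3) R(3), blast)
qed

lemma axiomatizable_all:
  assumes "clausal Q"
  shows "axiomatizable (\<lambda>k W. \<forall>c. Q k c W)"
proof -
  obtain P N where Q: "ternary P" "ternary N"
     "Q = (\<lambda>k c W. (\<exists>v. P k c v \<and> v \<in> W) \<or> (\<exists>v. N k c v \<and> v \<notin> W))"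
    using assms unfolding clausal_def by blast
  define C where "C = {z. \<exists>y k. z = pair y k \<and> (\<exists>c l. y = pair c l \<and> (\<exists>v s. l = pair v s \<and>
      (s = \<zero> \<and> P k c v \<or> s = \<one> \<and> N k c v)))}"
  have "C \<in> sets M"
    unfolding C_def
    by (rule comprehension)
       (rule definable_rel3[of P, OF Q(1)[unfolded ternary_def]]
          definable_rel3[of N, OF Q(2)[unfolded ternary_def]] definable_intros)+
  moreover have "solves C k W \<longleftrightarrow> (\<forall>c. Q k c W)" for k W
    unfolding solves_def ex_lit Q(3) by (simp add: C_def)
  ultimately show ?thesis unfolding axiomatizable_def by blast
qed

lemma axiomatizable_conj:
  assumes "axiomatizable K" "axiomatizable L"
  shows "axiomatizable (\<lambda>k W. K k W \<and> L k W)"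
proof -
  obtain C where C: "C \<in> sets M" "\<And>k W. solves C k W \<longleftrightarrow> K k W"
    using assms(1) unfolding axiomatizable_def by blast
  obtain D where D: "D \<in> sets M" "\<And>k W. solves D k W \<longleftrightarrow> L k W"
    using assms(2) unfolding axiomatizable_def by blast
  \<comment> \<open>Clause \<open>pair c s\<close> is clause \<open>c\<close> of the first system
    for \<open>s = \<zero>\<close> and of the second otherwise. Numbers that are not pairs receive
    all literals and so hold in every \<open>W\<close>.\<close>
  define B where "B = {z. \<exists>y k. z = pair y k \<and> (\<exists>d l. y = pair d l \<and>
      ((\<exists>c s. d = pair c s \<and> (s = \<zero> \<and> pair (pair c l) k \<in> C \<or> s \<noteq> \<zero> \<and> pair (pair c l) k \<in> D)) \<or>
       \<not> (\<exists>c s. d = pair c s)))}"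
  have "B \<in> sets M"
    unfolding B_def by (rule comprehension) (rule definable_intros C(1) D(1))+
  moreover have "solves B k W \<longleftrightarrow> K k W \<and> L k W" for k W
  proof -
    have pair: "pair (pair (pair c s) l) k \<in> B \<longleftrightarrow>
        (if s = \<zero> then pair (pair c l) k \<in> C else pair (pair c l) k \<in> D)" for c s l
      by (auto simp: B_def)
    have other: "pair (pair d l) k \<in> B" if "\<nexists>c s. d = pair c s" for d l
      using that by (simp add: B_def)
    have "\<exists>l. lit W l" by (cases "\<zero> \<in> W") (metis lit_pair)+
    then have "solves B k W \<longleftrightarrow> (\<forall>c s. \<exists>l. pair (pair (pair c s) l) k \<in> B \<and> lit W l)"
      unfolding solves_def using other by metis
    also have "\<dots> \<longleftrightarrow> (\<forall>c s. if s = \<zero> then \<exists>l. pair (pair c l) k \<in> C \<and> lit W l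
        else \<exists>l. pair (pair c l) k \<in> D \<and> lit W l)"
      unfolding pair by (intro iff_allI) simp
    also have "\<dots> \<longleftrightarrow> solves C k W \<and> solves D k W"
    proof -
      have "(\<forall>s. if s = \<zero> then F else F') \<longleftrightarrow> F \<and> F'" for F F'
        using one_neq_zero(1) by (cases F; cases F'; simp; blast)
      then show ?thesis unfolding solves_def by blast
    qed
    finally show ?thesis by (simp add: C D)
  qed
  ultimately show ?thesis unfolding axiomatizable_def by blast
qed

lemma axiomatizable_True: "axiomatizable (\<lambda>k W. True)"
  using axiomatizable_all[OF clausal_const[of "\<lambda>_ _. True"]] by (simp add: definable_const)

lemma axiomatizable_ball:
  assumes "finite I" "\<And>i. i \<in> I \<Longrightarrow> axiomatizable (K i)"
  shows "axiomatizable (\<lambda>k W. \<forall>i\<in>I. K i k W)"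
  using assms by (induction I rule: finite_induct) (simp_all add: axiomatizable_True axiomatizable_conj)

lemma clausal_mem:
  assumes "definable M (\<lambda>e. e 0 = f (e 1))"
  shows "clausal (\<lambda>k c W. f c \<in> W)" "clausal (\<lambda>k c W. f c \<notin> W)"
  using clausal_pos[of "\<lambda>k c v. v = f c", OF assms] clausal_neg[of "\<lambda>k c v. v = f c", OF assms]
  by simp_all

lemma axiomatizable_iff:
  assumes "clausal (\<lambda>k c W. \<not> Q k c W)" "clausal Q" "clausal (\<lambda>k c W. \<not> R k c W)" "clausal R"
  shows "axiomatizable (\<lambda>k W. \<forall>c. Q k c W \<longleftrightarrow> R k c W)"
proof -
  have eq: "(\<forall>c. Q k c W \<longleftrightarrow> R k c W) \<longleftrightarrow>
      (\<forall>c. \<not> Q k c W \<or> R k c W) \<and> (\<forall>c. Q k c W \<or> \<not> R k c W)" for k W by blast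
  show ?thesis
    unfolding eq by (intro axiomatizable_conj axiomatizable_all clausal_disj assms)
qed

end

section \<open>Tarski's conditions as clauses\<close>

context hamilton_choice
begin

text \<open>The section of \<open>W\<close> at \<open>ix \<phi>\<close> is to be the truth set of \<open>\<phi>\<close>; those at 0 and 1 are the values
  of the set variables \<open>X\<close> and \<open>Z\<close>. The conditions are one step of Tarski's definition of truth.\<close>

definition tarski :: "(fm \<Rightarrow> nat) \<Rightarrow> nat \<Rightarrow> nat \<Rightarrow> nat \<Rightarrow> (nat \<Rightarrow> 'a set) \<Rightarrow> fm \<Rightarrow> 'a set \<Rightarrow> bool" where
  "tarski ix N X Z E \<phi> W \<longleftrightarrow> (case \<phi> of
     Mem t V \<Rightarrow> \<forall>b. pair b (num (ix \<phi>)) \<in> W \<longleftrightarrow>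
       (if V = Z then pair (eval M (dec b) t) (num 1) \<in> W
        else if V = X then pair (eval M (dec b) t) (num 0) \<in> W else eval M (dec b) t \<in> E V)
   | Neg \<psi> \<Rightarrow> \<forall>b. pair b (num (ix \<phi>)) \<in> W \<longleftrightarrow> pair b (num (ix \<psi>)) \<notin> W
   | And \<psi> \<chi> \<Rightarrow> \<forall>b. pair b (num (ix \<phi>)) \<in> W \<longleftrightarrow>
       pair b (num (ix \<psi>)) \<in> W \<and> pair b (num (ix \<chi>)) \<in> W
   | ExN x \<psi> \<Rightarrow> \<forall>b. pair b (num (ix \<phi>)) \<in> W \<longleftrightarrow>
       (\<exists>b'. agree_except N x b b' \<and> pair b' (num (ix \<psi>)) \<in> W)
   | _ \<Rightarrow> \<forall>b. pair b (num (ix \<phi>)) \<in> W \<longleftrightarrow> sat M (dec b) E \<phi>)"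

text \<open>Each condition is an equivalence that splits into clauses. Atomic truth not involving
  \<open>X\<close> or \<open>Z\<close> is independent of \<open>W\<close>; \<open>truth_set\<close>
  makes it definable, so it can enter by \<open>clausal_const\<close>.\<close>

lemma axiomatizable_tarski:
  assumes E: "range E \<subseteq> sets M" and "core \<phi>"
  shows "axiomatizable (\<lambda>k W. tarski ix N X Z E \<phi> W)"
proof -
  have def_code: "definable M (\<lambda>e. e 0 = pair (e 1) (num q))" for q
    by (rule definable_intros)+
  note code = clausal_mem[of "\<lambda>b. pair b (num q)" for q, OF def_code]
  have const: "axiomatizable (\<lambda>k W. \<forall>b. pair b (num q) \<in> W \<longleftrightarrow> T b)"
    if T: "definable M (\<lambda>e. T (e 0))" for q T
  proof -
    have "definable M (\<lambda>e. \<not> T (e 0))" using T by (rule definable_not)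
    then show ?thesis
      using T by (intro axiomatizable_iff) (simp_all add: code clausal_const)
  qed
  have atom: "definable M (\<lambda>e. sat M (dec (e 0)) E \<phi>)" if "core \<phi>" for \<phi>
  proof -
    obtain N where "nvars \<phi> \<subseteq> {..<N}" using nvars_bounded by blast
    from definable_mem[OF truth_set[OF E that this] definable_term_var] show ?thesis by simp
  qed
  have def_eval_code: "definable M (\<lambda>e. e 0 = pair (eval M (dec (e 1)) t) (num q))" for t q
  proof -
    have "definable M (\<lambda>e. \<exists>u c. e 0 = pair u c \<and> c = num q \<and> u = eval M (dec (e 1)) t)"
      by (rule definable_eval definable_intros)+
    then show ?thesis by simp
  qed
  note eval_code = clausal_mem[of "\<lambda>b. pair (eval M (dec b) t) (num q)" for t q, OF def_eval_code]
  show ?thesis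
  proof (cases \<phi>)
    case (Eq s t)
    then show ?thesis using const[OF atom[OF assms(2)]] by (simp add: tarski_def)
  next
    case (Less s t)
    then show ?thesis using const[OF atom[OF assms(2)]] by (simp add: tarski_def)
  next
    case (Mem t V)
    have var: "axiomatizable (\<lambda>k W. \<forall>b. pair b (num p) \<in> W \<longleftrightarrow> pair (eval M (dec b) t) (num q) \<in> W)"
      for p q
      by (intro axiomatizable_iff) (simp_all only: code eval_code)
    show ?thesis
    proof (cases "V = Z \<or> V = X")
      case True
      then show ?thesis using Mem var by (cases "V = Z") (simp_all add: tarski_def del: num_0 num_Suc One_nat_def)
    next
      case False
      then show ?thesis using Mem const[OF atom[OF assms(2)]] by (simp add: tarski_def)
    qed
  next
    case (Neg \<psi>)
    have "axiomatizable (\<lambda>k W. \<forall>b. pair b (num p) \<in> W \<longleftrightarrow> pair b (num q) \<notin> W)" for p q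
      by (intro axiomatizable_iff) (simp_all only: code not_not)
    then show ?thesis using Neg by (simp add: tarski_def)
  next
    case (And \<psi> \<chi>)
    have eq: "(\<forall>b. pair b (num p) \<in> W \<longleftrightarrow> pair b (num q) \<in> W \<and> pair b (num r) \<in> W) \<longleftrightarrow>
        (\<forall>b. pair b (num p) \<notin> W \<or> pair b (num q) \<in> W) \<and>
        (\<forall>b. pair b (num p) \<notin> W \<or> pair b (num r) \<in> W) \<and>
        (\<forall>b. pair b (num p) \<in> W \<or> pair b (num q) \<notin> W \<or> pair b (num r) \<notin> W)" for p q r W
      by blast
    have "axiomatizable (\<lambda>k W. \<forall>b. pair b (num p) \<in> W \<longleftrightarrow>
        pair b (num q) \<in> W \<and> pair b (num r) \<in> W)" for p q r
      unfolding eq by (intro axiomatizable_conj axiomatizable_all clausal_disj code)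
    then show ?thesis using And by (simp add: tarski_def)
  next
    case (ExN x \<psi>)
    define p q where "p = num (ix \<phi>)" and "q = num (ix \<psi>)"
    \<comment> \<open>For the existential quantifier, one direction is an infinite clause for each
      \<open>b\<close>, the other a clause for each pair of \<open>b\<close> and
      \<open>b'\<close>.\<close>
    have 1: "clausal (\<lambda>k c W. \<exists>v. (\<exists>b d. v = pair b d \<and> d = q \<and> agree_except N x c b) \<and> v \<in> W)"
      by (rule clausal_pos) (rule definable_agree_except definable_intros)+
    have 2: "clausal (\<lambda>k c W. \<exists>v. (\<exists>b b'. c = pair b b' \<and> v = pair b p) \<and> v \<in> W)"
      by (rule clausal_pos) (rule definable_intros)+
    have 3: "clausal (\<lambda>k c W. \<exists>v. (\<exists>b b'. c = pair b b' \<and> v = pair b' q) \<and> v \<notin> W)"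
      by (rule clausal_neg) (rule definable_intros)+
    have 4: "clausal (\<lambda>k c W. \<not> (\<exists>b b'. c = pair b b' \<and> agree_except N x b b'))"
      by (rule clausal_const) (rule definable_agree_except definable_intros)+
    have 5: "clausal (\<lambda>k c W. pair c p \<notin> W)" unfolding p_def by (rule code)
    have "axiomatizable (\<lambda>k W.
        (\<forall>c. pair c p \<notin> W \<or> (\<exists>v. (\<exists>b d. v = pair b d \<and> d = q \<and> agree_except N x c b) \<and> v \<in> W)) \<and>
        (\<forall>c. \<not> (\<exists>b b'. c = pair b b' \<and> agree_except N x b b') \<or>
          (\<exists>v. (\<exists>b b'. c = pair b b' \<and> v = pair b p) \<and> v \<in> W) \<or>
          (\<exists>v. (\<exists>b b'. c = pair b b' \<and> v = pair b' q) \<and> v \<notin> W)))" (is "axiomatizable (\<lambda>k W. ?K W)")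
      by (intro axiomatizable_conj axiomatizable_all clausal_disj 1 2 3 4 5)
    moreover have "?K W \<longleftrightarrow> (\<forall>b. pair b p \<in> W \<longleftrightarrow> (\<exists>b'. agree_except N x b b' \<and> pair b' q \<in> W))" for W
    proof -
      have left: "(\<exists>v. (\<exists>b d. v = pair b d \<and> d = q \<and> agree_except N x c b) \<and> v \<in> W) \<longleftrightarrow>
          (\<exists>b'. agree_except N x c b' \<and> pair b' q \<in> W)" for c
        by auto
      have right: "(\<not> (\<exists>b b'. c = pair b b' \<and> agree_except N x b b') \<or>
          (\<exists>v. (\<exists>b b'. c = pair b b' \<and> v = pair b p) \<and> v \<in> W) \<or>
          (\<exists>v. (\<exists>b b'. c = pair b b' \<and> v = pair b' q) \<and> v \<notin> W)) \<longleftrightarrow>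
          (\<forall>b b'. c = pair b b' \<longrightarrow> agree_except N x b b' \<longrightarrow> pair b p \<in> W \<or> pair b' q \<notin> W)" for c
        by (cases "\<exists>b b'. c = pair b b'") auto
      show ?thesis unfolding left right by blast
    qed
    ultimately show ?thesis using ExN by (simp add: tarski_def p_def q_def)
  qed (use assms(2) in simp_all)
qed

text \<open>An induction on subformulas outside the model. \<open>tarski\<close> tests for
  \<open>Z\<close> before \<open>X\<close>, just as the update at \<open>Z\<close> overrides the one
  at \<open>X\<close> should the two coincide.\<close>

lemma tarski_sound:
  assumes "core \<theta>" "nvars \<theta> \<subseteq> {..<N}" and T: "\<And>\<phi>. \<phi> \<in> subs \<theta> \<Longrightarrow> tarski ix N X Z E \<phi> W"
    and "\<phi> \<in> subs \<theta>"
  shows "pair b (num (ix \<phi>)) \<in> W \<longleftrightarrow>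
    sat M (dec b) (E(X := slice W (num 0), Z := slice W (num 1))) \<phi>"
  using assms(4) subs_core[OF assms(1,4)]
proof (induction \<phi> arbitrary: b)
  case (Eq s t)
  then show ?case using T[OF Eq.prems(1)] by (simp add: tarski_def)
next
  case (Less s t)
  then show ?case using T[OF Less.prems(1)] by (simp add: tarski_def)
next
  case (Mem t V)
  then show ?case using T[OF Mem.prems(1)] by (simp add: tarski_def)
next
  case (Neg \<phi>)
  have "\<phi> \<in> subs \<theta>" using subs_closed(1)[OF Neg.prems(1)] .
  then have "pair b (num (ix \<phi>)) \<in> W \<longleftrightarrow>
      sat M (dec b) (E(X := slice W (num 0), Z := slice W (num 1))) \<phi>"
    using Neg.prems(2) by (intro Neg.IH) simp_all
  moreover have "pair b (num (ix (\<^bold>\<not> \<phi>))) \<in> W \<longleftrightarrow> pair b (num (ix \<phi>)) \<notin> W"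
    using T[OF Neg.prems(1)] by (simp add: tarski_def)
  ultimately show ?case unfolding sat.simps by blast
next
  case (And \<phi> \<psi>)
  have "\<phi> \<in> subs \<theta>" "\<psi> \<in> subs \<theta>" using subs_closed(2)[OF And.prems(1)] by simp_all
  then have "pair b (num (ix \<phi>)) \<in> W \<longleftrightarrow>
      sat M (dec b) (E(X := slice W (num 0), Z := slice W (num 1))) \<phi>"
      "pair b (num (ix \<psi>)) \<in> W \<longleftrightarrow>
      sat M (dec b) (E(X := slice W (num 0), Z := slice W (num 1))) \<psi>"
    using And.prems(2) by (intro And.IH; simp)+
  moreover have "pair b (num (ix (\<phi> \<^bold>\<and> \<psi>))) \<in> W \<longleftrightarrow>
      pair b (num (ix \<phi>)) \<in> W \<and> pair b (num (ix \<psi>)) \<in> W"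
    using T[OF And.prems(1)] by (simp add: tarski_def)
  ultimately show ?case unfolding sat.simps by blast
next
  case (ExN x \<phi>)
  have "nvars (ExN x \<phi>) \<subseteq> {..<N}" using subs_nvars[OF ExN.prems(1)] assms(2) by blast
  note sat = sat_ExN_dec[OF this]
  have "\<phi> \<in> subs \<theta>" using subs_closed(3)[OF ExN.prems(1)] .
  then have IH: "pair b (num (ix \<phi>)) \<in> W \<longleftrightarrow>
      sat M (dec b) (E(X := slice W (num 0), Z := slice W (num 1))) \<phi>" for b
    using ExN.prems(2) by (intro ExN.IH) simp_all
  have "pair b (num (ix (ExN x \<phi>))) \<in> W \<longleftrightarrow>
      (\<exists>b'. agree_except N x b b' \<and> pair b' (num (ix \<phi>)) \<in> W)"
    using T[OF ExN.prems(1)] by (simp add: tarski_def)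
  then show ?case unfolding sat IH .
qed simp_all

text \<open>Finitely many truth sets are joined into one set. Indices from 2 on keep them apart from
  the values of \<open>X\<close> and \<open>Z\<close>, and injectivity of \<open>ix\<close> keeps
  them apart from each other.\<close>

lemma tarski_complete:
  assumes E: "range E \<subseteq> sets M" and AB: "A \<in> sets M" "B \<in> sets M"
    and \<theta>: "core \<theta>" "nvars \<theta> \<subseteq> {..<N}" and ix: "inj_on ix (subs \<theta>)" "\<And>\<phi>. 2 \<le> ix \<phi>"
  shows "\<exists>W\<in>sets M. slice W (num 0) = A \<and> slice W (num 1) = B \<and>
    (\<forall>\<phi>\<in>subs \<theta>. tarski ix N X Z E \<phi> W)"
proof -
  let ?E = "E(X := A, Z := B)"
  have "range ?E \<subseteq> sets M" using E AB by auto
  then have truth: "{b. sat M (dec b) ?E \<phi>} \<in> sets M" if "\<phi> \<in> subs \<theta>" for \<phi>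
    using truth_set[of ?E \<phi> N] subs_core[OF \<theta>(1) that] subs_nvars[OF that] \<theta>(2) by blast
  define W where "W = {z. \<exists>b c. z = pair b c \<and> (c = num 0 \<and> b \<in> A \<or> c = num 1 \<and> b \<in> B \<or>
      (\<exists>\<phi>\<in>subs \<theta>. c = num (ix \<phi>) \<and> b \<in> {b. sat M (dec b) ?E \<phi>}))}"
  have W: "W \<in> sets M"
    unfolding W_def
    by (rule comprehension) (rule definable_intros AB truth finite_subs | assumption)+
  have ix': "ix \<phi> \<noteq> 0" "ix \<phi> \<noteq> 1" for \<phi> using ix(2)[of \<phi>] by auto
  have W01: "pair b (num 0) \<in> W \<longleftrightarrow> b \<in> A" "pair b (num 1) \<in> W \<longleftrightarrow> b \<in> B" for b
    unfolding W_def by (auto simp add: ix' ix'[symmetric] simp del: num_0 num_Suc One_nat_def)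
  have W\<phi>: "pair b (num (ix \<phi>)) \<in> W \<longleftrightarrow> sat M (dec b) ?E \<phi>" if "\<phi> \<in> subs \<theta>" for b \<phi>
  proof -
    have "pair b (num (ix \<phi>)) \<in> W \<longleftrightarrow> (\<exists>\<psi>\<in>subs \<theta>. ix \<phi> = ix \<psi> \<and> sat M (dec b) ?E \<psi>)"
      unfolding W_def by (simp add: ix' del: num_0 num_Suc One_nat_def)
    then show ?thesis using that inj_onD[OF ix(1)] by metis
  qed
  have "tarski ix N X Z E \<phi> W" if \<phi>: "\<phi> \<in> subs \<theta>" for \<phi>
  proof -
    note W1 = W\<phi>[OF \<phi>]
    show ?thesis
    proof (cases \<phi>)
      case (Mem t V)
      show ?thesis
        using W1 unfolding Mem tarski_def fm.case W01 by simp
    next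
      case (Neg \<psi>)
      have "\<psi> \<in> subs \<theta>" using subs_closed(1) \<phi> Neg by blast
      then show ?thesis using W1 unfolding Neg tarski_def fm.case by (simp only: W\<phi> sat.simps; simp)
    next
      case (And \<psi> \<chi>)
      have "\<psi> \<in> subs \<theta>" "\<chi> \<in> subs \<theta>" using subs_closed(2) \<phi> And by blast+
      then show ?thesis using W1 unfolding And tarski_def fm.case by (simp only: W\<phi> sat.simps; simp)
    next
      case (ExN x \<psi>)
      have "\<psi> \<in> subs \<theta>" using subs_closed(3) \<phi> ExN by blast
      moreover have "nvars (ExN x \<psi>) \<subseteq> {..<N}" using subs_nvars[OF \<phi>] \<theta>(2) ExN by blast
      note sat_ExN_dec[OF this]
      ultimately show ?thesis using W1 unfolding ExN tarski_def fm.case by (simp only: W\<phi>; simp)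
    next
      case (Eq s t)
      show ?thesis using W1 unfolding Eq tarski_def fm.case by simp
    next
      case (Less s t)
      show ?thesis using W1 unfolding Less tarski_def fm.case by simp
    qed (use subs_core[OF \<theta>(1) \<phi>] in simp_all)
  qed
  moreover have "slice W (num 0) = A" "slice W (num 1) = B" unfolding slice_def W01 by simp_all
  ultimately show ?thesis using W by blast
qed

text \<open>\<open>Z\<close> plays the set variable bound in front of a member of
  \<open>Sigma11\<close>: its witness is chosen along with the value of \<open>X\<close>, which
  leaves an arithmetical condition on both.\<close>

lemma arithmetical_choice:
  assumes E: "range E \<subseteq> sets M" and \<theta>: "arithmetical \<theta>"
    and ex: "\<And>\<kappa>. \<exists>A\<in>sets M. \<exists>B\<in>sets M. sat M (e(k := \<kappa>)) (E(X := A, Z := B)) \<theta>"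
  shows "\<exists>Y\<in>sets M. \<forall>\<kappa>. sat M (e(k := \<kappa>))
    (E(X := slice (slice Y \<kappa>) (num 0), Z := slice (slice Y \<kappa>) (num 1))) \<theta>"
proof -
  let ?\<theta> = "nf \<theta>"
  have core: "core ?\<theta>" using \<theta> by (rule core_nf)
  obtain N where "nvars ?\<theta> \<subseteq> {..<N}" using nvars_bounded by blast
  then have N: "nvars ?\<theta> \<subseteq> {..<N}" .
  obtain f :: "fm \<Rightarrow> nat" where f: "inj_on f (subs ?\<theta>)"
    using finite_imp_inj_to_nat_seg[OF finite_subs] by blast
  define ix where "ix \<phi> = f \<phi> + 2" for \<phi>
  have ix: "inj_on ix (subs ?\<theta>)" "\<And>\<phi>. 2 \<le> ix \<phi>"
    using f by (auto simp: ix_def inj_on_def)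
  \<comment> \<open>An assignment is coded only below \<open>N\<close>, possibly by several numbers.
    Requiring truth at all of its codes gives one clause for each \<open>b\<close>.\<close>
  define codes where "codes \<kappa> b \<longleftrightarrow> \<not> (\<exists>i\<in>{..<N}. \<not> (\<exists>a. a \<prec> b \<oplus> \<one> \<and> a = dec b i \<and>
      (i = k \<and> a = \<kappa> \<or> i \<noteq> k \<and> a = e i)))" for \<kappa> b
  have codes: "codes \<kappa> b \<longleftrightarrow> (\<forall>i<N. dec b i = (e(k := \<kappa>)) i)" for \<kappa> b
    unfolding codes_def using dec_le by auto
  have def_codes: "definable M (\<lambda>e. codes (e 1) (e 0))"
    unfolding codes_def by (rule definable_intros definable_dec finite_lessThan)+
  have sat: "sat M (dec b) F ?\<theta> \<longleftrightarrow> sat M (e(k := \<kappa>)) F \<theta>" if "codes \<kappa> b" for \<kappa> b F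
    using sat_dec_cong[OF N, of b "e(k := \<kappa>)" F] that by (simp add: codes sat_nf)
  let ?K = "\<lambda>\<kappa> W. (\<forall>\<phi>\<in>subs ?\<theta>. tarski ix N X Z E \<phi> W) \<and>
      (\<forall>b. \<not> codes \<kappa> b \<or> pair b (num (ix ?\<theta>)) \<in> W)"
  have "axiomatizable ?K"
  proof (intro axiomatizable_conj axiomatizable_ball axiomatizable_tarski axiomatizable_all
      clausal_disj finite_subs E)
    show "core \<phi>" if "\<phi> \<in> subs ?\<theta>" for \<phi> using subs_core[OF core that] .
    show "clausal (\<lambda>\<kappa> b W. \<not> codes \<kappa> b)"
      by (rule clausal_const) (rule definable_not def_codes)+
    show "clausal (\<lambda>\<kappa> b W. pair b (num (ix ?\<theta>)) \<in> W)"
      by (rule clausal_mem) (rule definable_intros)+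
  qed
  then obtain C where C: "C \<in> sets M" "\<And>\<kappa> W. solves C \<kappa> W \<longleftrightarrow> ?K \<kappa> W"
    unfolding axiomatizable_def by blast
  have sound: "pair b (num (ix ?\<theta>)) \<in> W \<longleftrightarrow>
      sat M (dec b) (E(X := slice W (num 0), Z := slice W (num 1))) ?\<theta>"
    if "\<forall>\<phi>\<in>subs ?\<theta>. tarski ix N X Z E \<phi> W" for b W
    by (rule tarski_sound[OF core N _ subs_self]) (use that in blast)
  have "\<exists>W\<in>sets M. solves C \<kappa> W" for \<kappa>
  proof -
    obtain A B where AB: "A \<in> sets M" "B \<in> sets M" "sat M (e(k := \<kappa>)) (E(X := A, Z := B)) \<theta>"
      using ex by blast
    obtain W where W: "W \<in> sets M" "slice W (num 0) = A" "slice W (num 1) = B"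
        "\<forall>\<phi>\<in>subs ?\<theta>. tarski ix N X Z E \<phi> W"
      using tarski_complete[OF E AB(1,2) core N ix, of X Z] by blast
    have "pair b (num (ix ?\<theta>)) \<in> W" if "codes \<kappa> b" for b
      unfolding sound[OF W(4)] W(2,3) sat[OF that] by (rule AB(3))
    then show ?thesis using C(2) W(1,4) by blast
  qed
  then obtain Y where Y: "Y \<in> sets M" "\<And>\<kappa>. solves C \<kappa> (slice Y \<kappa>)"
    using clause_choice[OF C(1)] by blast
  have "sat M (e(k := \<kappa>)) (E(X := slice (slice Y \<kappa>) (num 0), Z := slice (slice Y \<kappa>) (num 1))) \<theta>"
    for \<kappa>
  proof -
    obtain b where b: "codes \<kappa> b" using dec_exists unfolding codes by blast
    have K: "?K \<kappa> (slice Y \<kappa>)" using Y(2) C(2) by blast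
    then have "pair b (num (ix ?\<theta>)) \<in> slice Y \<kappa>" using b by blast
    then show ?thesis using sound[OF conjunct1[OF K]] sat[OF b] by blast
  qed
  then show ?thesis using Y(1) by blast
qed

theorem Sigma11_AC0: "M \<Turnstile> Sigma11_AC0"
  unfolding models_def
proof (intro conjI ballI allI impI)
  fix \<phi> e and E :: "nat \<Rightarrow> 'a set"
  assume \<phi>: "\<phi> \<in> Sigma11_AC0" and E: "range E \<subseteq> sets M"
  show "sat M e E \<phi>"
  proof (cases "\<phi> \<in> RCA0")
    case True
    then show ?thesis using E by (rule satisfies)
  next
    case False
    with \<phi> obtain Z \<theta> k X Y i where \<theta>: "arithmetical \<theta>" "Y \<notin> fvS (ExS Z \<theta>)" "Y \<noteq> X" "i \<noteq> k"
      and \<phi>_eq: "\<phi> = (AllN k (ExS X (ExS Z \<theta>)) \<^bold>\<longrightarrow>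
        ExS Y (AllN k (ExS X (AllN i (Var i \<^bold>\<in> X \<^bold>\<longleftrightarrow> sec (setvar Y) (Var k) (Var i)) \<^bold>\<and> ExS Z \<theta>))))"
      unfolding Sigma11_AC0_def Sigma11_def by blast
    show ?thesis
      unfolding \<phi>_eq sat.simps
    proof
      assume "\<forall>\<kappa>. \<exists>A\<in>sets M. \<exists>B\<in>sets M. sat M (e(k := \<kappa>)) (E(X := A, Z := B)) \<theta>"
      then obtain U where U: "U \<in> sets M" "\<And>\<kappa>. sat M (e(k := \<kappa>))
          (E(X := slice (slice U \<kappa>) (num 0), Z := slice (slice U \<kappa>) (num 1))) \<theta>"
        using arithmetical_choice[OF E \<theta>(1)] by blast
      \<comment> \<open>The sections of \<open>U\<close> are whole families of truth sets;
        \<open>B\<close> keeps only the values of \<open>X\<close>.\<close>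
      define B where "B = {z. \<exists>a \<kappa>. z = pair a \<kappa> \<and> pair (pair a (num 0)) \<kappa> \<in> U}"
      have B: "B \<in> sets M" unfolding B_def by (rule comprehension) (rule definable_intros U)+
      show "\<exists>B\<in>sets M. \<forall>\<kappa>. \<exists>A\<in>sets M.
          (\<forall>a. (eval M (e(k := \<kappa>, i := a)) (Var i) \<in> (E(Y := B, X := A)) X) =
            sat M (e(k := \<kappa>, i := a)) (E(Y := B, X := A)) (sec (setvar Y) (Var k) (Var i))) \<and>
          (\<exists>D\<in>sets M. sat M (e(k := \<kappa>)) (E(Y := B, X := A, Z := D)) \<theta>)"
      proof (rule bexI[OF _ B], rule allI)
        fix \<kappa>
        let ?A = "slice (slice U \<kappa>) (num 0)" and ?D = "slice (slice U \<kappa>) (num 1)"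
        have "sat M (e(k := \<kappa>)) (E(Y := B, X := ?A, Z := ?D)) \<theta> \<longleftrightarrow>
            sat M (e(k := \<kappa>)) (E(X := ?A, Z := ?D)) \<theta>"
          by (rule sat_cong) (use \<theta>(2) in auto)
        then have "sat M (e(k := \<kappa>)) (E(Y := B, X := ?A, Z := ?D)) \<theta>" using U(2) by blast
        moreover have "?A \<in> sets M" "?D \<in> sets M" using U(1) slice_sets by blast+
        moreover have "a \<in> ?A \<longleftrightarrow> pair a \<kappa> \<in> B" for a by (simp add: B_def)
        ultimately show "\<exists>A\<in>sets M.
          (\<forall>a. (eval M (e(k := \<kappa>, i := a)) (Var i) \<in> (E(Y := B, X := A)) X) =
            sat M (e(k := \<kappa>, i := a)) (E(Y := B, X := A)) (sec (setvar Y) (Var k) (Var i))) \<and>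
          (\<exists>D\<in>sets M. sat M (e(k := \<kappa>)) (E(Y := B, X := A, Z := D)) \<theta>)"
          using \<theta>(3,4) by (intro bexI[of _ ?A] conjI bexI[of _ ?D]) (simp_all add: sec_def setvar_def)
      qed
    qed
  qed
qed (rule sets_nonempty)

end

section \<open>From choice to Hamilton paths, and the equivalence\<close>

lemma (in rca) sat_sec:
  "sat M e E (sec (setvar Y) s t) \<longleftrightarrow> pair (eval M e t) (eval M e s) \<in> E Y"
  by (simp add: sec_def setvar_def)

lemma (in rca) hamilton_sequences_of_Sigma11_AC0:
  assumes AC: "M \<Turnstile> Sigma11_AC0"
  shows "M \<Turnstile> {hamilton_sequences}"
  unfolding hamilton_sequences_iff
proof (intro ballI impI)
  fix G assume G: "G \<in> sets M"
    and ex: "\<forall>i. is_graph (slice G i) \<and> (\<exists>P\<in>sets M. is_hamilton_path (slice G i) P)"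
  let ?\<theta> = "hamilton_path_fm (sec (setvar 0) (Var 0)) (setvar 1)"
  \<comment> \<open>Set variable 0 holds the graphs, 1 a path and 3 the chosen sequence. The vacuous
    quantifier over 2 brings the arithmetical formula into \<open>Sigma11\<close>.\<close>
  let ?\<phi> = "AllN 0 (ExS 1 (ExS 2 ?\<theta>)) \<^bold>\<longrightarrow>
    ExS 3 (AllN 0 (ExS 1 (AllN 1 (Var 1 \<^bold>\<in> 1 \<^bold>\<longleftrightarrow> sec (setvar 3) (Var 0) (Var 1)) \<^bold>\<and> ExS 2 ?\<theta>)))"
  have "arithmetical ?\<theta>" "3 \<notin> fvS ?\<theta>"
    by (simp_all add: hamilton_path_fm_def path_fm_def vertices_def edges_def sec_def setvar_def Let_def)
  then have "ExS 2 ?\<theta> \<in> Sigma11" "3 \<notin> fvS (ExS 2 ?\<theta>)" unfolding Sigma11_def by auto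
  then have "?\<phi> \<in> Sigma11_AC0"
    unfolding Sigma11_AC0_def
    by (intro UnI2 CollectI exI[of _ "ExS 2 ?\<theta>"] exI[of _ 0] exI[of _ 1] exI[of _ 3]) simp
  moreover have "range (\<lambda>_. G) \<subseteq> sets M" using G by simp
  ultimately have "sat M (\<lambda>_. \<zero>) (\<lambda>_. G) ?\<phi>" using AC unfolding models_def by blast
  then have imp: "(\<forall>i. \<exists>P\<in>sets M. is_hamilton_path (slice G i) P) \<longrightarrow> (\<exists>Y\<in>sets M. \<forall>i. \<exists>P\<in>sets M.
      (\<forall>a. a \<in> P \<longleftrightarrow> pair a i \<in> Y) \<and> is_hamilton_path (slice G i) P)"
    by (simp add: sat_hamilton_path_fm sat_sec sets_nonempty ex_in_conv)
  have "\<forall>i. \<exists>P\<in>sets M. is_hamilton_path (slice G i) P" using ex by simp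
  from imp this have "\<exists>Y\<in>sets M. \<forall>i. \<exists>P\<in>sets M.
      (\<forall>a. a \<in> P \<longleftrightarrow> pair a i \<in> Y) \<and> is_hamilton_path (slice G i) P" by (rule mp)
  then obtain Y where Y: "Y \<in> sets M" and paths: "\<forall>i. \<exists>P\<in>sets M.
      (\<forall>a. a \<in> P \<longleftrightarrow> pair a i \<in> Y) \<and> is_hamilton_path (slice G i) P" ..
  have "is_hamilton_path (slice G i) (slice Y i)" for i
  proof -
    obtain P where P: "\<forall>a. a \<in> P \<longleftrightarrow> pair a i \<in> Y" "is_hamilton_path (slice G i) P"
      using paths[THEN spec, of i] by (auto simp only: bex_simps Bex_def)
    have "P = slice Y i" using P(1) by (simp add: set_eq_iff)
    then show ?thesis using P(2) by simp
  qed
  then show "\<exists>P\<in>sets M. \<forall>i. is_hamilton_path (slice G i) (slice P i)" using Y by blast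
qed

theorem theorem26:
  fixes M :: "'a L2_structure"
  assumes "M \<Turnstile> RCA0"
  shows "M \<Turnstile> Sigma11_AC0 \<longleftrightarrow> M \<Turnstile> {hamilton_sequences}"
proof -
  interpret rca M using assms by unfold_locales
  show ?thesis
  proof
    assume "M \<Turnstile> Sigma11_AC0"
    then show "M \<Turnstile> {hamilton_sequences}" by (rule hamilton_sequences_of_Sigma11_AC0)
  next
    assume "M \<Turnstile> {hamilton_sequences}"
    then have H: "\<forall>G\<in>sets M.
        (\<forall>i. is_graph (slice G i) \<and> (\<exists>P\<in>sets M. is_hamilton_path (slice G i) P)) \<longrightarrow>
        (\<exists>P\<in>sets M. \<forall>i. is_hamilton_path (slice G i) (slice P i))"
      unfolding hamilton_sequences_iff .
    interpret hamilton_choice M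
    proof unfold_locales
      fix G assume "G \<in> sets M"
        and ex: "\<And>i. is_graph (slice G i) \<and> (\<exists>P\<in>sets M. is_hamilton_path (slice G i) P)"
      from bspec[OF H this(1)] show "\<exists>P\<in>sets M. \<forall>i. is_hamilton_path (slice G i) (slice P i)"
        by (rule mp) (intro allI ex)
    qed
    show "M \<Turnstile> Sigma11_AC0" by (rule Sigma11_AC0)
  qed
qed

end
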